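(* Let $\mathbb{G}$ be a group of Heisenberg type and let $s\in(0,1)$. Then for every $g\in\mathbb{G}$ and every $y>0$ one has $$\mathscr L_s\big(\mathfrak e_{(s)}(\cdot,y)\big)(g)=(2\pi y)^{2s}\,\mathfrak e_{(-s)}(g,y).$$
   Context: Group of Heisenberg type. Let $\mathfrak g=V_1\oplus V_2$ be a (real, finite-dimensional) Lie algebra with $[V_1,V_1]=V_2$, $[V_1,V_2]=\{0\}$, endowed with an inner product $\langle\cdot,\cdot\rangle$ with norm $|\cdot|$ (and $V_1\perp V_2$), $m=\dim V_1$, $k=\dim V_2\ge 1$. The Kaplan map $J:V_2\to \mathrm{End}(V_1)$ is defined by $\langle J(\sigma)z,\zeta\rangle=\langle[z,\zeta],\sigma\rangle$ for $z,\zeta\in V_1$, $\sigma\in V_2$. The simply connected Lie group $\mathbb G$ with Lie algebra $\mathfrak g$ is of Heisenberg type if $J(\sigma)^2=-|\sigma|^2\,\mathbb I_{V_1}$ for every $\sigma\in V_2$ (then $m$ is even). Fixing orthonormal bases $\{e_1,\dots,e_m\}$ of $V_1$ and $\{\varepsilon_1,\dots,\varepsilon_k\}$ of $V_2$, one identifies $g=\exp(z+\sigma)\in\mathbb G$ with its logarithmic coordinates $(z,\sigma)\in\mathbb R^m\times\mathbb R^k$. The group law is $$(z,\sigma)\circ(\zeta,\tau)=\Big(z+\zeta,\ \sigma+\tau+\tfrac12\sum_{\ell=1}^k\langle J(\varepsilon_\ell)z,\zeta\rangle\varepsilon_\ell\Big),$$ with identity $(0,0)$ and $(z,\sigma)^{-1}=(-z,-\sigma)$;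 $dg=dz\,d\sigma$ is Lebesgue (Haar) measure. Kernels. For $0<s<1$, $t>0$, $y\ge 0$ and each choice of sign, $$q_{(\pm s)}((z,\sigma),t,y)=\frac{2^k}{(4\pi t)^{\frac m2+k+1\mp s}}\int_{\mathbb R^k}e^{-\frac it\langle\sigma,\lambda\rangle}\Big(\frac{|\lambda|}{\sinh|\lambda|}\Big)^{\frac m2+1\mp s}e^{-\frac{|z|^2+y^2}{4t}\frac{|\lambda|}{\tanh|\lambda|}}\,d\lambda,$$ and for $y>0$ $$\mathfrak e_{(\pm s)}((z,\sigma),y)=\int_0^\infty q_{(\pm s)}((z,\sigma),t,y)\,dt.$$ The operator $\mathscr L_s$. Let $X_j$ be the left-invariant vector fields on $\mathbb G$ with $X_j(e)=e_j$, let $\mathscr L=\sum_{j=1}^mX_j^2$ be the horizontal Laplacian, and $\Delta_\sigma$ the Euclidean Laplacian in $\sigma\in\mathbb R^k$. For $0<s<1$ the conformal fractional horizontal Laplacian is given spectrally by $$\mathscr L_s=2^s(-\Delta_\sigma)^{s/2}\,\frac{\Gamma\big(-\frac12\mathscr L(-\Delta_\sigma)^{-1/2}+\frac{1+s}2\big)}{\Gamma\big(-\frac12\mathscr L(-\Delta_\sigma)^{-1/2}+\frac{1-s}2\big)}.$$ It has the following equivalent pointwise representation, which is the meaning of $\mathscr L_su(g)$ to be used here for smooth functions $u$ with suitable decay at infinity, such as $u=\mathfrak e_{(s)}(\cdot,y)$: $$\mathscr L_su(g)=-\frac{s}{\Gamma(1-s)}\int_0^\infty\frac1{t^{1+s}}\big[P_{(-s),t}u(g)-u(g)\big]\,dt,$$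 where $$P_{(-s),t}u(g)=\int_{\mathbb G}\mathscr K_{(-s)}\big((g')^{-1}\circ g,t\big)u(g')\,dg',\qquad \mathscr K_{(-s)}((z,\sigma),t)=(4\pi t)^{1+s}q_{(-s)}((z,\sigma),t,0).$$ *)

theory Defs
  imports "HOL-Analysis.Analysis"
begin

text \<open>
  The Lie algebra is modelled on the product \<open>'a \<times> 'b\<close> of two Euclidean spaces, with
  \<open>V\<^sub>1 = 'a \<times> {0}\<close>, \<open>V\<^sub>2 = {0} \<times> 'b\<close>; the product inner product makes them orthogonal.
  Points of the simply connected group are written in logarithmic coordinates, so they are
  elements \<open>(z, \<sigma>)\<close> of the same type. Here \<open>m = DIM('a)\<close> and \<open>k = DIM('b)\<close>, and the
  orthonormal bases are the \<open>Basis\<close> sets of the two types.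
\<close>

definition lie_bracket :: "('g::real_vector \<Rightarrow> 'g \<Rightarrow> 'g) \<Rightarrow> bool" where
  "lie_bracket br \<longleftrightarrow> bilinear br \<and> (\<forall>x. br x x = 0) \<and>
     (\<forall>x y w. br x (br y w) + br y (br w x) + br w (br x y) = 0)"

definition V1 :: "('a::euclidean_space \<times> 'b::euclidean_space) set" where
  "V1 = range (\<lambda>z. (z, 0))"

definition V2 :: "('a::euclidean_space \<times> 'b::euclidean_space) set" where
  "V2 = range (\<lambda>\<sigma>. (0, \<sigma>))"

text \<open>
  The map \<open>\<zeta> \<mapsto> [z, \<zeta>]\<close> from \<open>V\<^sub>1\<close> to \<open>V\<^sub>2\<close> has \<open>\<sigma> \<mapsto> J(\<sigma>)z\<close> as its adjoint; see
  \<open>kaplan_inner\<close> below for the usual defining identity.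
\<close>

definition kaplan ::
  "('a::euclidean_space \<times> 'b::euclidean_space \<Rightarrow> 'a \<times> 'b \<Rightarrow> 'a \<times> 'b) \<Rightarrow> 'b \<Rightarrow> 'a \<Rightarrow> 'a" where
  "kaplan br \<sigma> z = adjoint (\<lambda>\<zeta>. snd (br (z, 0) (\<zeta>, 0))) \<sigma>"

definition heisenberg_type ::
  "('a::euclidean_space \<times> 'b::euclidean_space \<Rightarrow> 'a \<times> 'b \<Rightarrow> 'a \<times> 'b) \<Rightarrow> bool" where
  "heisenberg_type br \<longleftrightarrow> lie_bracket br \<and>
     span {br u v | u v. u \<in> V1 \<and> v \<in> V1} = V2 \<and>
     (\<forall>u\<in>V1. \<forall>v\<in>V2. br u v = 0) \<and>
     (\<forall>\<sigma> z. kaplan br \<sigma> (kaplan br \<sigma> z) = - ((norm \<sigma>)\<^sup>2 *\<^sub>R z))"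

definition gmul ::
  "('a::euclidean_space \<times> 'b::euclidean_space \<Rightarrow> 'a \<times> 'b \<Rightarrow> 'a \<times> 'b) \<Rightarrow>
    'a \<times> 'b \<Rightarrow> 'a \<times> 'b \<Rightarrow> 'a \<times> 'b" where
  "gmul br g h = (case g of (z, \<sigma>) \<Rightarrow> case h of (\<zeta>, \<tau>) \<Rightarrow>
     (z + \<zeta>, \<sigma> + \<tau> + (1/2) *\<^sub>R (\<Sum>\<epsilon>\<in>Basis. (kaplan br \<epsilon> z \<bullet> \<zeta>) *\<^sub>R \<epsilon>)))"

definition ginv :: "'a::euclidean_space \<times> 'b::euclidean_space \<Rightarrow> 'a \<times> 'b" where
  "ginv g = (case g of (z, \<sigma>) \<Rightarrow> (- z, - \<sigma>))"

text \<open>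
  The real parameter \<open>r\<close> carries the sign: \<open>q_kernel s\<close> is \<open>q\<^bsub>(+s)\<^esub>\<close> and
  \<open>q_kernel (-s)\<close> is \<open>q\<^bsub>(-s)\<^esub>\<close>. In the integrand both quotients are \<open>0/0 = 0\<close> at
  \<open>\<lambda> = 0\<close> instead of their limit \<open>1\<close>; this is a single point, hence a null set as
  \<open>k \<ge> 1\<close>. Kernels are complex valued because of the oscillating exponential.
\<close>

definition q_kernel ::
  "real \<Rightarrow> 'a::euclidean_space \<times> 'b::euclidean_space \<Rightarrow> real \<Rightarrow> real \<Rightarrow> complex" where
  "q_kernel r g t y = (case g of (z, \<sigma>) \<Rightarrow>
     complex_of_real (2 ^ DIM('b) / (4 * pi * t) powr (real DIM('a) / 2 + real DIM('b) + 1 - r)) *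
     (LINT l|lborel.
        exp (- (\<i> / complex_of_real t) * complex_of_real (\<sigma> \<bullet> l)) *
        complex_of_real ((norm l / sinh (norm l)) powr (real DIM('a) / 2 + 1 - r)) *
        complex_of_real (exp (- (((norm z)\<^sup>2 + y\<^sup>2) / (4 * t)) * (norm l / tanh (norm l))))))"

definition e_kernel ::
  "real \<Rightarrow> 'a::euclidean_space \<times> 'b::euclidean_space \<Rightarrow> real \<Rightarrow> complex" where
  "e_kernel r g y = (LINT t:{0<..}|lborel. q_kernel r g t y)"

text \<open>\<open>K_kernel s\<close> and \<open>P_op br s\<close> are \<open>K\<^bsub>(-s)\<^esub>\<close> and \<open>P\<^bsub>(-s)\<^esub>\<close>.\<close>

definition K_kernel ::
  "real \<Rightarrow> 'a::euclidean_space \<times> 'b::euclidean_space \<Rightarrow> real \<Rightarrow> complex" where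
  "K_kernel s g t = complex_of_real ((4 * pi * t) powr (1 + s)) * q_kernel (- s) g t 0"

definition P_op ::
  "('a::euclidean_space \<times> 'b::euclidean_space \<Rightarrow> 'a \<times> 'b \<Rightarrow> 'a \<times> 'b) \<Rightarrow> real \<Rightarrow> real \<Rightarrow>
    ('a \<times> 'b \<Rightarrow> complex) \<Rightarrow> 'a \<times> 'b \<Rightarrow> complex" where
  "P_op br s t u g = (LINT g'|lborel. K_kernel s (gmul br (ginv g') g) t * u g')"

text \<open>The conformal fractional horizontal Laplacian, in its pointwise representation.\<close>

definition conf_frac_Laplacian ::
  "('a::euclidean_space \<times> 'b::euclidean_space \<Rightarrow> 'a \<times> 'b \<Rightarrow> 'a \<times> 'b) \<Rightarrow> real \<Rightarrow>
    ('a \<times> 'b \<Rightarrow> complex) \<Rightarrow> 'a \<times> 'b \<Rightarrow> complex" where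
  "conf_frac_Laplacian br s u g =
     - complex_of_real (s / Gamma (1 - s)) *
     (LINT t:{0<..}|lborel. complex_of_real (1 / t powr (1 + s)) * (P_op br s t u g - u g))"

lemma kaplan_inner:
  fixes br :: "'a::euclidean_space \<times> 'b::euclidean_space \<Rightarrow> 'a \<times> 'b \<Rightarrow> 'a \<times> 'b"
  assumes "lie_bracket br"
  shows "kaplan br \<sigma> z \<bullet> \<zeta> = snd (br (z, 0) (\<zeta>, 0)) \<bullet> \<sigma>"
proof -
  have br: "linear (br (z, 0))"
    using assms by (simp add: lie_bracket_def bilinear_def)
  have "linear (\<lambda>\<zeta>::'a. snd (br (z, 0) (\<zeta>, 0)))"
  proof (rule linearI)
    fix x y :: 'a and c :: real
    show "snd (br (z, 0) (x + y, 0)) = snd (br (z, 0) (x, 0)) + snd (br (z, 0) (y, 0))"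
      using linear_add[OF br, of "(x, 0)" "(y, 0)"] by simp
    show "snd (br (z, 0) (c *\<^sub>R x, 0)) = c *\<^sub>R snd (br (z, 0) (x, 0))"
      using linear_scale[OF br, of c "(x, 0)"] by simp
  qed
  from adjoint_works[OF this] show ?thesis
    by (simp add: kaplan_def inner_commute)
qed

end

theory Submission
  imports Defs "HOL-Probability.Characteristic_Functions"
begin

text \<open>
  Take the Fourier transform in the central variable \<open>\<sigma>\<close>, with dual variable \<open>\<mu>\<close> and \<open>\<rho> = |\<mu>|\<close>.
  After the substitution \<open>\<lambda> = t\<mu>\<close> the kernels become superpositions over \<open>t > 0\<close> of the
  functions \<open>(\<rho> / sinh \<rho>t)\<^sup>a exp (- c \<rho> coth \<rho>t)\<close>. Group convolution becomes a twisted convolution of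
  Gaussians in \<open>z\<close>, for which \<open>(\<rho> / sinh \<rho>t)\<^bsup>m/2\<^esup> exp (- |z|\<^sup>2/4 \<rho> coth \<rho>t)\<close> is a
  semigroup up to constants; here \<open>J(\<mu>)\<^sup>2 = - |\<mu>|\<^sup>2\<close> enters. Hence for each total time \<open>T\<close> and each
  \<open>\<mu>\<close> the claim reduces to evaluating a regularised one-dimensional integral over \<open>0 < t < T\<close>, which
  the substitution \<open>v = \<rho> coth \<rho>(T - t) - \<rho> coth \<rho>T\<close> turns into
  \<open>\<integral> v\<^bsup>-1-s\<^esup> exp (- c v) dv = \<Gamma>(-s) c\<^sup>s\<close> with \<open>c = y\<^sup>2/4\<close>, understood as a finite part.
\<close>

section \<open>Hyperbolic functions\<close>

text \<open>Put n = m/2. The exponents n + 1 + s of the convolution kernel and n + 1 - s of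
  \<open>e_kernel s\<close> are split into n and a rest. The parts n are consumed, together with the
  Gaussians in the horizontal variable, by the semigroup law; the rests 1 + s and 1 - s stay in the
  time integral. The Jacobian of the substitution is the square of \<open>hs \<rho> (T - t)\<close>,
  and this is why an exponent 1 + s at time T comes out, the one of \<open>e_kernel (- s)\<close>.
  Two obstacles shape the analysis. The convolution in the centre pairs two Fourier transforms for
  which no pointwise decay is at hand, so it is treated in L^2. And t^(-1-s) is not integrable at 0,
  so the exchange with the t integral has to act on the difference P u - u, under a bound that gains
  \<open>min 1 t\<close> and stays integrable in T and \<mu>. The factor (2 pi y)^(2s) is (4
  pi)^(2s), the ratio of the kernel constants, times c^s = (y/2)^(2s).\<close>

text \<open>At \<open>\<rho> = 0\<close> both functions take their limit, so that the addition theorems and the bounds need no exception.\<close>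

definition hs :: "real \<Rightarrow> real \<Rightarrow> real" where
  "hs \<rho> t = (if \<rho> = 0 then 1 / t else \<rho> / sinh (\<rho> * t))"

definition hc :: "real \<Rightarrow> real \<Rightarrow> real" where
  "hc \<rho> t = (if \<rho> = 0 then 1 / t else \<rho> / tanh (\<rho> * t))"

lemma hs_measurable [measurable]:
  assumes [measurable]: "f \<in> borel_measurable M" "g \<in> borel_measurable M"
  shows "(\<lambda>x. hs (f x) (g x)) \<in> borel_measurable M"
proof -
  have [measurable]: "(sinh :: real \<Rightarrow> real) \<in> borel_measurable borel"
    by (intro borel_measurable_continuous_onI continuous_intros)
  show ?thesis unfolding hs_def by measurable
qed

lemma hc_measurable [measurable]:
  assumes [measurable]: "f \<in> borel_measurable M" "g \<in> borel_measurable M"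
  shows "(\<lambda>x. hc (f x) (g x)) \<in> borel_measurable M"
proof -
  have [measurable]: "(tanh :: real \<Rightarrow> real) \<in> borel_measurable borel"
    by (intro borel_measurable_continuous_onI continuous_intros) auto
  show ?thesis unfolding hc_def by measurable
qed

lemma sinh_ge_self: "x \<le> sinh x" if "0 \<le> x" for x :: real
proof -
  have "(\<lambda>x. sinh x - x) 0 \<le> (\<lambda>x. sinh x - x) x"
    by (rule DERIV_nonneg_imp_nondecreasing[OF that])
      (auto intro!: derivative_eq_intros exI simp: cosh_real_ge_1)
  then show ?thesis by simp
qed

lemma sinh_le_self_times_cosh: "sinh x \<le> x * cosh x" if "0 \<le> x" for x :: real
proof -
  have "(\<lambda>x. x * cosh x - sinh x) 0 \<le> (\<lambda>x. x * cosh x - sinh x) x"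
    by (rule DERIV_nonneg_imp_nondecreasing[OF that])
      (auto intro!: derivative_eq_intros exI)
  then show ?thesis by simp
qed

context
  fixes \<rho> t :: real
  assumes rho: "0 \<le> \<rho>" and t: "0 < t"
begin

lemma hs_pos: "0 < hs \<rho> t"
  using rho t by (auto simp: hs_def intro!: divide_pos_pos)

lemma hc_pos: "0 < hc \<rho> t"
  using rho t by (auto simp: hc_def intro!: divide_pos_pos)

lemma hs_le_inverse: "hs \<rho> t \<le> 1 / t"
  using rho t sinh_ge_self[of "\<rho> * t"] by (auto simp: hs_def field_simps)

lemma hs_le_hc: "hs \<rho> t \<le> hc \<rho> t"
proof (cases "\<rho> = 0")
  case False
  then have "sinh (\<rho> * t) > 0" using rho t by simp
  then have "\<rho> * 1 \<le> \<rho> * cosh (\<rho> * t)"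
    using rho by (intro mult_left_mono) (auto simp: cosh_real_ge_1)
  then show ?thesis using False \<open>sinh (\<rho> * t) > 0\<close>
    by (auto simp: hs_def hc_def tanh_def field_simps)
qed (auto simp: hs_def hc_def)

lemma inverse_le_hc: "1 / t \<le> hc \<rho> t"
proof (cases "\<rho> = 0")
  case False
  then have "sinh (\<rho> * t) > 0" using rho t by simp
  moreover have "sinh (\<rho> * t) \<le> \<rho> * t * cosh (\<rho> * t)"
    by (rule sinh_le_self_times_cosh) (use rho t in auto)
  ultimately show ?thesis using False t
    by (auto simp: hc_def tanh_def field_simps)
qed (auto simp: hc_def)

lemma rho_le_hc: "\<rho> \<le> hc \<rho> t"
proof (cases "\<rho> = 0")
  case False
  then have *: "tanh (\<rho> * t) > 0" using rho t by simp
  have "tanh (\<rho> * t) < 1" by (rule tanh_real_lt_1)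
  then have "\<rho> * tanh (\<rho> * t) \<le> \<rho> * 1"
    by (intro mult_left_mono) (use rho in auto)
  then show ?thesis using False * by (auto simp: hc_def field_simps)
qed (use t in \<open>auto simp: hc_def\<close>)

text \<open>Halving the argument, sinh 2x = 2 sinh x cosh x with sinh x >= x and cosh x >= exp x /
  2, keeps the factor 1/t and still gains exponential decay in \<rho>. This decay makes the kernels
  integrable in the dual variable.\<close>

lemma hs_exp_decay: "hs \<rho> t \<le> 2 / t * exp (- (\<rho> * t / 2))"
proof (cases "\<rho> = 0")
  case False
  define x where "x = \<rho> * t / 2"
  have x: "x > 0" using False rho t by (simp add: x_def)
  have "x * (exp x / 2) \<le> sinh x * cosh x"
    by (intro mult_mono) (use x in \<open>auto simp: sinh_ge_self cosh_def\<close>)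
  then have "x * exp x \<le> sinh (2 * x)" by (simp add: sinh_double)
  moreover have "hs \<rho> t = 2 * x / (t * sinh (2 * x))"
    using False t by (simp add: hs_def x_def)
  moreover have "sinh (2 * x) > 0" using x by simp
  ultimately have "hs \<rho> t \<le> 2 * x / (t * (x * exp x))"
    using t x by (simp only:) (intro divide_left_mono mult_left_mono mult_pos_pos, auto)
  also have "\<dots> = 2 / t * exp (- x)" using x by (simp add: exp_minus field_simps)
  finally show ?thesis by (simp add: x_def)
qed (use t in \<open>auto simp: hs_def field_simps\<close>)

text \<open>Near t = 0 powers of \<open>t * hs \<rho> t\<close> will be compared with 1, and an
  error linear in \<rho> t is good enough. With x = \<rho> t the claim reads sinh x (1 - x) <= x;
  the derivative of the difference is nonnegative because cosh u (1 - u) <= exp u exp (- u) =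
  1.\<close>

lemma hs_ge: "1 - \<rho> * t \<le> t * hs \<rho> t"
proof (cases "\<rho> = 0")
  case False
  define x where "x = \<rho> * t"
  have x: "x > 0" using False rho t by (simp add: x_def)
  have "sinh x * (1 - x) \<le> x"
  proof -
    have "(\<lambda>x. x - sinh x * (1 - x)) 0 \<le> (\<lambda>x. x - sinh x * (1 - x)) x"
    proof (rule DERIV_nonneg_imp_nondecreasing[OF less_imp_le[OF x]])
      fix u :: real assume u: "0 \<le> u"
      have "cosh u * (1 - u) \<le> exp u * exp (- u)"
      proof (cases "u \<le> 1")
        case True
        have "1 - u \<le> exp (- u)" using exp_ge_add_one_self[of "-u"] by simp
        moreover have "cosh u \<le> exp u" using u by (simp add: cosh_def)
        ultimately show ?thesis using True by (intro mult_mono) auto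
      next
        case False
        then have "cosh u * (1 - u) \<le> 0" by (intro mult_nonneg_nonpos) auto
        then show ?thesis by (simp add: exp_minus)
      qed
      then have "0 \<le> 1 - (cosh u * (1 - u) - sinh u)"
        using u sinh_ge_self[of u] by (simp add: exp_minus)
      moreover have "((\<lambda>x. x - sinh x * (1 - x)) has_real_derivative
          1 - (cosh u * (1 - u) - sinh u)) (at u)"
        by (auto intro!: derivative_eq_intros)
      ultimately show "\<exists>y. ((\<lambda>x. x - sinh x * (1 - x)) has_real_derivative y) (at u) \<and> 0 \<le> y"
        by blast
    qed
    then show ?thesis by simp
  qed
  then have "1 - x \<le> x / sinh x" using x by (simp add: field_simps)
  also have "x / sinh x = t * hs \<rho> t" using False by (simp add: hs_def x_def)
  finally show ?thesis by (simp add: x_def)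
qed (use t in \<open>auto simp: hs_def\<close>)

lemma hs_has_derivative: "(hs \<rho> has_real_derivative - (hs \<rho> t * hc \<rho> t)) (at t)"
proof (cases "\<rho> = 0")
  case True
  have "((\<lambda>t. 1 / t) has_real_derivative - (hs \<rho> t * hc \<rho> t)) (at t)"
    using True t by (auto intro!: derivative_eq_intros simp: hs_def hc_def power2_eq_square)
  then show ?thesis by (simp add: hs_def [abs_def] True)
next
  case False
  then have "sinh (\<rho> * t) > 0" using rho t by simp
  then have "((\<lambda>t. \<rho> / sinh (\<rho> * t)) has_real_derivative - (hs \<rho> t * hc \<rho> t)) (at t)"
    using False
    by (auto intro!: derivative_eq_intros simp: hs_def hc_def power2_eq_square tanh_def)
  then show ?thesis by (simp add: hs_def [abs_def] False)
qed

lemma hc_has_derivative: "(hc \<rho> has_real_derivative - ((hs \<rho> t)\<^sup>2)) (at t)"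
proof (cases "\<rho> = 0")
  case True
  have "((\<lambda>t. 1 / t) has_real_derivative - ((hs \<rho> t)\<^sup>2)) (at t)"
    using True t by (auto intro!: derivative_eq_intros simp: hs_def hc_def power2_eq_square)
  then show ?thesis by (simp add: hc_def [abs_def] True)
next
  case False
  then have s: "sinh (\<rho> * t) > 0" using rho t by simp
  have "((\<lambda>t. \<rho> * cosh (\<rho> * t) / sinh (\<rho> * t)) has_real_derivative
      (\<rho> * (sinh (\<rho> * t) * \<rho>) * sinh (\<rho> * t) - \<rho> * cosh (\<rho> * t) * (cosh (\<rho> * t) * \<rho>)) /
        (sinh (\<rho> * t) * sinh (\<rho> * t))) (at t)"
    using s by (auto intro!: derivative_eq_intros)
  also have "(\<rho> * (sinh (\<rho> * t) * \<rho>) * sinh (\<rho> * t) - \<rho> * cosh (\<rho> * t) * (cosh (\<rho> * t) * \<rho>)) =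
      - (\<rho>\<^sup>2) * ((cosh (\<rho> * t))\<^sup>2 - (sinh (\<rho> * t))\<^sup>2)"
    by (simp add: algebra_simps power2_eq_square)
  also have "\<dots> / (sinh (\<rho> * t) * sinh (\<rho> * t)) = - ((hs \<rho> t)\<^sup>2)"
    using s False by (simp add: hyperbolic_pythagoras hs_def power2_eq_square[of "\<rho> / _"] power2_eq_square[of \<rho>])
  finally show ?thesis using False by (simp add: hc_def [abs_def] tanh_def)
qed

end

lemma hc_decreasing:
  assumes "0 \<le> \<rho>" "0 < t" "t \<le> T"
  shows "hc \<rho> T \<le> hc \<rho> t"
proof (rule DERIV_nonpos_imp_nonincreasing[OF \<open>t \<le> T\<close>])
  fix x assume "t \<le> x"
  then have "(hc \<rho> has_real_derivative - ((hs \<rho> x)\<^sup>2)) (at x)"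
    using assms by (auto intro!: hc_has_derivative)
  then show "\<exists>y. (hc \<rho> has_real_derivative y) (at x) \<and> y \<le> 0"
    by (intro exI[of _ "- ((hs \<rho> x)\<^sup>2)"]) auto
qed

text \<open>The addition theorem of sinh. When two Gaussians are convolved, the sum of the two
  \<open>hc\<close> is, up to a factor, the new quadratic coefficient, so this identity governs the
  amplitudes and \<open>hc_mult\<close> the exponents.\<close>

lemma hs_mult:
  assumes "0 \<le> \<rho>" "0 < t" "0 < u"
  shows "hs \<rho> t * hs \<rho> u = hs \<rho> (t + u) * (hc \<rho> t + hc \<rho> u)"
proof (cases "\<rho> = 0")
  case True
  then show ?thesis using assms by (simp add: hs_def hc_def field_simps)
next
  case False
  then have "sinh (\<rho> * t) > 0" "sinh (\<rho> * u) > 0" "sinh (\<rho> * t + \<rho> * u) > 0"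
    using assms by (auto intro!: add_pos_pos)
  then show ?thesis using False assms
    by (simp add: hs_def hc_def tanh_def distrib_left divide_simps)
       (simp add: sinh_add algebra_simps)
qed

text \<open>The addition theorem of coth, cleared of denominators. The term \<rho>^2 is the slot
  that the norm of \<open>kaplan br \<mu> z\<close> fills in the twisted convolution.\<close>

lemma hc_mult:
  assumes "0 \<le> \<rho>" "0 < t" "0 < u"
  shows "hc \<rho> t * hc \<rho> u + \<rho>\<^sup>2 = hc \<rho> (t + u) * (hc \<rho> t + hc \<rho> u)"
proof (cases "\<rho> = 0")
  case True
  then show ?thesis using assms by (simp add: hs_def hc_def field_simps)
next
  case False
  then have *: "sinh (\<rho> * t) > 0" "sinh (\<rho> * u) > 0" "sinh (\<rho> * t + \<rho> * u) > 0"
    using assms by (auto intro!: add_pos_pos)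
  let ?a = "\<rho> * t" and ?b = "\<rho> * u"
  have 1: "hc \<rho> t + hc \<rho> u = \<rho> * sinh (?a + ?b) / (sinh ?a * sinh ?b)"
    using * False assms by (simp add: hc_def tanh_def sinh_add divide_simps) (simp add: algebra_simps)
  have 2: "hc \<rho> (t + u) = \<rho> * cosh (?a + ?b) / sinh (?a + ?b)"
    using * False by (simp add: hc_def tanh_def distrib_left)
  have 3: "hc \<rho> t * hc \<rho> u + \<rho>\<^sup>2 = \<rho>\<^sup>2 * cosh (?a + ?b) / (sinh ?a * sinh ?b)"
    using * False assms
    by (simp add: hc_def tanh_def cosh_add divide_simps) (simp add: algebra_simps power2_eq_square)
  show ?thesis unfolding 1 2 3 using * by (simp add: power2_eq_square)
qed

text \<open>With T = t + u the left side is the new variable of the time integral. The product on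
  the right shows how its real powers factor into powers of \<open>hs\<close> at the times t, T - t
  and T.\<close>

lemma hc_diff:
  assumes "0 \<le> \<rho>" "0 < t" "0 < u"
  shows "hc \<rho> u - hc \<rho> (t + u) = hs \<rho> u * hs \<rho> (t + u) / hs \<rho> t"
proof (cases "\<rho> = 0")
  case True
  then show ?thesis using assms by (simp add: hs_def hc_def field_simps)
next
  case False
  then have *: "sinh (\<rho> * t) > 0" "sinh (\<rho> * u) > 0" "sinh (\<rho> * t + \<rho> * u) > 0"
    using assms by (auto intro!: add_pos_pos)
  let ?a = "\<rho> * t" and ?b = "\<rho> * u"
  have "sinh ?a = sinh ((?a + ?b) - ?b)" by simp
  also have "\<dots> = sinh (?a + ?b) * cosh ?b - cosh (?a + ?b) * sinh ?b"
    by (rule sinh_diff)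
  finally have 1: "sinh ?a = \<dots>" .
  have "hc \<rho> u - hc \<rho> (t + u) = \<rho> * sinh ?a / (sinh ?b * sinh (?a + ?b))"
    unfolding 1 using * False assms
    by (simp add: hc_def tanh_def distrib_left divide_simps) (simp add: algebra_simps)
  also have "\<dots> = hs \<rho> u * hs \<rho> (t + u) / hs \<rho> t"
    using * False assms by (simp add: hs_def distrib_left divide_simps)
  finally show ?thesis .
qed

text \<open>The inequality u <= exp u at u = b x / a, raised to the power a.\<close>

lemma powr_mult_exp_bounded:
  fixes a b :: real
  assumes "0 < a" "0 < b"
  obtains M where "0 < M" "\<And>x. 0 \<le> x \<Longrightarrow> x powr a * exp (- (b * x)) \<le> M"
proof
  show "0 < (a / b) powr a" using assms by simp
  fix x :: real assume x: "0 \<le> x"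
  have "b * x / a \<le> exp (b * x / a)" using exp_ge_add_one_self[of "b * x / a"] by linarith
  then have "(b * x / a) powr a \<le> exp (b * x / a) powr a"
    using assms x by (intro powr_mono2) auto
  also have "\<dots> = exp (b * x)" using assms by (simp add: powr_def)
  finally have "(b * x / a) powr a \<le> exp (b * x)" .
  moreover have "x powr a = (a / b) powr a * (b * x / a) powr a"
    using assms x by (simp add: powr_mult [symmetric])
  ultimately have "x powr a \<le> (a / b) powr a * exp (b * x)"
    by (simp add: mult_left_mono)
  then show "x powr a * exp (- (b * x)) \<le> (a / b) powr a"
    by (simp add: exp_minus field_simps)
qed

section \<open>Gaussian integrals and the Parseval formula\<close>

text \<open>The square is completed with the real shift \<open>m\<close> only, so no contour is
  moved: the imaginary part of c survives as a frequency, and after scaling by \<open>d\<close>,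
  which turns a x^2 into x^2/2, the integral is the characteristic function of the standard normal
  distribution at \<open>t\<close>.\<close>

lemma gaussian_real_line:
  fixes a :: real and c :: complex
  assumes a: "0 < a"
  shows "integrable lborel (\<lambda>x::real. exp (- complex_of_real (a * x\<^sup>2) + c * complex_of_real x))"
    and "(LINT x|lborel. exp (- complex_of_real (a * x\<^sup>2) + c * complex_of_real x)) =
      complex_of_real (sqrt (pi / a)) * exp (c\<^sup>2 / complex_of_real (4 * a))"
proof -
  define d where "d = 1 / sqrt (2 * a)"
  define m where "m = Re c / (2 * a)"
  define t where "t = d * Im c"
  have d: "d > 0" "d \<noteq> 0" "a * d\<^sup>2 = 1 / 2" "d * d = 1 / (2 * a)"
    using a by (auto simp: d_def power_divide)
  let ?g = "\<lambda>x::real. std_normal_density x *\<^sub>R iexp (t * x)"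
  let ?f = "\<lambda>x::real. exp (- complex_of_real (a * x\<^sup>2) + c * complex_of_real x)"
  have int_g: "integrable lborel ?g"
    by (rule Bochner_Integration.integrable_bound[where f = std_normal_density])
       (auto simp: integrable_std_normal_moment[of 0, simplified])
  have g: "(LINT x|lborel. ?g x) = complex_of_real (exp (- (t\<^sup>2) / 2))"
  proof -
    have "char std_normal_distribution t = (LINT x|lborel. ?g x)"
      unfolding char_def by (subst integral_density) auto
    then show ?thesis by (simp add: char_std_normal_distribution)
  qed
  define C where "C = complex_of_real (sqrt (2 * pi)) * exp (c * m - a * m\<^sup>2)"
  have eq: "?f (m + d * x) = C * ?g x" for x
  proof -
    have "- complex_of_real (a * (m + d * x)\<^sup>2) + c * complex_of_real (m + d * x) =
       (c * m - a * m\<^sup>2) + of_real (- (x\<^sup>2) / 2) + \<i> * of_real (t * x)"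
    proof -
      have 1: "2 * a * m = Re c" using a by (simp add: m_def)
      have "a * (m + d * x)\<^sup>2 = a * m\<^sup>2 + Re c * (d * x) + (a * d\<^sup>2) * x\<^sup>2"
        unfolding 1[symmetric] by (simp add: power2_eq_square algebra_simps)
      then show ?thesis
        unfolding d by (auto simp: complex_eq_iff t_def algebra_simps)
    qed
    then have "?f (m + d * x) = exp (c * m - a * m\<^sup>2) * of_real (exp (- (x\<^sup>2) / 2)) * iexp (t * x)"
      by (simp only: exp_add exp_of_real mult.assoc)
    moreover have "sqrt (2 * pi) \<noteq> 0" by simp
    ultimately show ?thesis
      by (simp add: C_def normal_density_def scaleR_conv_of_real)
  qed
  have "integrable lborel (\<lambda>x. ?f (m + d * x))"
    unfolding eq by (intro integrable_mult_right int_g)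
  then show "integrable lborel ?f"
    using lborel_integrable_real_affine_iff[OF d(2), of ?f m] by simp
  have "(LINT x|lborel. ?f x) = \<bar>d\<bar> *\<^sub>R (LINT x|lborel. ?f (m + d * x))"
    by (rule lborel_integral_real_affine[OF d(2)])
  also have "\<dots> = of_real d * (C * of_real (exp (- (t\<^sup>2) / 2)))"
    unfolding eq integral_mult_right_zero g using d by (simp add: scaleR_conv_of_real)
  also have "\<dots> = of_real (d * sqrt (2 * pi)) * exp ((c * m - a * m\<^sup>2) + of_real (- (t\<^sup>2) / 2))"
    by (simp only: C_def exp_add exp_of_real of_real_mult mult_ac)
  also have "d * sqrt (2 * pi) = sqrt (pi / a)"
    using a by (simp add: d_def real_sqrt_divide real_sqrt_mult field_simps)
  also have "(c * m - a * m\<^sup>2) + of_real (- (t\<^sup>2) / 2) = c\<^sup>2 / complex_of_real (4 * a)"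
  proof -
    have t2: "t\<^sup>2 = (Im c)\<^sup>2 / (2 * a)"
    proof -
      have "t\<^sup>2 = (d * d) * (Im c)\<^sup>2" by (simp add: t_def power2_eq_square)
      then show ?thesis by (simp only: d) simp
    qed
    show ?thesis unfolding t2 m_def using a
      by (auto simp: complex_eq_iff power2_eq_square field_simps)
  qed
  finally show "(LINT x|lborel. ?f x) =
      complex_of_real (sqrt (pi / a)) * exp (c\<^sup>2 / complex_of_real (4 * a))" .
qed

interpretation lborel_product: product_sigma_finite "\<lambda>b::'b. lborel :: real measure"
  by standard

lemma lborel_prod_coordinates:
  fixes f :: "'b::euclidean_space \<Rightarrow> real \<Rightarrow> complex"
  assumes int: "\<And>b. b \<in> Basis \<Longrightarrow> integrable lborel (f b)"
    and [measurable]: "\<And>b. b \<in> Basis \<Longrightarrow> f b \<in> borel_measurable borel"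
  shows "integrable lborel (\<lambda>x::'b. \<Prod>b\<in>Basis. f b (x \<bullet> b))"
    and "(LINT x|lborel. (\<Prod>b\<in>Basis. f b ((x::'b) \<bullet> b))) = (\<Prod>b\<in>Basis. (LINT x|lborel. f b x))"
proof -
  have eq: "lborel = distr (\<Pi>\<^sub>M b\<in>Basis. lborel) borel (\<lambda>f. \<Sum>b\<in>Basis. f b *\<^sub>R (b::'b))"
    by (rule lborel_eq)
  let ?h = "\<lambda>f. \<Sum>b\<in>Basis. f b *\<^sub>R (b::'b)"
  let ?P = "\<lambda>x::'b. \<Prod>b\<in>Basis. f b (x \<bullet> b)"
  have m: "?h \<in> measurable (\<Pi>\<^sub>M b\<in>Basis. lborel) borel" by measurable
  have mP: "?P \<in> borel_measurable borel" by measurable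
  have P: "?P (?h x) = (\<Prod>b\<in>Basis. f b (x b))" for x
    by (intro prod.cong refl) (simp add: inner_sum_left_Basis)
  have "integrable (\<Pi>\<^sub>M b\<in>(Basis::'b set). lborel) (\<lambda>x. \<Prod>b\<in>Basis. f b (x b))"
    by (rule lborel_product.product_integrable_prod) (use int in auto)
  then show "integrable lborel ?P"
    by (subst eq, subst integrable_distr_eq[OF m mP]) (simp only: P)
  have "(LINT x|lborel. ?P x) = (LINT x|(\<Pi>\<^sub>M b\<in>(Basis::'b set). lborel). ?P (?h x))"
    by (subst eq, subst integral_distr[OF m mP]) (rule refl)
  also have "\<dots> = (\<Prod>b\<in>Basis. (LINT x|lborel. f b x))"
    unfolding P by (rule lborel_product.product_integral_prod) (use int in auto)
  finally show "(LINT x|lborel. ?P x) = (\<Prod>b\<in>Basis. (LINT x|lborel. f b x))" .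
qed

text \<open>In each coordinate v and w are the real and imaginary part of one complex slope; the
  squares of the slopes sum to |v|^2 - |w|^2 + 2 i v.w. The minus sign is what later produces -
  \<rho>^2.\<close>

lemma gaussian_integral:
  fixes v w :: "'b::euclidean_space" and a :: real
  assumes a: "0 < a"
  defines "f \<equiv> \<lambda>x::'b. exp (complex_of_real (- (a * (norm x)\<^sup>2) + x \<bullet> v) + \<i> * complex_of_real (x \<bullet> w))"
  shows "integrable lborel f"
    and "(LINT x|lborel. f x) = complex_of_real ((pi / a) powr (real DIM('b) / 2)) *
      exp ((complex_of_real ((norm v)\<^sup>2 - (norm w)\<^sup>2) + 2 * \<i> * complex_of_real (v \<bullet> w)) /
        complex_of_real (4 * a))"
proof -
  define c where "c b = Complex (v \<bullet> b) (w \<bullet> b)" for b :: 'b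
  define h where "h b = (\<lambda>x::real. exp (- complex_of_real (a * x\<^sup>2) + c b * complex_of_real x))" for b
  have sq: "(norm x)\<^sup>2 = (\<Sum>b\<in>Basis. (x \<bullet> b)\<^sup>2)" for x :: 'b
    unfolding power2_norm_eq_inner by (subst euclidean_inner) (simp add: power2_eq_square)
  have f: "f x = (\<Prod>b\<in>Basis. h b (x \<bullet> b))" for x
  proof -
    have "complex_of_real (- (a * (norm x)\<^sup>2) + x \<bullet> v) + \<i> * complex_of_real (x \<bullet> w) =
       (\<Sum>b\<in>Basis. - complex_of_real (a * (x \<bullet> b)\<^sup>2) + c b * complex_of_real (x \<bullet> b))"
      unfolding sq euclidean_inner[of x v] euclidean_inner[of x w]
      by (auto simp: complex_eq_iff c_def sum_distrib_left sum.distrib sum_negf sum_subtractf mult_ac)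
    then show ?thesis by (simp add: f_def h_def exp_sum)
  qed
  have [measurable]: "h b \<in> borel_measurable borel" for b unfolding h_def by measurable
  note hi = gaussian_real_line[OF a, of "c _", folded h_def]
  show "integrable lborel f"
    using lborel_prod_coordinates(1)[of h] hi by (simp add: f [abs_def])
  have "(LINT x|lborel. f x) = (\<Prod>b\<in>(Basis::'b set). (LINT x|lborel. h b x))"
    using lborel_prod_coordinates(2)[of h] hi by (simp add: f [abs_def])
  also have "\<dots> = (\<Prod>b\<in>(Basis::'b set). complex_of_real (sqrt (pi / a)) * exp ((c b)\<^sup>2 / complex_of_real (4 * a)))"
    by (simp add: hi)
  also have "\<dots> = complex_of_real (sqrt (pi / a) ^ DIM('b)) * exp (\<Sum>b\<in>(Basis::'b set). (c b)\<^sup>2 / complex_of_real (4 * a))"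
    by (simp add: prod.distrib exp_sum)
  also have "sqrt (pi / a) ^ DIM('b) = (pi / a) powr (real DIM('b) / 2)"
    using a by (simp add: powr_half_sqrt [symmetric] powr_realpow [symmetric] powr_powr)
  also have "(\<Sum>b\<in>(Basis::'b set). (c b)\<^sup>2 / complex_of_real (4 * a)) =
     (complex_of_real ((norm v)\<^sup>2 - (norm w)\<^sup>2) + 2 * \<i> * complex_of_real (v \<bullet> w)) / complex_of_real (4 * a)"
    unfolding sum_divide_distrib [symmetric] sq euclidean_inner[of v w]
    by (intro arg_cong2[where f = "(/)"] refl)
       (auto simp: complex_eq_iff c_def sum_distrib_left sum_subtractf mult_ac power2_eq_square)
  finally show "(LINT x|lborel. f x) = complex_of_real ((pi / a) powr (real DIM('b) / 2)) *
      exp ((complex_of_real ((norm v)\<^sup>2 - (norm w)\<^sup>2) + 2 * \<i> * complex_of_real (v \<bullet> w)) /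
        complex_of_real (4 * a))" .
qed

lemma borel_measurable_fst_snd [measurable]:
  "(fst :: 'a::second_countable_topology \<times> 'b::second_countable_topology \<Rightarrow> 'a) \<in> borel_measurable borel"
  "(snd :: 'a \<times> 'b \<Rightarrow> 'b) \<in> borel_measurable borel"
  by (intro borel_measurable_continuous_onI continuous_intros)+

text \<open>Integrability is an equivalence, so the integral formula holds for every f: for a
  non-integrable f both sides have the default value 0.\<close>

lemma lborel_affine_subst:
  fixes f :: "'b::euclidean_space \<Rightarrow> 'c::{banach, second_countable_topology}"
  assumes c: "c \<noteq> 0"
  shows "integrable lborel (\<lambda>x. f (t + c *\<^sub>R x)) \<longleftrightarrow> integrable lborel f"
    and "(LINT x|lborel. f x) = (\<bar>c\<bar> ^ DIM('b)) *\<^sub>R (LINT x|lborel. f (t + c *\<^sub>R x))"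
proof -
  have imp: "integrable lborel (\<lambda>x. f (t + c *\<^sub>R x))" if "integrable lborel f" "c \<noteq> 0"
    for f :: "'b \<Rightarrow> 'c" and c t
    using that unfolding integrable_iff_bounded
    by (subst (asm) lborel_affine[of c t])
       (auto simp: nn_integral_density nn_integral_distr nn_integral_cmult ennreal_mult_less_top)
  show iff: "integrable lborel (\<lambda>x. f (t + c *\<^sub>R x)) \<longleftrightarrow> integrable lborel f"
  proof
    assume "integrable lborel (\<lambda>x. f (t + c *\<^sub>R x))"
    from imp[OF this, of "inverse c" "- (inverse c *\<^sub>R t)"] c
    show "integrable lborel f" by (simp add: scaleR_right_diff_distrib)
  qed (rule imp[OF _ c])
  show "(LINT x|lborel. f x) = (\<bar>c\<bar> ^ DIM('b)) *\<^sub>R (LINT x|lborel. f (t + c *\<^sub>R x))"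
  proof (cases "integrable lborel f")
    case True
    then have [measurable]: "f \<in> borel_measurable borel" by auto
    show ?thesis
      by (subst lborel_affine[OF c, of t]) (simp add: integral_density integral_distr)
  next
    case False
    then show ?thesis using iff by (simp add: not_integrable_integral_eq)
  qed
qed

lemma
  fixes f :: "'a::euclidean_space \<Rightarrow> 'c::{real_normed_field, banach, second_countable_topology}"
    and g :: "'b::euclidean_space \<Rightarrow> 'c"
  assumes f: "integrable lborel f" and g: "integrable lborel g"
  shows integrable_mult_pair: "integrable (lborel \<Otimes>\<^sub>M lborel) (\<lambda>p. f (fst p) * g (snd p))"
    and integral_mult_pair: "(LINT p|(lborel \<Otimes>\<^sub>M lborel). f (fst p) * g (snd p)) =
      (LINT x|lborel. f x) * (LINT y|lborel. g y)"
proof -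
  have [measurable]: "f \<in> borel_measurable borel" "g \<in> borel_measurable borel"
    using f g by auto
  show int: "integrable (lborel \<Otimes>\<^sub>M lborel) (\<lambda>p. f (fst p) * g (snd p))"
    by (rule lborel_pair.Fubini_integrable) (use f g in \<open>auto simp: norm_mult\<close>)
  show "(LINT p|(lborel \<Otimes>\<^sub>M lborel). f (fst p) * g (snd p)) =
      (LINT x|lborel. f x) * (LINT y|lborel. g y)"
    unfolding lborel_pair.integral_fst'[OF int, symmetric] by simp
qed

section \<open>The unnormalised Fourier transform: Gaussian regularisation and L^2 theory\<close>

definition fourier :: "('b::euclidean_space \<Rightarrow> complex) \<Rightarrow> 'b \<Rightarrow> complex" where
  "fourier f \<sigma> = (LINT x|lborel. exp (- (\<i> * complex_of_real (\<sigma> \<bullet> x))) * f x)"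

lemma integrable_character_mult:
  fixes f :: "'b::euclidean_space \<Rightarrow> complex"
  assumes "integrable lborel f"
  shows "integrable lborel (\<lambda>x. exp (- (\<i> * complex_of_real (\<sigma> \<bullet> x))) * f x)"
  by (rule Bochner_Integration.integrable_bound[OF assms])
     (use assms in \<open>auto simp: norm_mult\<close>)

lemma measurable_fourier [measurable]:
  fixes f :: "'b::euclidean_space \<Rightarrow> complex"
  assumes [measurable]: "f \<in> borel_measurable borel"
  shows "fourier f \<in> borel_measurable borel"
  unfolding fourier_def [abs_def] by measurable

lemma norm_fourier_le:
  assumes "integrable lborel f"
  shows "cmod (fourier f \<sigma>) \<le> (LINT x|lborel. cmod (f x))"
  unfolding fourier_def
  using integral_norm_bound[of lborel "\<lambda>x. exp (- (\<i> * complex_of_real (\<sigma> \<bullet> x))) * f x"]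
  by (simp add: norm_mult)

text \<open>The Fourier transform of the regulariser exp (- (\<delta>/2)^2 |\<sigma>|^2), a Gaussian
  of width \<delta>. Its mass is (2 pi)^k and not 1, in accordance with the unnormalised
  \<open>fourier\<close>, so smoothing by it tends to (2 pi)^k times the identity as \<delta> tends
  to 0.\<close>

definition heat :: "real \<Rightarrow> 'b::euclidean_space \<Rightarrow> real" where
  "heat \<delta> x = (4 * pi) powr (real DIM('b) / 2) / \<delta> ^ DIM('b) * exp (- ((norm x / \<delta>)\<^sup>2))"

lemma heat_nonneg: "0 < \<delta> \<Longrightarrow> 0 \<le> heat \<delta> x"
  by (simp add: heat_def)

lemma measurable_heat [measurable]: "heat \<delta> \<in> borel_measurable borel"
  unfolding heat_def [abs_def] by measurable

lemma gaussian_integrable: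
  "0 < a \<Longrightarrow> integrable lborel (\<lambda>x::'b::euclidean_space. exp (- (a * (norm x)\<^sup>2)))"
  using integrable_norm[OF gaussian_integral(1)[of a "0::'b" 0]] by simp

lemma gaussian_integral_real:
  assumes "0 < a"
  shows "(LINT x|lborel. exp (- (a * (norm (x::'b::euclidean_space))\<^sup>2))) = (pi / a) powr (real DIM('b) / 2)"
proof -
  have "complex_of_real (LINT x|lborel. exp (- (a * (norm (x::'b))\<^sup>2))) =
     (LINT x|lborel. complex_of_real (exp (- (a * (norm (x::'b))\<^sup>2))))"
    by simp
  also have "\<dots> = complex_of_real ((pi / a) powr (real DIM('b) / 2))"
    using gaussian_integral(2)[OF assms, of "0::'b" 0] by (simp add: exp_of_real [symmetric])
  finally show ?thesis by (simp only: of_real_eq_iff)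
qed

lemma heat_fourier:
  fixes w :: "'b::euclidean_space"
  assumes d: "0 < \<delta>"
  shows "(LINT x|lborel. complex_of_real (exp (- ((\<delta> / 2)\<^sup>2 * (norm x)\<^sup>2))) * exp (\<i> * complex_of_real (x \<bullet> w))) =
    complex_of_real (heat \<delta> w)"
proof -
  have "(pi / (\<delta> / 2)\<^sup>2) powr (real DIM('b) / 2) = (4 * pi) powr (real DIM('b) / 2) / \<delta> ^ DIM('b)"
  proof -
    have 1: "(pi / (\<delta> / 2)\<^sup>2) = 4 * pi / \<delta> powr 2"
      using d by (simp add: power_divide)
    have 2: "(\<delta> powr 2) powr (real DIM('b) / 2) = \<delta> ^ DIM('b)"
      using d by (simp only: powr_powr) (simp add: powr_realpow)
    show ?thesis
      unfolding 1 2[symmetric] using d by (intro powr_divide)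
  qed
  moreover have "4 * (\<delta> / 2)\<^sup>2 = \<delta>\<^sup>2" by (simp add: power_divide)
  moreover have "exp (- (complex_of_real (norm w))\<^sup>2 / (complex_of_real \<delta>)\<^sup>2) =
      complex_of_real (exp (- ((norm w / \<delta>)\<^sup>2)))"
    by (simp add: exp_of_real [symmetric] power_divide)
  moreover have "exp (complex_of_real (- ((\<delta> / 2)\<^sup>2 * (norm x)\<^sup>2) + x \<bullet> 0) + \<i> * complex_of_real (x \<bullet> w)) =
      complex_of_real (exp (- ((\<delta> / 2)\<^sup>2 * (norm x)\<^sup>2))) * exp (\<i> * complex_of_real (x \<bullet> w))" for x
    by (simp only: exp_add exp_of_real inner_zero_right add_0_right)
  ultimately show ?thesis
    using gaussian_integral(2)[of "(\<delta> / 2)\<^sup>2" "0::'b" w] d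
    by (simp add: heat_def)
qed

lemma heat_integral:
  fixes y :: "'b::euclidean_space"
  assumes d: "0 < \<delta>"
  shows "integrable lborel (\<lambda>x. heat \<delta> (x - y))"
    and "(LINT x|lborel. heat \<delta> (x - y)) = (2 * pi) ^ DIM('b)"
proof -
  let ?C = "(4 * pi) powr (real DIM('b) / 2) / \<delta> ^ DIM('b)"
  have eq: "heat \<delta> ((y + \<delta> *\<^sub>R x) - y) = ?C * exp (- (1 * (norm x)\<^sup>2))" for x
    using d by (simp add: heat_def)
  have "integrable lborel (\<lambda>x. heat \<delta> ((y + \<delta> *\<^sub>R x) - y))"
    unfolding eq by (intro integrable_mult_right gaussian_integrable) simp
  then show "integrable lborel (\<lambda>x. heat \<delta> (x - y))"
    using lborel_affine_subst(1)[of \<delta> "\<lambda>x. heat \<delta> (x - y)" y] d by simp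
  have "(LINT x|lborel. heat \<delta> (x - y)) = \<delta> ^ DIM('b) * (?C * pi powr (real DIM('b) / 2))"
    using d
    by (subst lborel_affine_subst(2)[of \<delta> _ y], simp)
       (simp only: eq integral_mult_right_zero gaussian_integral_real[OF zero_less_one, where 'b = 'b], simp)
  also have "\<dots> = (4 * pi * pi) powr (real DIM('b) / 2)"
    using d by (simp add: powr_mult)
  also have "4 * pi * pi = (2 * pi) powr 2" by (simp add: power2_eq_square)
  also have "\<dots> powr (real DIM('b) / 2) = (2 * pi) ^ DIM('b)"
    by (simp only: powr_powr) (simp add: powr_realpow)
  finally show "(LINT x|lborel. heat \<delta> (x - y)) = (2 * pi) ^ DIM('b)" .
qed

lemma heat_minus: "heat \<delta> (x - y) = heat \<delta> (y - x)"
  by (simp add: heat_def norm_minus_commute)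

lemma heat_convolution:
  fixes \<phi> :: "'b::euclidean_space \<Rightarrow> real"
  assumes d: "0 < \<delta>" and \<phi>: "integrable lborel \<phi>"
  shows "integrable (lborel \<Otimes>\<^sub>M lborel) (\<lambda>p. \<phi> (fst p) * heat \<delta> (fst p - snd p))"
    and "(LINT p|(lborel \<Otimes>\<^sub>M lborel). \<phi> (fst p) * heat \<delta> (fst p - snd p)) = (2 * pi) ^ DIM('b) * (LINT x|lborel. \<phi> x)"
    and "integrable (lborel \<Otimes>\<^sub>M lborel) (\<lambda>p. \<phi> (snd p) * heat \<delta> (fst p - snd p))"
    and "(LINT p|(lborel \<Otimes>\<^sub>M lborel). \<phi> (snd p) * heat \<delta> (fst p - snd p)) = (2 * pi) ^ DIM('b) * (LINT x|lborel. \<phi> x)"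
proof -
  have [measurable]: "\<phi> \<in> borel_measurable borel" using \<phi> by auto
  have h: "integrable lborel (\<lambda>y. heat \<delta> (x - y))" "(LINT y|lborel. heat \<delta> (x - y)) = (2 * pi) ^ DIM('b)"
    for x :: 'b
    using heat_integral[OF d, of x] by (simp_all add: heat_minus[of \<delta> x])
  show 1: "integrable (lborel \<Otimes>\<^sub>M lborel) (\<lambda>p. \<phi> (fst p) * heat \<delta> (fst p - snd p))"
    by (rule lborel_pair.Fubini_integrable)
       (use \<phi> h d in \<open>auto simp: abs_mult heat_nonneg\<close>)
  show 2: "(LINT p|(lborel \<Otimes>\<^sub>M lborel). \<phi> (fst p) * heat \<delta> (fst p - snd p)) = (2 * pi) ^ DIM('b) * (LINT x|lborel. \<phi> x)"
    unfolding lborel_pair.integral_fst'[OF 1, symmetric] by (simp add: h)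
  show "integrable (lborel \<Otimes>\<^sub>M lborel) (\<lambda>p. \<phi> (snd p) * heat \<delta> (fst p - snd p))"
    using lborel_pair.integrable_product_swap[OF 1]
    by (simp add: heat_minus[of \<delta> "snd _"] case_prod_unfold)
  show "(LINT p|(lborel \<Otimes>\<^sub>M lborel). \<phi> (snd p) * heat \<delta> (fst p - snd p)) = (2 * pi) ^ DIM('b) * (LINT x|lborel. \<phi> x)"
    using lborel_pair.integral_product_swap[of "\<lambda>p. \<phi> (fst p) * heat \<delta> (fst p - snd p)"] 1 2
    by (simp add: heat_minus[of \<delta> "snd _"] case_prod_unfold)
qed

text \<open>The Gaussian in \<sigma> makes the integral over \<sigma> and both dual variables
  absolutely convergent, so \<sigma> may be integrated first. The characters combine to the
  frequency \<open>fst p - snd p\<close>, and the regulariser turns into \<open>heat\<close>, which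
  concentrates on the diagonal for small \<delta>.\<close>

lemma fourier_product_regularised:
  fixes f h :: "'b::euclidean_space \<Rightarrow> complex"
  assumes d: "0 < \<delta>" and f: "integrable lborel f" and h: "integrable lborel h"
  shows "(LINT \<sigma>|lborel. complex_of_real (exp (- ((\<delta> / 2)\<^sup>2 * (norm \<sigma>)\<^sup>2))) *
            (fourier f (\<sigma>\<^sub>0 - \<sigma>) * fourier h \<sigma>)) =
    (LINT p|(lborel \<Otimes>\<^sub>M lborel). exp (- (\<i> * complex_of_real (\<sigma>\<^sub>0 \<bullet> fst p))) * f (fst p) * h (snd p) *
       complex_of_real (heat \<delta> (fst p - snd p)))"
proof -
  have [measurable]: "f \<in> borel_measurable borel" "h \<in> borel_measurable borel"
    using f h by auto
  let ?E = "\<lambda>\<sigma>::'b. complex_of_real (exp (- ((\<delta> / 2)\<^sup>2 * (norm \<sigma>)\<^sup>2)))"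
  let ?a = "\<lambda>\<sigma> x. exp (- (\<i> * complex_of_real ((\<sigma>\<^sub>0 - \<sigma>) \<bullet> x))) * f x"
  let ?b = "\<lambda>\<sigma> x. exp (- (\<i> * complex_of_real (\<sigma> \<bullet> x))) * h x"
  define W where "W = (\<lambda>(\<sigma>, p). ?E \<sigma> * (?a \<sigma> (fst p) * ?b \<sigma> (snd p)))"
  have E: "integrable lborel ?E"
    using gaussian_integrable[of "(\<delta> / 2)\<^sup>2", where 'b = 'b] d by (intro integrable_of_real) simp
  have fh: "integrable (lborel \<Otimes>\<^sub>M lborel) (\<lambda>p. f (fst p) * h (snd p))"
    by (rule integrable_mult_pair[OF f h])
  have "integrable (lborel \<Otimes>\<^sub>M lborel) (\<lambda>q. ?E (fst q) * (f (fst (snd q)) * h (snd (snd q))))"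
    using integrable_mult_pair[OF E, of "\<lambda>p. f (fst p) * h (snd p)"] fh by (simp add: lborel_prod)
  then have W: "integrable (lborel \<Otimes>\<^sub>M lborel) W"
    by (rule Bochner_Integration.integrable_bound)
       (auto simp: W_def norm_mult case_prod_unfold)
  then have W': "integrable (lborel \<Otimes>\<^sub>M lborel) (case_prod (\<lambda>\<sigma> p. W (\<sigma>, p)))" by simp
  have "(LINT \<sigma>|lborel. ?E \<sigma> * (fourier f (\<sigma>\<^sub>0 - \<sigma>) * fourier h \<sigma>)) =
      (LINT \<sigma>|lborel. (LINT p|lborel. W (\<sigma>, p)))"
    by (intro Bochner_Integration.integral_cong refl)
       (simp add: W_def fourier_def lborel_prod [symmetric]
          integral_mult_pair[OF integrable_character_mult[OF f] integrable_character_mult[OF h]])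
  also have "\<dots> = (LINT p|lborel. (LINT \<sigma>|lborel. W (\<sigma>, p)))"
    using lborel_pair.Fubini_integral[OF W'] by simp
  also have "\<dots> = (LINT p|lborel. exp (- (\<i> * complex_of_real (\<sigma>\<^sub>0 \<bullet> fst p))) * f (fst p) * h (snd p) *
       complex_of_real (heat \<delta> (fst p - snd p)))"
  proof (intro Bochner_Integration.integral_cong refl)
    fix p :: "'b \<times> 'b"
    have "W (\<sigma>, p) = (exp (- (\<i> * complex_of_real (\<sigma>\<^sub>0 \<bullet> fst p))) * f (fst p) * h (snd p)) *
       (?E \<sigma> * exp (\<i> * complex_of_real (\<sigma> \<bullet> (fst p - snd p))))" for \<sigma>
    proof -
      have "exp (- (\<i> * complex_of_real ((\<sigma>\<^sub>0 - \<sigma>) \<bullet> fst p))) * exp (- (\<i> * complex_of_real (\<sigma> \<bullet> snd p))) =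
        exp (- (\<i> * complex_of_real (\<sigma>\<^sub>0 \<bullet> fst p))) * exp (\<i> * complex_of_real (\<sigma> \<bullet> (fst p - snd p)))"
        by (simp add: exp_add [symmetric] inner_diff_left inner_diff_right algebra_simps)
      then show ?thesis
        by (simp add: W_def)
    qed
    then show "(LINT \<sigma>|lborel. W (\<sigma>, p)) = exp (- (\<i> * complex_of_real (\<sigma>\<^sub>0 \<bullet> fst p))) * f (fst p) * h (snd p) *
       complex_of_real (heat \<delta> (fst p - snd p))"
      by (simp only: integral_mult_right_zero heat_fourier[OF d])
  qed
  finally show ?thesis by (simp add: lborel_prod)
qed

lemma fourier_cnj: "cnj (fourier f \<sigma>) = fourier (\<lambda>x. cnj (f x)) (0 - \<sigma>)"
proof -
  have "cnj (fourier f \<sigma>) = (LINT x|lborel. cnj (exp (- (\<i> * complex_of_real (\<sigma> \<bullet> x))) * f x))"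
    unfolding fourier_def by (rule Bochner_Integration.integral_cnj [symmetric])
  then show ?thesis by (simp add: fourier_def exp_cnj)
qed

text \<open>The regularised identity for f and its conjugate at \<sigma> = 0 expresses the damped
  integral of |\<open>fourier f\<close>|^2. By 2 |f(x) f(x')| <= |f(x)|^2 + |f(x')|^2 each resulting
  term has one variable occurring only in \<open>heat\<close>, which integrates to (2 pi)^k; the
  bound is therefore uniform in \<delta>, and monotone convergence removes the damping.\<close>

lemma fourier_L2:
  fixes f :: "'b::euclidean_space \<Rightarrow> complex"
  assumes f: "integrable lborel f" and f2: "integrable lborel (\<lambda>x. (cmod (f x))\<^sup>2)"
  shows "integrable lborel (\<lambda>\<sigma>. (cmod (fourier f \<sigma>))\<^sup>2)"
    and "(LINT \<sigma>|lborel. (cmod (fourier f \<sigma>))\<^sup>2) \<le> (2 * pi) ^ DIM('b) * (LINT x|lborel. (cmod (f x))\<^sup>2)"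
proof -
  have [measurable]: "f \<in> borel_measurable borel" using f by auto
  let ?N = "(2 * pi) ^ DIM('b) * (LINT x|lborel. (cmod (f x))\<^sup>2)"
  let ?E = "\<lambda>\<delta> (\<sigma>::'b). exp (- ((\<delta> / 2)\<^sup>2 * (norm \<sigma>)\<^sup>2))"
  let ?F = "\<lambda>\<sigma>. (cmod (fourier f \<sigma>))\<^sup>2"
  define G where "G j \<sigma> = ?E (1 / real (Suc j)) \<sigma> * ?F \<sigma>" for j \<sigma>
  have int: "integrable lborel (\<lambda>\<sigma>. ?E \<delta> \<sigma> * ?F \<sigma>)" if "0 < \<delta>" for \<delta>
  proof (rule Bochner_Integration.integrable_bound)
    show "integrable lborel (\<lambda>\<sigma>::'b. ?E \<delta> \<sigma> * (LINT x|lborel. cmod (f x))\<^sup>2)"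
      using that by (intro integrable_mult_left gaussian_integrable) auto
    show "AE \<sigma> in lborel. norm (?E \<delta> \<sigma> * ?F \<sigma>) \<le> norm (?E \<delta> \<sigma> * (LINT x|lborel. cmod (f x))\<^sup>2)"
      by (auto simp: abs_mult intro!: power_mono norm_fourier_le f)
  qed measurable
  have bound: "(LINT \<sigma>|lborel. ?E \<delta> \<sigma> * ?F \<sigma>) \<le> ?N" if d: "0 < \<delta>" for \<delta>
  proof -
    let ?Q = "\<lambda>p. exp (- (\<i> * complex_of_real (0 \<bullet> fst p))) * cnj (f (fst p)) * f (snd p) *
       complex_of_real (heat \<delta> (fst p - snd p))"
    let ?R = "\<lambda>p. (cmod (f (fst p)))\<^sup>2 * heat \<delta> (fst p - snd p)"
    let ?S = "\<lambda>p. (cmod (f (snd p)))\<^sup>2 * heat \<delta> (fst p - snd p)"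
    have fc: "integrable lborel (\<lambda>x. cnj (f x))" using f by simp
    have "complex_of_real (?E \<delta> \<sigma> * ?F \<sigma>) =
        complex_of_real (?E \<delta> \<sigma>) * (fourier (\<lambda>x. cnj (f x)) (0 - \<sigma>) * fourier f \<sigma>)" for \<sigma>
      by (simp only: fourier_cnj [symmetric] of_real_mult complex_norm_square mult_ac)
    then have "complex_of_real (LINT \<sigma>|lborel. ?E \<delta> \<sigma> * ?F \<sigma>) =
       (LINT \<sigma>|lborel. complex_of_real (?E \<delta> \<sigma>) * (fourier (\<lambda>x. cnj (f x)) (0 - \<sigma>) * fourier f \<sigma>))"
      by (simp only: integral_complex_of_real [symmetric])
    also have "\<dots> = (LINT p|(lborel \<Otimes>\<^sub>M lborel). ?Q p)"
      by (rule fourier_product_regularised[OF d fc f])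
    finally have "\<bar>LINT \<sigma>|lborel. ?E \<delta> \<sigma> * ?F \<sigma>\<bar> = cmod (LINT p|(lborel \<Otimes>\<^sub>M lborel). ?Q p)"
      by (simp only: norm_of_real [symmetric, where 'a = complex])
    also have "\<dots> \<le> (LINT p|(lborel \<Otimes>\<^sub>M lborel). cmod (?Q p))"
      by (rule integral_norm_bound)
    also have "\<dots> \<le> (LINT p|(lborel \<Otimes>\<^sub>M lborel). (?R p + ?S p) / 2)"
    proof (rule integral_mono_AE')
      show "integrable (lborel \<Otimes>\<^sub>M lborel) (\<lambda>p. (?R p + ?S p) / 2)"
        using heat_convolution(1,3)[OF d f2] by auto
      show "AE p in (lborel \<Otimes>\<^sub>M lborel). cmod (?Q p) \<le> (?R p + ?S p) / 2"
      proof (rule AE_I2)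
        fix p
        have "cmod (f (fst p)) * cmod (f (snd p)) \<le> ((cmod (f (fst p)))\<^sup>2 + (cmod (f (snd p)))\<^sup>2) / 2"
          using sum_squares_bound[of "cmod (f (fst p))" "cmod (f (snd p))"] by simp
        then have "cmod (f (fst p)) * cmod (f (snd p)) * heat \<delta> (fst p - snd p)
            \<le> ((cmod (f (fst p)))\<^sup>2 + (cmod (f (snd p)))\<^sup>2) / 2 * heat \<delta> (fst p - snd p)"
          by (intro mult_right_mono heat_nonneg d)
        then show "cmod (?Q p) \<le> (?R p + ?S p) / 2"
          using heat_nonneg[OF d, of "fst p - snd p"]
          by (simp add: norm_mult distrib_right add_divide_distrib)
      qed
    qed (use d in \<open>auto simp: heat_nonneg\<close>)
    also have "\<dots> = ?N"
      using heat_convolution[OF d f2] by simp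
    finally show ?thesis by linarith
  qed
  have incr: "mono (\<lambda>j. G j \<sigma>)" for \<sigma>
  proof (rule monoI)
    fix i j :: nat assume "i \<le> j"
    then have "1 / real (Suc j) \<le> 1 / real (Suc i)" by (intro divide_left_mono) auto
    then have "(1 / real (Suc j) / 2)\<^sup>2 \<le> (1 / real (Suc i) / 2)\<^sup>2"
      by (intro power_mono divide_right_mono) auto
    then have "(1 / real (Suc j) / 2)\<^sup>2 * (norm \<sigma>)\<^sup>2 \<le> (1 / real (Suc i) / 2)\<^sup>2 * (norm \<sigma>)\<^sup>2"
      by (rule mult_right_mono) simp
    then show "G i \<sigma> \<le> G j \<sigma>"
      unfolding G_def by (intro mult_right_mono) (simp_all only: exp_le_cancel_iff neg_le_iff_le zero_le_power2)
  qed
  have lim: "(\<lambda>j. G j \<sigma>) \<longlonglongrightarrow> ?F \<sigma>" for \<sigma>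
  proof -
    have "(\<lambda>j. 1 / real (Suc j)) \<longlonglongrightarrow> 0" by (rule LIMSEQ_Suc[OF lim_1_over_n])
    then have "(\<lambda>j. G j \<sigma>) \<longlonglongrightarrow> ?E 0 \<sigma> * ?F \<sigma>"
      unfolding G_def by (intro tendsto_intros) auto
    then show ?thesis by simp
  qed
  have fin: "(\<integral>\<^sup>+\<sigma>. ennreal (?F \<sigma>) \<partial>lborel) \<le> ennreal ?N"
  proof -
    have "(\<integral>\<^sup>+\<sigma>. ennreal (?F \<sigma>) \<partial>lborel) = (\<integral>\<^sup>+\<sigma>. (SUP j. ennreal (G j \<sigma>)) \<partial>lborel)"
    proof (rule nn_integral_cong)
      fix \<sigma> :: 'b
      have "(\<lambda>j. ennreal (G j \<sigma>)) \<longlonglongrightarrow> (SUP j. ennreal (G j \<sigma>))"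
        by (rule LIMSEQ_SUP) (use incr in \<open>auto simp: mono_def intro!: ennreal_leI\<close>)
      moreover have "(\<lambda>j. ennreal (G j \<sigma>)) \<longlonglongrightarrow> ennreal (?F \<sigma>)"
        using lim by (intro tendsto_ennrealI)
      ultimately show "ennreal (?F \<sigma>) = (SUP j. ennreal (G j \<sigma>))"
        using LIMSEQ_unique by blast
    qed
    also have "\<dots> = (SUP j. (\<integral>\<^sup>+\<sigma>. ennreal (G j \<sigma>) \<partial>lborel))"
      by (rule nn_integral_monotone_convergence_SUP)
         (use incr in \<open>auto simp: mono_def incseq_def le_fun_def G_def [abs_def] intro!: ennreal_leI\<close>)
    also have "\<dots> \<le> ennreal ?N"
    proof (rule SUP_least)
      fix j
      have "(\<integral>\<^sup>+\<sigma>. ennreal (G j \<sigma>) \<partial>lborel) = ennreal (LINT \<sigma>|lborel. G j \<sigma>)"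
        unfolding G_def by (rule nn_integral_eq_integral[OF int]) auto
      also have "\<dots> \<le> ennreal ?N"
        unfolding G_def by (intro ennreal_leI bound) simp
      finally show "(\<integral>\<^sup>+\<sigma>. ennreal (G j \<sigma>) \<partial>lborel) \<le> ennreal ?N" .
    qed
    finally show ?thesis .
  qed
  show F: "integrable lborel ?F"
    using fin by (intro integrableI_bounded) (auto simp: top.extremum_strict less_top [symmetric] top_unique)
  have "ennreal (LINT \<sigma>|lborel. ?F \<sigma>) \<le> ennreal ?N"
    using fin nn_integral_eq_integral[OF F] by simp
  then show "(LINT \<sigma>|lborel. ?F \<sigma>) \<le> ?N"
    by (subst (asm) ennreal_le_iff) auto
qed

context
  fixes f h :: "'b::euclidean_space \<Rightarrow> complex"
  assumes f: "integrable lborel f" "integrable lborel (\<lambda>x. (cmod (f x))\<^sup>2)"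
    and h: "integrable lborel h" "integrable lborel (\<lambda>x. (cmod (h x))\<^sup>2)"
begin

lemma fourier_reflect:
  shows "integrable lborel (\<lambda>\<sigma>. (cmod (fourier f (\<sigma>\<^sub>0 - \<sigma>)))\<^sup>2)"
    and "(LINT \<sigma>|lborel. (cmod (fourier f (\<sigma>\<^sub>0 - \<sigma>)))\<^sup>2) = (LINT \<sigma>|lborel. (cmod (fourier f \<sigma>))\<^sup>2)"
  using lborel_affine_subst[of "-1" "\<lambda>\<sigma>. (cmod (fourier f \<sigma>))\<^sup>2" \<sigma>\<^sub>0] fourier_L2(1)[OF f]
  by simp_all

text \<open>AM-GM with a weight, from the square of a x - y divided by a. The weight is kept free in
  order to balance later an f that is small in the horizontal variable against an h whose L^2 norm
  is merely bounded.\<close>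

lemma fourier_product_bound:
  assumes a: "0 < a"
  shows "cmod (fourier f (\<sigma>\<^sub>0 - \<sigma>) * fourier h \<sigma>) \<le>
    (a * (cmod (fourier f (\<sigma>\<^sub>0 - \<sigma>)))\<^sup>2 + (cmod (fourier h \<sigma>))\<^sup>2 / a) / 2"
proof -
  let ?x = "cmod (fourier f (\<sigma>\<^sub>0 - \<sigma>))" and ?y = "cmod (fourier h \<sigma>)"
  have "0 \<le> (a * ?x - ?y)\<^sup>2 / a" using a by simp
  also have "\<dots> = a * ?x\<^sup>2 + ?y\<^sup>2 / a - 2 * (?x * ?y)"
    using a by (simp add: power2_eq_square field_simps)
  finally show ?thesis by (simp add: norm_mult)
qed

lemma fourier_product_integrable:
  "integrable lborel (\<lambda>\<sigma>. fourier f (\<sigma>\<^sub>0 - \<sigma>) * fourier h \<sigma>)"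
proof (rule Bochner_Integration.integrable_bound)
  show "integrable lborel (\<lambda>\<sigma>. (1 * (cmod (fourier f (\<sigma>\<^sub>0 - \<sigma>)))\<^sup>2 + (cmod (fourier h \<sigma>))\<^sup>2 / 1) / 2)"
    using fourier_reflect(1) fourier_L2(1)[OF h] by simp
  have [measurable]: "f \<in> borel_measurable borel" "h \<in> borel_measurable borel"
    using f h by auto
  show "(\<lambda>\<sigma>. fourier f (\<sigma>\<^sub>0 - \<sigma>) * fourier h \<sigma>) \<in> borel_measurable lborel" by measurable
  show "AE \<sigma> in lborel. norm (fourier f (\<sigma>\<^sub>0 - \<sigma>) * fourier h \<sigma>) \<le>
      norm ((1 * (cmod (fourier f (\<sigma>\<^sub>0 - \<sigma>)))\<^sup>2 + (cmod (fourier h \<sigma>))\<^sup>2 / 1) / 2)"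
    using order.trans[OF fourier_product_bound[OF zero_less_one] abs_ge_self] by simp
qed

lemma fourier_product_L1_bound:
  assumes a: "0 < a"
  shows "(LINT \<sigma>|lborel. cmod (fourier f (\<sigma>\<^sub>0 - \<sigma>) * fourier h \<sigma>)) \<le>
    (2 * pi) ^ DIM('b) * (a * (LINT x|lborel. (cmod (f x))\<^sup>2) + (LINT x|lborel. (cmod (h x))\<^sup>2) / a) / 2"
proof -
  have "(LINT \<sigma>|lborel. cmod (fourier f (\<sigma>\<^sub>0 - \<sigma>) * fourier h \<sigma>)) \<le>
      (LINT \<sigma>|lborel. (a * (cmod (fourier f (\<sigma>\<^sub>0 - \<sigma>)))\<^sup>2 + (cmod (fourier h \<sigma>))\<^sup>2 / a) / 2)"
    by (rule integral_mono[OF integrable_norm[OF fourier_product_integrable] _ fourier_product_bound[OF a]])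
       (use fourier_reflect(1) fourier_L2(1)[OF h] in simp)
  also have "\<dots> = (a * (LINT \<sigma>|lborel. (cmod (fourier f \<sigma>))\<^sup>2) + (LINT \<sigma>|lborel. (cmod (fourier h \<sigma>))\<^sup>2) / a) / 2"
    using fourier_reflect fourier_L2(1)[OF h] by simp
  also have "\<dots> \<le> (a * ((2 * pi) ^ DIM('b) * (LINT x|lborel. (cmod (f x))\<^sup>2)) +
      ((2 * pi) ^ DIM('b) * (LINT x|lborel. (cmod (h x))\<^sup>2)) / a) / 2"
    using fourier_L2(2)[OF f] fourier_L2(2)[OF h] a
    by (intro divide_right_mono add_mono mult_left_mono) auto
  finally show ?thesis by (simp add: algebra_simps add_divide_distrib)
qed

text \<open>
  No Fourier inversion is needed: the Gaussian-regularised identity \<open>fourier_product_regularised\<close>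
  passes to the limit because \<open>fourier f\<close> and \<open>fourier h\<close> are square integrable and \<open>f\<close> is continuous.
\<close>

lemma fourier_parseval:
  assumes B: "\<And>x. cmod (f x) \<le> B" and cont: "\<And>x. x \<noteq> 0 \<Longrightarrow> isCont f x"
  shows "(LINT \<sigma>|lborel. fourier f (\<sigma>\<^sub>0 - \<sigma>) * fourier h \<sigma>) =
    (2 * pi) ^ DIM('b) * fourier (\<lambda>x. f x * h x) \<sigma>\<^sub>0"
proof -
  have [measurable]: "f \<in> borel_measurable borel" "h \<in> borel_measurable borel"
    using f h by auto
  define \<delta> where "\<delta> j = 1 / real (Suc j)" for j
  have \<delta>: "0 < \<delta> j" for j by (simp add: \<delta>_def)
  have \<delta>0: "\<delta> \<longlonglongrightarrow> 0" unfolding \<delta>_def by (rule LIMSEQ_Suc[OF lim_1_over_n])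
  define F where "F x = exp (- (\<i> * complex_of_real (\<sigma>\<^sub>0 \<bullet> x))) * f x" for x
  have FB: "cmod (F x) \<le> B" for x using B by (simp add: F_def norm_mult)
  have F_cont: "isCont F x" if "x \<noteq> 0" for x
    unfolding F_def by (intro continuous_intros cont that)
  have [measurable]: "F \<in> borel_measurable borel" unfolding F_def by measurable
  let ?C = "(4 * pi) powr (real DIM('b) / 2)"
  have C0: "?C \<noteq> 0" "?C \<ge> 0" by auto
  have gauss_total: "?C * (LINT x|lborel. exp (- (1 * (norm (x::'b))\<^sup>2))) = (2 * pi) ^ DIM('b)"
  proof -
    have "heat 1 (x - 0) = ?C * exp (- (1 * (norm (x::'b))\<^sup>2))" for x by (simp add: heat_def)
    then show ?thesis using heat_integral(2)[of 1 "0::'b"] by (simp del: diff_zero)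
  qed
  note gauss_int = gaussian_integrable[of 1, OF zero_less_one, where 'b = 'b]
  define A where "A j \<nu> = (LINT \<mu>|lborel. F \<mu> * complex_of_real (heat (\<delta> j) (\<mu> - \<nu>)))" for j \<nu>
  \<comment> \<open>Rescaling by \<open>\<delta> j\<close> moves the dependence on j from the
    Gaussian weight into the argument of \<open>F\<close>, so one Gaussian majorant serves all
    j.\<close>
  have A: "A j \<nu> = (LINT x|lborel. F (\<nu> + \<delta> j *\<^sub>R x) * complex_of_real (?C * exp (- (1 * (norm x)\<^sup>2))))" for j \<nu>
    unfolding A_def using \<delta>[of j]
    by (subst lborel_affine_subst(2)[of "\<delta> j" _ \<nu>], simp, subst integral_scaleR_right [symmetric])
       (intro Bochner_Integration.integral_cong refl, simp add: heat_def scaleR_conv_of_real)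
  have A_bound: "cmod (A j \<nu>) \<le> B * (2 * pi) ^ DIM('b)" for j \<nu>
  proof -
    have "cmod (A j \<nu>) \<le> (LINT x|lborel. cmod (F (\<nu> + \<delta> j *\<^sub>R x) * complex_of_real (?C * exp (- (1 * (norm x)\<^sup>2)))))"
      unfolding A by (rule integral_norm_bound)
    also have "\<dots> \<le> (LINT x|lborel. B * (?C * exp (- (1 * (norm (x::'b))\<^sup>2))))"
    proof (rule integral_mono_AE')
      show "integrable lborel (\<lambda>x::'b. B * (?C * exp (- (1 * (norm x)\<^sup>2))))"
        by (intro integrable_mult_right gauss_int)
      show "AE x in lborel. cmod (F (\<nu> + \<delta> j *\<^sub>R x) * complex_of_real (?C * exp (- (1 * (norm x)\<^sup>2))))
          \<le> B * (?C * exp (- (1 * (norm x)\<^sup>2)))"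
        by (rule AE_I2) (auto simp: norm_mult intro!: mult_right_mono FB)
      show "AE x in lborel. 0 \<le> B * (?C * exp (- (1 * (norm (x::'b))\<^sup>2)))"
        using order.trans[OF norm_ge_zero FB] by simp
    qed
    also have "\<dots> = B * (2 * pi) ^ DIM('b)"
      by (simp only: integral_mult_right_zero gauss_total)
    finally show ?thesis .
  qed
  have A_lim: "(\<lambda>j. A j \<nu>) \<longlonglongrightarrow> F \<nu> * (2 * pi) ^ DIM('b)" if \<nu>: "\<nu> \<noteq> 0" for \<nu>
  proof -
    have "(\<lambda>j. A j \<nu>) \<longlonglongrightarrow> (LINT x|lborel. F \<nu> * complex_of_real (?C * exp (- (1 * (norm (x::'b))\<^sup>2))))"
      unfolding A
    proof (rule integral_dominated_convergence)
      show "integrable lborel (\<lambda>x::'b. B * (?C * exp (- (1 * (norm x)\<^sup>2))))"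
        by (intro integrable_mult_right gauss_int)
      show "AE x in lborel. (\<lambda>j. F (\<nu> + \<delta> j *\<^sub>R x) * complex_of_real (?C * exp (- (1 * (norm x)\<^sup>2))))
          \<longlonglongrightarrow> F \<nu> * complex_of_real (?C * exp (- (1 * (norm x)\<^sup>2)))"
      proof (rule AE_I2)
        fix x :: 'b
        have "(\<lambda>j. \<nu> + \<delta> j *\<^sub>R x) \<longlonglongrightarrow> \<nu> + 0 *\<^sub>R x" by (intro tendsto_intros \<delta>0)
        then have "(\<lambda>j. F (\<nu> + \<delta> j *\<^sub>R x)) \<longlonglongrightarrow> F \<nu>"
          using isCont_tendsto_compose[OF F_cont[OF \<nu>]] by simp
        then show "(\<lambda>j. F (\<nu> + \<delta> j *\<^sub>R x) * complex_of_real (?C * exp (- (1 * (norm x)\<^sup>2))))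
          \<longlonglongrightarrow> F \<nu> * complex_of_real (?C * exp (- (1 * (norm x)\<^sup>2)))"
          by (rule tendsto_mult_right)
      qed
      show "AE x in lborel. norm (F (\<nu> + \<delta> j *\<^sub>R x) * complex_of_real (?C * exp (- (1 * (norm x)\<^sup>2))))
          \<le> B * (?C * exp (- (1 * (norm x)\<^sup>2)))" for j
        by (rule AE_I2) (auto simp: norm_mult intro!: mult_right_mono FB)
    qed measurable
    also have "(LINT x|lborel. F \<nu> * complex_of_real (?C * exp (- (1 * (norm (x::'b))\<^sup>2)))) =
        F \<nu> * complex_of_real ((2 * pi) ^ DIM('b))"
      by (simp only: integral_mult_right_zero integral_complex_of_real gauss_total)
    finally show ?thesis by simp
  qed
  let ?E = "\<lambda>j (\<sigma>::'b). exp (- ((\<delta> j / 2)\<^sup>2 * (norm \<sigma>)\<^sup>2))"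
  let ?G = "\<lambda>\<sigma>. fourier f (\<sigma>\<^sub>0 - \<sigma>) * fourier h \<sigma>"
  have eq: "(LINT \<sigma>|lborel. complex_of_real (?E j \<sigma>) * ?G \<sigma>) = (LINT \<nu>|lborel. h \<nu> * A j \<nu>)" for j
  proof -
    let ?H = "\<lambda>p. F (fst p) * h (snd p) * complex_of_real (heat (\<delta> j) (fst p - snd p))"
    have int: "integrable (lborel \<Otimes>\<^sub>M lborel) ?H"
    proof (rule Bochner_Integration.integrable_bound)
      show "integrable (lborel \<Otimes>\<^sub>M lborel) (\<lambda>p. B * (cmod (h (snd p)) * heat (\<delta> j) (fst p - snd p)))"
        using h(1) by (intro integrable_mult_right heat_convolution(3) \<delta>) simp
      show "?H \<in> borel_measurable (lborel \<Otimes>\<^sub>M lborel)" by measurable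
      show "AE p in lborel \<Otimes>\<^sub>M lborel. norm (?H p) \<le> norm (B * (cmod (h (snd p)) * heat (\<delta> j) (fst p - snd p)))"
      proof (rule AE_I2)
        fix p
        have "cmod (F (fst p)) * (cmod (h (snd p)) * heat (\<delta> j) (fst p - snd p)) \<le>
            B * (cmod (h (snd p)) * heat (\<delta> j) (fst p - snd p))"
          by (intro mult_right_mono FB mult_nonneg_nonneg heat_nonneg \<delta>) simp
        then show "norm (?H p) \<le> norm (B * (cmod (h (snd p)) * heat (\<delta> j) (fst p - snd p)))"
          using heat_nonneg[OF \<delta>, of j "fst p - snd p"] by (simp add: norm_mult)
      qed
    qed
    have "(LINT \<sigma>|lborel. complex_of_real (?E j \<sigma>) * ?G \<sigma>) = (LINT p|(lborel \<Otimes>\<^sub>M lborel). ?H p)"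
      using fourier_product_regularised[OF \<delta>[of j] f(1) h(1), of \<sigma>\<^sub>0] by (simp add: F_def)
    also have "\<dots> = (LINT \<nu>|lborel. (LINT \<mu>|lborel. ?H (\<mu>, \<nu>)))"
      using lborel_pair.integral_snd[of "\<lambda>\<mu> \<nu>. ?H (\<mu>, \<nu>)"] int by (simp add: case_prod_unfold)
    also have "\<dots> = (LINT \<nu>|lborel. h \<nu> * A j \<nu>)"
      unfolding A_def integral_mult_right_zero [symmetric] by (simp add: mult_ac)
    finally show ?thesis .
  qed
  have "(\<lambda>j. LINT \<sigma>|lborel. complex_of_real (?E j \<sigma>) * ?G \<sigma>) \<longlonglongrightarrow> (LINT \<sigma>|lborel. ?G \<sigma>)"
  proof (rule integral_dominated_convergence)
    show "integrable lborel (\<lambda>\<sigma>. cmod (?G \<sigma>))"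
      using integrable_norm[OF fourier_product_integrable] .
    show "AE \<sigma> in lborel. (\<lambda>j. complex_of_real (?E j \<sigma>) * ?G \<sigma>) \<longlonglongrightarrow> ?G \<sigma>"
    proof (rule AE_I2)
      fix \<sigma> :: 'b
      have "(\<lambda>j. complex_of_real (?E j \<sigma>) * ?G \<sigma>) \<longlonglongrightarrow>
          complex_of_real (exp (- ((0 / 2)\<^sup>2 * (norm \<sigma>)\<^sup>2))) * ?G \<sigma>"
        by (intro tendsto_intros \<delta>0) auto
      then show "(\<lambda>j. complex_of_real (?E j \<sigma>) * ?G \<sigma>) \<longlonglongrightarrow> ?G \<sigma>" by simp
    qed
    show "AE \<sigma> in lborel. norm (complex_of_real (?E j \<sigma>) * ?G \<sigma>) \<le> cmod (?G \<sigma>)" for j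
      by (rule AE_I2) (simp add: norm_mult mult_left_le_one_le)
  qed measurable
  moreover have "(\<lambda>j. LINT \<nu>|lborel. h \<nu> * A j \<nu>) \<longlonglongrightarrow> (LINT \<nu>|lborel. h \<nu> * (F \<nu> * (2 * pi) ^ DIM('b)))"
  proof (rule integral_dominated_convergence)
    show "integrable lborel (\<lambda>\<nu>. cmod (h \<nu>) * (B * (2 * pi) ^ DIM('b)))"
      using h(1) by simp
    \<comment> \<open>Continuity of f is assumed off the origin, so the smoothed values converge
      there; the origin is a null set.\<close>
    show "AE \<nu> in lborel. (\<lambda>j. h \<nu> * A j \<nu>) \<longlonglongrightarrow> h \<nu> * (F \<nu> * (2 * pi) ^ DIM('b))"
      using AE_lborel_singleton[of "0::'b"]
      by eventually_elim (intro tendsto_mult_left A_lim)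
    show "AE \<nu> in lborel. norm (h \<nu> * A j \<nu>) \<le> cmod (h \<nu>) * (B * (2 * pi) ^ DIM('b))" for j
      by (rule AE_I2, unfold norm_mult) (intro mult_left_mono A_bound norm_ge_zero)
    show "(\<lambda>\<nu>. h \<nu> * A j \<nu>) \<in> borel_measurable lborel" for j
      unfolding A_def by measurable
  qed measurable
  ultimately have "(LINT \<sigma>|lborel. ?G \<sigma>) = (LINT \<nu>|lborel. h \<nu> * (F \<nu> * (2 * pi) ^ DIM('b)))"
    unfolding eq using LIMSEQ_unique by blast
  also have "\<dots> = (2 * pi) ^ DIM('b) * fourier (\<lambda>x. f x * h x) \<sigma>\<^sub>0"
    unfolding fourier_def integral_mult_right_zero [symmetric]
    by (intro Bochner_Integration.integral_cong refl) (simp add: F_def mult_ac)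
  finally show ?thesis .
qed

end

section \<open>The regularised time integral\<close>

text \<open>Packages the primitive of the Gamma integrand that starts at 0, so that the time
  integral can be evaluated by the fundamental theorem from end values alone.\<close>

lemma lower_incomplete_Gamma:
  fixes a :: real
  assumes a: "0 < a"
  obtains V where "\<And>x. 0 < x \<Longrightarrow> (V has_real_derivative x powr (a - 1) * exp (- x)) (at x)"
    and "(V \<longlongrightarrow> 0) (at_right 0)" and "(V \<longlongrightarrow> Gamma a) at_top"
proof
  let ?f = "\<lambda>t::real. t powr (a - 1) / exp t"
  define V where "V x = integral {0..x} ?f" for x
  have f: "(?f has_integral Gamma a) {0..}" by (rule Gamma_integral_real[OF a])
  have ai: "?f absolutely_integrable_on {0..}"
    using f by (intro nonnegative_absolutely_integrable_1) auto
  have int: "?f integrable_on {0..x}" for x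
    using f by (intro integrable_on_subinterval[of _ "{0..}"]) auto
  show "(V has_real_derivative x powr (a - 1) * exp (- x)) (at x)" if "0 < x" for x
  proof -
    have "(V has_vector_derivative ?f x) (at x within {0..x + 1} - {})"
      unfolding V_def
    proof (rule integral_has_vector_derivative_continuous_at)
      have "isCont ?f x" using that by (intro continuous_intros) auto
      then show "continuous (at x within ({0..x + 1} - {})) ?f"
        by (rule continuous_at_imp_continuous_within)
    qed (use int that in auto)
    then have "(V has_vector_derivative ?f x) (at x)"
      using that by (simp add: at_within_Icc_at)
    then show ?thesis
      by (simp add: has_real_derivative_iff_has_vector_derivative exp_minus field_simps)
  qed
  have "continuous_on {0..1} V"
    unfolding V_def by (rule indefinite_integral_continuous_1[OF int])
  then have "(V \<longlongrightarrow> V 0) (at 0 within {0..1})" by (auto simp: continuous_on)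
  then show "(V \<longlongrightarrow> 0) (at_right 0)"
    by (simp add: at_within_Icc_at_right V_def)
  have sb: "set_integrable lborel {0..} ?f"
    using ai unfolding set_integrable_def by (subst (asm) integrable_completion) auto
  then have "((\<lambda>y. LINT x|lborel. indicator {..y} x *\<^sub>R (indicator {0..} x *\<^sub>R ?f x)) \<longlongrightarrow>
      (LINT x|lborel. indicator {0..} x *\<^sub>R ?f x)) at_top"
    unfolding set_integrable_def by (intro tendsto_integral_at_top) auto
  also have "(LINT x|lborel. indicator {0..} x *\<^sub>R ?f x) = Gamma a"
    using set_borel_integral_eq_integral(2)[OF sb] f
    by (simp add: set_lebesgue_integral_def integral_unique)
  also have "(\<lambda>y. LINT x|lborel. indicator {..y} x *\<^sub>R (indicator {0..} x *\<^sub>R ?f x)) = V"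
  proof
    fix y
    have "(LINT x|lborel. indicator {..y} x *\<^sub>R (indicator {0..} x *\<^sub>R ?f x)) = (LINT x:{0..y}|lborel. ?f x)"
      unfolding set_lebesgue_integral_def
      by (intro Bochner_Integration.integral_cong) (auto split: split_indicator)
    also have "\<dots> = V y"
      unfolding V_def
      by (rule set_borel_integral_eq_integral) (rule set_integrable_subset[OF sb], auto)
    finally show "(LINT x|lborel. indicator {..y} x *\<^sub>R (indicator {0..} x *\<^sub>R ?f x)) = V y" .
  qed
  finally show "(V \<longlongrightarrow> Gamma a) at_top" .
qed

text \<open>For a = m/2 and c = |z|^2/4 this is, up to a constant, Mehler's kernel: the Fourier
  transform in the centre of the heat kernel of the group. The default 0 for t <= 0 lets time
  integrals run over the whole line and cuts off \<open>mehler a c \<rho> (T - t)\<close> at t =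
  T.\<close>

definition mehler :: "real \<Rightarrow> real \<Rightarrow> real \<Rightarrow> real \<Rightarrow> real" where
  "mehler a c \<rho> t = (if 0 < t then hs \<rho> t powr a * exp (- (c * hc \<rho> t)) else 0)"

lemma measurable_mehler [measurable]:
  assumes [measurable]: "d \<in> borel_measurable M" "f \<in> borel_measurable M" "g \<in> borel_measurable M"
  shows "(\<lambda>x. mehler a (d x) (f x) (g x)) \<in> borel_measurable M"
  unfolding mehler_def by measurable

lemma mehler_nonneg: "0 \<le> mehler a c \<rho> t"
  by (simp add: mehler_def)

lemma mehler_has_derivative:
  assumes "0 \<le> \<rho>" "0 < t"
  shows "(mehler (1 - s) c \<rho> has_real_derivative
    mehler (1 - s) c \<rho> t * (c * (hs \<rho> t)\<^sup>2 - (1 - s) * hc \<rho> t)) (at t)"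
proof -
  have p: "hs \<rho> t > 0" by (rule hs_pos[OF assms])
  define w where "w = hs \<rho> t powr (- s)"
  have w: "hs \<rho> t powr (1 - s) = hs \<rho> t * w" "hs \<rho> t powr (1 - s - 1) = w"
    using p powr_add[of "hs \<rho> t" 1 "- s"] by (simp_all add: w_def)
  have d: "((\<lambda>t. hs \<rho> t powr (1 - s)) has_real_derivative
      ((1 - s) * hs \<rho> t powr (1 - s - 1)) * (- (hs \<rho> t * hc \<rho> t))) (at t)"
    by (rule DERIV_chain2[OF has_real_derivative_powr[OF p] hs_has_derivative[OF assms]])
  have e: "((\<lambda>t. exp (- (c * hc \<rho> t))) has_real_derivative
      exp (- (c * hc \<rho> t)) * (c * (hs \<rho> t)\<^sup>2)) (at t)"
    using assms by (auto intro!: derivative_eq_intros hc_has_derivative)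
  have "((\<lambda>t. hs \<rho> t powr (1 - s) * exp (- (c * hc \<rho> t))) has_real_derivative
      mehler (1 - s) c \<rho> t * (c * (hs \<rho> t)\<^sup>2 - (1 - s) * hc \<rho> t)) (at t)"
    by (rule DERIV_cong[OF DERIV_mult[OF d e]])
       (unfold mehler_def w, use assms in \<open>simp add: algebra_simps\<close>)
  then show ?thesis
    by (rule has_field_derivative_transform_within_open[of _ _ _ "{0<..}"])
       (use assms in \<open>auto simp: mehler_def\<close>)
qed

text \<open>The point is uniformity in \<rho> and T. Half of the exponential absorbs powers of
  \<open>hc\<close>; the other half stays as a weight that will secure integrability over T and the
  dual variable. For small t the shift of time costs O(t) by the mean value theorem, and replacing
  \<open>(t * hs \<rho> t) powr (1 + s)\<close> by 1 costs O(\<rho> t), where \<rho> <=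
  \<open>hc \<rho> T\<close>; for large t boundedness of both terms suffices.\<close>

lemma mehler_increment_bound:
  fixes s c :: real
  assumes s: "0 < s" "s < 1" and c: "0 < c"
  obtains M where "0 < M"
    "\<And>\<rho> T. 0 \<le> \<rho> \<Longrightarrow> 0 < T \<Longrightarrow> mehler (1 - s) c \<rho> T \<le> M * exp (- (c / 2 * hc \<rho> T))"
    "\<And>\<rho> T t. 0 \<le> \<rho> \<Longrightarrow> 0 < T \<Longrightarrow> 0 < t \<Longrightarrow>
      \<bar>(t * hs \<rho> t) powr (1 + s) * mehler (1 - s) c \<rho> (T - t) - mehler (1 - s) c \<rho> T\<bar> \<le>
        M * min 1 t * exp (- (c / 2 * hc \<rho> T))"
proof -
  \<comment> \<open>The exponents belong to \<open>mehler\<close> itself, to \<open>mehler\<close>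
    times \<open>hc\<close>, and to \<open>mehler\<close> times the square of \<open>hc\<close>; the
    derivative of \<open>mehler\<close> contains c times the square of \<open>hs\<close>, whence the
    third.\<close>
  obtain M1 where M1: "0 < M1" "\<And>x. 0 \<le> x \<Longrightarrow> x powr (1 - s) * exp (- (c / 2 * x)) \<le> M1"
    using powr_mult_exp_bounded[of "1 - s" "c / 2"] s c by auto
  obtain M2 where M2: "0 < M2" "\<And>x. 0 \<le> x \<Longrightarrow> x powr (2 - s) * exp (- (c / 2 * x)) \<le> M2"
    using powr_mult_exp_bounded[of "2 - s" "c / 2"] s c by auto
  obtain M3 where M3: "0 < M3" "\<And>x. 0 \<le> x \<Longrightarrow> x powr (3 - s) * exp (- (c / 2 * x)) \<le> M3"
    using powr_mult_exp_bounded[of "3 - s" "c / 2"] s c by auto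
  define E where "E \<rho> T = exp (- (c / 2 * hc \<rho> T))" for \<rho> T
  have E: "0 \<le> E \<rho> T" for \<rho> T by (simp add: E_def)
  have split: "exp (- (c * x)) = exp (- (c / 2 * x)) * exp (- (c / 2 * x))" for x
    by (simp add: exp_add [symmetric])
  have mehler_le': "mehler (1 - s) c \<rho> T \<le> hc \<rho> T powr (1 - s) * exp (- (c / 2 * hc \<rho> T)) * E \<rho> T"
    if "0 \<le> \<rho>" "0 < T" for \<rho> T
    using hs_le_hc[OF that] hs_pos[OF that] s that
    by (auto simp: mehler_def E_def split mult.assoc intro!: mult_right_mono powr_mono2)
  have b1: "mehler (1 - s) c \<rho> T \<le> M1 * E \<rho> T" if "0 \<le> \<rho>" "0 < T" for \<rho> T
    using mehler_le'[OF that] mult_right_mono[OF M1(2)[of "hc \<rho> T"] E] hc_pos[OF that] by (meson less_imp_le order.trans)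
  have b2: "hc \<rho> T * mehler (1 - s) c \<rho> T \<le> M2 * E \<rho> T" if "0 \<le> \<rho>" "0 < T" for \<rho> T
  proof -
    have p: "hc \<rho> T > 0" by (rule hc_pos[OF that])
    have "hc \<rho> T * mehler (1 - s) c \<rho> T \<le> hc \<rho> T * (hc \<rho> T powr (1 - s) * exp (- (c / 2 * hc \<rho> T)) * E \<rho> T)"
      using mehler_le'[OF that] p by simp
    also have "\<dots> = hc \<rho> T powr (2 - s) * exp (- (c / 2 * hc \<rho> T)) * E \<rho> T"
    proof -
      have "hc \<rho> T powr (2 - s) = hc \<rho> T * hc \<rho> T powr (1 - s)"
        using p powr_add[of "hc \<rho> T" 1 "1 - s"] by simp
      then show ?thesis by simp
    qed
    also have "\<dots> \<le> M2 * E \<rho> T" using p by (intro mult_right_mono M2 E) auto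
    finally show ?thesis .
  qed
  have b3: "(hc \<rho> T)\<^sup>2 * mehler (1 - s) c \<rho> T \<le> M3 * E \<rho> T" if "0 \<le> \<rho>" "0 < T" for \<rho> T
  proof -
    have p: "hc \<rho> T > 0" by (rule hc_pos[OF that])
    have "(hc \<rho> T)\<^sup>2 * mehler (1 - s) c \<rho> T \<le> (hc \<rho> T)\<^sup>2 * (hc \<rho> T powr (1 - s) * exp (- (c / 2 * hc \<rho> T)) * E \<rho> T)"
      using mehler_le'[OF that] p by simp
    also have "\<dots> = hc \<rho> T powr (3 - s) * exp (- (c / 2 * hc \<rho> T)) * E \<rho> T"
    proof -
      have "hc \<rho> T powr (3 - s) = (hc \<rho> T)\<^sup>2 * hc \<rho> T powr (1 - s)"
        using p powr_add[of "hc \<rho> T" 2 "1 - s"] by simp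
      then show ?thesis by simp
    qed
    also have "\<dots> \<le> M3 * E \<rho> T" using p by (intro mult_right_mono M3 E) auto
    finally show ?thesis .
  qed
  define N where "N = M2 + c * M3"
  have N: "0 < N" using M2 M3 c by (simp add: N_def add_pos_pos)
  have b4: "\<bar>mehler (1 - s) c \<rho> u * (c * (hs \<rho> u)\<^sup>2 - (1 - s) * hc \<rho> u)\<bar> \<le> N * E \<rho> u" if "0 \<le> \<rho>" "0 < u" for \<rho> u
  proof -
    have p: "hc \<rho> u > 0" "hs \<rho> u > 0" "hs \<rho> u \<le> hc \<rho> u"
      using that by (auto intro: hc_pos hs_pos hs_le_hc)
    have "\<bar>c * (hs \<rho> u)\<^sup>2 - (1 - s) * hc \<rho> u\<bar> \<le> \<bar>c * (hs \<rho> u)\<^sup>2\<bar> + \<bar>(1 - s) * hc \<rho> u\<bar>"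
      by (rule abs_triangle_ineq4)
    also have "\<dots> = c * (hs \<rho> u)\<^sup>2 + (1 - s) * hc \<rho> u" using p s c by (simp add: abs_mult)
    also have "\<dots> \<le> c * (hc \<rho> u)\<^sup>2 + 1 * hc \<rho> u"
      using p s c by (intro add_mono mult_left_mono mult_right_mono power_mono) auto
    finally have "\<bar>mehler (1 - s) c \<rho> u * (c * (hs \<rho> u)\<^sup>2 - (1 - s) * hc \<rho> u)\<bar> \<le>
        mehler (1 - s) c \<rho> u * (c * (hc \<rho> u)\<^sup>2 + 1 * hc \<rho> u)"
      unfolding abs_mult using mehler_nonneg[of "1 - s" c \<rho> u] by (intro mult_mono) auto
    also have "\<dots> = c * ((hc \<rho> u)\<^sup>2 * mehler (1 - s) c \<rho> u) + hc \<rho> u * mehler (1 - s) c \<rho> u" by (simp add: algebra_simps)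
    also have "\<dots> \<le> c * (M3 * E \<rho> u) + M2 * E \<rho> u"
      using b2[OF that] b3[OF that] c by (intro add_mono mult_left_mono) auto
    finally show ?thesis by (simp add: N_def algebra_simps)
  qed
  have E_mono: "E \<rho> u \<le> E \<rho> T" if "0 \<le> \<rho>" "0 < u" "u \<le> T" for \<rho> u T
    using hc_decreasing[OF that] c by (simp add: E_def)
  have diff1: "\<bar>mehler (1 - s) c \<rho> (T - t) - mehler (1 - s) c \<rho> T\<bar> \<le> M1 * E \<rho> T"
    if "0 \<le> \<rho>" "0 < T" "0 < t" for \<rho> T t
  proof -
    have "mehler (1 - s) c \<rho> (T - t) \<le> M1 * E \<rho> T"
    proof (cases "t < T")
      case True
      then have "mehler (1 - s) c \<rho> (T - t) \<le> M1 * E \<rho> (T - t)" by (intro b1) (use that in auto)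
      also have "\<dots> \<le> M1 * E \<rho> T"
        using True that M1 by (intro mult_left_mono E_mono) auto
      finally show ?thesis .
    next
      case False
      then show ?thesis using M1 by (simp add: mehler_def E_def)
    qed
    then show ?thesis using b1[OF that(1,2)] mehler_nonneg[of "1 - s" c \<rho> T] mehler_nonneg[of "1 - s" c \<rho> "T - t"] by linarith
  qed
  have diff2: "\<bar>mehler (1 - s) c \<rho> (T - t) - mehler (1 - s) c \<rho> T\<bar> \<le> t * ((N + M2) * E \<rho> T)"
    if "0 \<le> \<rho>" "0 < T" "0 < t" for \<rho> T t
  proof (cases "t < T")
    case True
    have "norm (mehler (1 - s) c \<rho> (T - t) - mehler (1 - s) c \<rho> T) \<le> N * E \<rho> T * norm ((T - t) - T)"
    proof (rule field_differentiable_bound[where S = "{T - t..T}"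
          and f' = "\<lambda>u. mehler (1 - s) c \<rho> u * (c * (hs \<rho> u)\<^sup>2 - (1 - s) * hc \<rho> u)"])
      fix u assume u: "u \<in> {T - t..T}"
      then have "0 < u" using True by auto
      then show "(mehler (1 - s) c \<rho> has_field_derivative mehler (1 - s) c \<rho> u * (c * (hs \<rho> u)\<^sup>2 - (1 - s) * hc \<rho> u))
          (at u within {T - t..T})"
        using mehler_has_derivative[OF that(1)] by (blast intro: has_field_derivative_at_within)
      have "\<bar>mehler (1 - s) c \<rho> u * (c * (hs \<rho> u)\<^sup>2 - (1 - s) * hc \<rho> u)\<bar> \<le> N * E \<rho> u"
        by (rule b4) fact+
      also have "\<dots> \<le> N * E \<rho> T"
        using \<open>0 < u\<close> u that N by (intro mult_left_mono E_mono) auto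
      finally show "norm (mehler (1 - s) c \<rho> u * (c * (hs \<rho> u)\<^sup>2 - (1 - s) * hc \<rho> u)) \<le> N * E \<rho> T" by simp
    qed (use that in auto)
    also have "\<dots> \<le> (N + M2) * E \<rho> T * t"
      using that M2 E by (simp add: mult_right_mono)
    finally show ?thesis by (simp add: mult_ac)
  next
    case False
    \<comment> \<open>Here t >= T and the shifted term is 0. The factor t is gained from T <= t
      together with 1 / T <= \<open>hc \<rho> T\<close>.\<close>
    have "mehler (1 - s) c \<rho> T = T * (1 / T * mehler (1 - s) c \<rho> T)" using that by simp
    also have "\<dots> \<le> t * (hc \<rho> T * mehler (1 - s) c \<rho> T)"
      using False that inverse_le_hc[OF that(1,2)] mehler_nonneg[of "1 - s" c \<rho> T]
      by (intro mult_mono mult_right_mono) auto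
    also have "\<dots> \<le> t * (M2 * E \<rho> T)"
      using b2[OF that(1,2)] that by (intro mult_left_mono) auto
    also have "\<dots> \<le> t * ((N + M2) * E \<rho> T)"
      using that N E by (intro mult_left_mono mult_right_mono) auto
    finally show ?thesis using False mehler_nonneg[of "1 - s" c \<rho> T] by (simp add: mehler_def[of _ _ _ "T - t"])
  qed
  define M where "M = 2 * M1 + N + 3 * M2"
  have M: "0 < M" using M1 M2 N by (simp add: M_def)
  show ?thesis
  proof (rule that[of M])
    show "0 < M" by (rule M)
    show "mehler (1 - s) c \<rho> T \<le> M * exp (- (c / 2 * hc \<rho> T))" if "0 \<le> \<rho>" "0 < T" for \<rho> T
    proof -
      have "M1 * E \<rho> T \<le> M * E \<rho> T" using M1 M2 N E by (intro mult_right_mono) (auto simp: M_def)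
      then show ?thesis using b1[OF that] unfolding E_def by linarith
    qed
    fix \<rho> T t :: real assume A: "0 \<le> \<rho>" "0 < T" "0 < t"
    define w where "w = (t * hs \<rho> t) powr (1 + s)"
    have x: "0 < t * hs \<rho> t" "t * hs \<rho> t \<le> 1"
      using hs_pos[OF A(1,3)] hs_le_inverse[OF A(1,3)] A by (auto simp: field_simps)
    have w: "0 \<le> w" "w \<le> 1"
      using x s powr_le1[of "1 + s" "t * hs \<rho> t"] by (auto simp: w_def)
    \<comment> \<open>The base lies in (0, 1] and 1 + s <= 2, so \<open>w\<close> is at least the
      square of the base, hence at least (1 - \<rho> t)^2; the 2 comes from this square.\<close>
    have w1: "1 - w \<le> 2 * \<rho> * t"
    proof (cases "\<rho> * t \<le> 1")
      case True
      have "1 - 2 * (\<rho> * t) \<le> (1 - \<rho> * t)\<^sup>2"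
        using zero_le_power2[of "\<rho> * t"] by (simp add: power2_eq_square algebra_simps)
      also have "\<dots> \<le> (t * hs \<rho> t)\<^sup>2"
        using True hs_ge[OF A(1,3)] by (intro power_mono) auto
      also have "\<dots> = (t * hs \<rho> t) powr 2" using x by simp
      also have "\<dots> \<le> w" unfolding w_def by (rule powr_mono') (use x s in auto)
      finally show ?thesis by simp
    next
      case False
      then show ?thesis using w A by simp
    qed
    define a b where "a = mehler (1 - s) c \<rho> (T - t)" and "b = mehler (1 - s) c \<rho> T"
    have ab: "0 \<le> a" "0 \<le> b" by (auto simp: a_def b_def mehler_nonneg)
    have key: "\<bar>w * a - b\<bar> \<le> \<bar>a - b\<bar> + (1 - w) * b"
    proof -
      have "w * a - b = w * (a - b) - (1 - w) * b" by (simp add: algebra_simps)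
      then have "\<bar>w * a - b\<bar> \<le> \<bar>w * (a - b)\<bar> + \<bar>(1 - w) * b\<bar>" by simp
      also have "\<dots> \<le> \<bar>a - b\<bar> + (1 - w) * b"
        using w ab by (simp add: abs_mult mult_left_le_one_le)
      finally show ?thesis .
    qed
    have 1: "(1 - w) * b \<le> M1 * E \<rho> T"
      using mult_right_mono[of "1 - w" 1 b] w ab b1[OF A(1,2)] by (simp add: b_def)
    have 2: "(1 - w) * b \<le> t * (2 * M2 * E \<rho> T)"
    proof -
      have "(1 - w) * b \<le> 2 * \<rho> * t * b" using w1 ab(2) by (rule mult_right_mono)
      also have "\<dots> = t * (2 * (\<rho> * b))" by simp
      also have "\<dots> \<le> t * (2 * (hc \<rho> T * b))"
        using A ab rho_le_hc[OF A(1,2)] by (intro mult_left_mono mult_right_mono) auto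
      also have "\<dots> \<le> t * (2 * (M2 * E \<rho> T))"
        using A b2[OF A(1,2)] by (intro mult_left_mono) (auto simp: b_def)
      finally show ?thesis by simp
    qed
    have "\<bar>w * a - b\<bar> \<le> M * min 1 t * E \<rho> T"
    proof (cases "t \<le> 1")
      case True
      have "\<bar>w * a - b\<bar> \<le> t * ((N + M2) * E \<rho> T) + t * (2 * M2 * E \<rho> T)"
        using key diff2[OF A] 2 unfolding a_def b_def by linarith
      also have "\<dots> = (N + 3 * M2) * (t * E \<rho> T)" by (simp add: algebra_simps)
      also have "\<dots> \<le> M * (t * E \<rho> T)"
        using M1 A E by (intro mult_right_mono) (auto simp: M_def)
      finally show ?thesis using True by (simp add: min_absorb2 mult_ac)
    next
      case False
      have "\<bar>w * a - b\<bar> \<le> M1 * E \<rho> T + M1 * E \<rho> T"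
        using key diff1[OF A] 1 unfolding a_def b_def by linarith
      also have "\<dots> = (2 * M1) * E \<rho> T" by simp
      also have "\<dots> \<le> M * E \<rho> T" using M2 N E by (intro mult_right_mono) (auto simp: M_def)
      finally show ?thesis using False by (simp add: min_absorb1)
    qed
    then show "\<bar>(t * hs \<rho> t) powr (1 + s) * mehler (1 - s) c \<rho> (T - t) - mehler (1 - s) c \<rho> T\<bar> \<le>
        M * min 1 t * exp (- (c / 2 * hc \<rho> T))"
      by (simp add: a_def b_def w_def E_def)
  qed
qed

lemma set_integrable_lborelI_nonneg:
  fixes f :: "real \<Rightarrow> real"
  assumes "(f has_integral I) S" "\<And>x. x \<in> S \<Longrightarrow> 0 \<le> f x" "S \<in> sets borel" "f \<in> borel_measurable borel"
  shows "set_integrable lborel S f"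
proof -
  have "f absolutely_integrable_on S"
    using assms by (intro nonnegative_absolutely_integrable_1) auto
  moreover have "(\<lambda>x. indicator S x *\<^sub>R f x) \<in> borel_measurable borel"
    using assms(3,4) by measurable
  ultimately show ?thesis
    unfolding set_integrable_def by (subst (asm) integrable_completion) auto
qed

lemma integrable_min_powr:
  assumes s: "0 < s" "s < 1"
  shows "set_integrable lborel {0<..} (\<lambda>t::real. 1 / t powr (1 + s) * min 1 t)"
proof -
  have 1: "set_integrable lborel {0..1} (\<lambda>t::real. t powr (- s))"
    by (rule set_integrable_lborelI_nonneg[OF has_integral_powr_from_0]) (use s in auto)
  have 2: "set_integrable lborel {1..} (\<lambda>t::real. t powr (- (1 + s)))"
    by (rule set_integrable_lborelI_nonneg[OF has_integral_powr_to_inf]) (use s in auto)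
  have "integrable lborel (\<lambda>t::real. indicator {0..1} t *\<^sub>R t powr (- s) + indicator {1..} t *\<^sub>R t powr (- (1 + s)))"
    using 1 2 unfolding set_integrable_def by (rule Bochner_Integration.integrable_add)
  then show ?thesis
    unfolding set_integrable_def
  proof (rule Bochner_Integration.integrable_bound)
    show "AE t in lborel. norm (indicator {0<..} t *\<^sub>R (1 / t powr (1 + s) * min 1 t)) \<le>
       norm (indicator {0..1} t *\<^sub>R t powr (- s) + indicator {1..} t *\<^sub>R t powr (- (1 + s)))"
    proof (rule AE_I2)
      fix t :: real
      have 1: "1 / t powr (1 + s) = t powr (- (1 + s))" by (rule powr_minus_divide [symmetric])
      have 2: "t powr (- (1 + s)) * t = t powr (- s)" if "0 < t"
      proof -
        have "t powr (- (1 + s)) * t = t powr (- (1 + s)) * t powr 1" using that by simp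
        also have "\<dots> = t powr (- s)" by (simp only: powr_add [symmetric]) simp
        finally show ?thesis .
      qed
      show "norm (indicator {0<..} t *\<^sub>R (1 / t powr (1 + s) * min 1 t)) \<le>
          norm (indicator {0..1} t *\<^sub>R t powr (- s) + indicator {1..} t *\<^sub>R t powr (- (1 + s)))"
        unfolding 1 using 2
        by (cases "0 < t"; cases "t \<le> 1") (auto simp: min_def indicator_def)
    qed
  qed auto
qed

section \<open>Evaluation of the time integral for one total time and one frequency\<close>

context
  fixes s c \<rho> T :: real
  assumes s: "0 < s" "s < 1" and c: "0 < c" and rho: "0 \<le> \<rho>" and T: "0 < T"
begin

text \<open>The two powers multiply to \<open>hs \<rho> t powr (1 + s)\<close>. Grouped as
  \<open>t * hs \<rho> t\<close>, a quantity in (0, 1] close to 1 for small t, they exhibit the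
  cancellation against the subtracted term at t = 0.\<close>

definition increment :: "real \<Rightarrow> real" where
  "increment t = 1 / t powr (1 + s) * ((t * hs \<rho> t) powr (1 + s) * mehler (1 - s) c \<rho> (T - t) - mehler (1 - s) c \<rho> T)"

lemma increment_integrable: "set_integrable lborel {0<..} increment"
proof -
  obtain M where M: "0 < M" "\<And>t. 0 < t \<Longrightarrow>
      \<bar>(t * hs \<rho> t) powr (1 + s) * mehler (1 - s) c \<rho> (T - t) - mehler (1 - s) c \<rho> T\<bar> \<le>
        M * min 1 t * exp (- (c / 2 * hc \<rho> T))"
    using mehler_increment_bound[OF s c] rho T by metis
  have "set_integrable lborel {0<..} (\<lambda>t. (M * exp (- (c / 2 * hc \<rho> T))) * (1 / t powr (1 + s) * min 1 t))"
    by (intro set_integrable_mult_right integrable_min_powr s)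
  then show ?thesis
    unfolding set_integrable_def
  proof (rule Bochner_Integration.integrable_bound)
    show "(\<lambda>t. indicator {0<..} t *\<^sub>R increment t) \<in> borel_measurable lborel"
      unfolding increment_def by measurable
    show "AE t in lborel. norm (indicator {0<..} t *\<^sub>R increment t) \<le>
      norm (indicator {0<..} t *\<^sub>R ((M * exp (- (c / 2 * hc \<rho> T))) * (1 / t powr (1 + s) * min 1 t)))"
    proof (rule AE_I2)
      fix t :: real
      show "norm (indicator {0<..} t *\<^sub>R increment t) \<le>
        norm (indicator {0<..} t *\<^sub>R ((M * exp (- (c / 2 * hc \<rho> T))) * (1 / t powr (1 + s) * min 1 t)))"
      proof (cases "0 < t")
        case True
        have "\<bar>increment t\<bar> \<le> 1 / t powr (1 + s) * (M * min 1 t * exp (- (c / 2 * hc \<rho> T)))"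
          unfolding increment_def abs_mult using M(2)[OF True] by (intro mult_mono) auto
        then show ?thesis using True M(1) by (simp add: abs_mult mult_ac)
      qed simp
    qed
  qed
qed

text \<open>For t < T the integrand has the primitive \<open>A\<close>; for t > T only the
  subtracted term is left, and its integral cancels the end value of \<open>A\<close> at T. The
  result is minus the limit of \<open>A\<close> at 0, namely - D c^s Gamma(1 - s)/s, that is D c^s
  Gamma(- s).\<close>

lemma increment_integral:
  "(LINT t:{0<..}|lborel. increment t) =
    - (Gamma (1 - s) / s * c powr s * (hs \<rho> T powr (1 + s) * exp (- (c * hc \<rho> T))))"
proof -
  obtain V where V: "\<And>x. 0 < x \<Longrightarrow> (V has_real_derivative x powr (- s) * exp (- x)) (at x)"
    "(V \<longlongrightarrow> 0) (at_right 0)" "(V \<longlongrightarrow> Gamma (1 - s)) at_top"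
    using lower_incomplete_Gamma[of "1 - s"] s by auto
  \<comment> \<open>\<open>H\<close> is \<open>\<integral> w\<^bsup>-1-s\<^esup> exp (- c w) dw\<close> over \<open>w > x\<close>, integrated by parts once; the singular parts
     of the two terms of the antiderivative \<open>A\<close> cancel at \<open>t = 0\<close>.\<close>
  define D where "D = hs \<rho> T powr (1 + s) * exp (- (c * hc \<rho> T))"
  define v where "v t = hc \<rho> (T - t) - hc \<rho> T" for t
  define H where "H x = x powr (- s) * exp (- (c * x)) / s - c powr s / s * (Gamma (1 - s) - V (c * x))" for x
  define A where "A t = mehler (1 - s) c \<rho> T / s * t powr (- s) - D * H (v t)" for t
  have hsT: "hs \<rho> T > 0" by (rule hs_pos[OF rho T])
  have v_eq: "v t = hs \<rho> (T - t) * hs \<rho> T / hs \<rho> t" if "0 < t" "t < T" for t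
    using hc_diff[OF rho, of t "T - t"] that by (simp add: v_def)
  have v_pos: "0 < v t" if "0 < t" "t < T" for t
    unfolding v_eq[OF that] using hs_pos[OF rho] that T by simp
  have H': "(H has_real_derivative - (x powr (- 1 - s) * exp (- (c * x)))) (at x)" if x: "0 < x" for x
  proof -
    have V': "((\<lambda>x. V (c * x)) has_real_derivative ((c * x) powr (- s) * exp (- (c * x))) * c) (at x)"
      by (rule DERIV_chain2[OF V(1)]) (use x c in \<open>auto intro!: derivative_eq_intros\<close>)
    have P': "((\<lambda>x. x powr (- s)) has_real_derivative (- s) * x powr (- s - 1)) (at x)"
      by (rule has_real_derivative_powr[OF x])
    have E': "((\<lambda>x. exp (- (c * x))) has_real_derivative exp (- (c * x)) * (- c)) (at x)"
      by (auto intro!: derivative_eq_intros)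
    have "(H has_real_derivative
        (((- s) * x powr (- s - 1)) * exp (- (c * x)) + (exp (- (c * x)) * (- c)) * x powr (- s)) / s
        - c powr s / s * (0 - ((c * x) powr (- s) * exp (- (c * x))) * c)) (at x)"
      unfolding H_def
      by (intro DERIV_diff DERIV_cdivide DERIV_cmult DERIV_mult DERIV_const P' E' V')
    also have "c powr s / s * (0 - ((c * x) powr (- s) * exp (- (c * x))) * c) =
        - (c / s * x powr (- s) * exp (- (c * x)))"
    proof -
      have "c powr s * c powr (- s) = 1" using c by (simp add: powr_minus)
      then have "c powr s * (c * x) powr (- s) = x powr (- s)"
        using c x by (simp add: powr_mult mult.assoc [symmetric])
      then show ?thesis by (simp add: field_simps)
    qed
    also have "(((- s) * x powr (- s - 1)) * exp (- (c * x)) + (exp (- (c * x)) * (- c)) * x powr (- s)) / s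
        - - (c / s * x powr (- s) * exp (- (c * x))) = - (x powr (- 1 - s) * exp (- (c * x)))"
    proof -
      have "- s - 1 = - 1 - s" by simp
      then show ?thesis using s by (simp only:) (simp add: field_simps)
    qed
    finally show ?thesis .
  qed
  have v': "(v has_real_derivative (hs \<rho> (T - t))\<^sup>2) (at t)" if "t < T" for t
  proof -
    have "((\<lambda>t. hc \<rho> (T - t)) has_real_derivative (- ((hs \<rho> (T - t))\<^sup>2)) * (- 1)) (at t)"
      by (rule DERIV_chain2[OF hc_has_derivative[OF rho]])
         (use that in \<open>auto intro!: derivative_eq_intros\<close>)
    then show ?thesis
      unfolding v_def using DERIV_diff[OF _ DERIV_const] by fastforce
  qed
  define g where "g t = hs \<rho> t powr (1 + s) * mehler (1 - s) c \<rho> (T - t) - mehler (1 - s) c \<rho> T * t powr (- 1 - s)" for t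
  have inc: "increment t = g t" if "0 < t" for t
  proof -
    have "- 1 - s = - (1 + s)" by simp
    then have "t powr (- 1 - s) = 1 / t powr (1 + s)"
      using powr_minus_divide[of t "1 + s"] by simp
    then show ?thesis using that hs_pos[OF rho that]
      by (simp add: increment_def g_def powr_mult field_simps)
  qed
  \<comment> \<open>The change of variables at the level of powers. The square of
    \<open>hs \<rho> (T - t)\<close> is the derivative of \<open>v\<close>, and
    \<open>v t powr (- 1 - s)\<close> trades the exponent 1 + s at time T for 1 + s at time t and,
    with the Jacobian, 1 - s at time T - t.\<close>
  have powr_step: "hs \<rho> T powr (1 + s) * v t powr (- 1 - s) * (hs \<rho> (T - t))\<^sup>2 =
      hs \<rho> t powr (1 + s) * hs \<rho> (T - t) powr (1 - s)" if t: "0 < t" "t < T" for t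
  proof -
    define a b d where "a = hs \<rho> T" and "b = hs \<rho> (T - t)" and "d = hs \<rho> t"
    have p: "0 < a" "0 < b" "0 < d" using hs_pos[OF rho] t T by (auto simp: a_def b_def d_def)
    have "(b * a / d) powr (- 1 - s) = b powr (- 1 - s) * a powr (- 1 - s) / d powr (- 1 - s)"
      using p by (simp add: powr_mult powr_divide)
    moreover have "d powr (- 1 - s) = 1 / d powr (1 + s)" "a powr (- 1 - s) = 1 / a powr (1 + s)"
      using powr_minus_divide[of _ "1 + s"] by simp_all
    moreover have "b powr (- 1 - s) * b\<^sup>2 = b powr (1 - s)"
      using p powr_add[of b "- 1 - s" 2] by simp
    ultimately show ?thesis
      unfolding v_eq[OF t] a_def[symmetric] b_def[symmetric] d_def[symmetric]
      using p by (simp add: field_simps)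
  qed
  have A': "(A has_real_derivative g t) (at t)" if t: "0 < t" "t < T" for t
  proof -
    have "((\<lambda>t. t powr (- s)) has_real_derivative (- s) * t powr (- s - 1)) (at t)"
      by (rule has_real_derivative_powr[OF t(1)])
    moreover have "((\<lambda>t. H (v t)) has_real_derivative
        - (v t powr (- 1 - s) * exp (- (c * v t))) * (hs \<rho> (T - t))\<^sup>2) (at t)"
      by (rule DERIV_chain2[OF H'[OF v_pos[OF t]] v'[OF t(2)]])
    ultimately have "(A has_real_derivative mehler (1 - s) c \<rho> T / s * ((- s) * t powr (- s - 1)) -
        D * (- (v t powr (- 1 - s) * exp (- (c * v t))) * (hs \<rho> (T - t))\<^sup>2)) (at t)"
      unfolding A_def by (intro DERIV_diff DERIV_cmult)
    also have "mehler (1 - s) c \<rho> T / s * ((- s) * t powr (- s - 1)) = - (mehler (1 - s) c \<rho> T * t powr (- 1 - s))"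
    proof -
      have "- s - 1 = - 1 - s" by simp
      then show ?thesis using s by (simp only:) simp
    qed
    also have "D * (- (v t powr (- 1 - s) * exp (- (c * v t))) * (hs \<rho> (T - t))\<^sup>2) =
        - (hs \<rho> t powr (1 + s) * mehler (1 - s) c \<rho> (T - t))"
    proof -
      have "exp (- (c * hc \<rho> T)) * exp (- (c * v t)) = exp (- (c * hc \<rho> (T - t)))"
        by (simp add: v_def exp_add [symmetric] algebra_simps)
      then have "hs \<rho> t powr (1 + s) * mehler (1 - s) c \<rho> (T - t) =
          hs \<rho> T powr (1 + s) * v t powr (- 1 - s) * (hs \<rho> (T - t))\<^sup>2 * (exp (- (c * hc \<rho> T)) * exp (- (c * v t)))"
        unfolding powr_step[OF t] using t by (simp add: mehler_def)
      then show ?thesis by (simp add: D_def)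
    qed
    finally show ?thesis by (simp add: g_def)
  qed
  have g_cont: "isCont g t" if t: "0 < t" "t < T" for t
  proof -
    have "isCont (mehler (1 - s) c \<rho>) (T - t)" using mehler_has_derivative[OF rho, of "T - t"] t by (auto intro: DERIV_isCont)
    then have 1: "isCont (\<lambda>t. mehler (1 - s) c \<rho> (T - t)) t"
      by (intro isCont_o2[where g = "mehler (1 - s) c \<rho>" and f = "\<lambda>t. T - t"] continuous_intros)
    have 2: "isCont (hs \<rho>) t" using hs_has_derivative[OF rho t(1)] by (rule DERIV_isCont)
    show ?thesis unfolding g_def
      using t hs_pos[OF rho t(1)] by (intro continuous_intros 1 2) auto
  qed
  have hc_cont: "isCont (hc \<rho>) T" using hc_has_derivative[OF rho T] by (rule DERIV_isCont)
  have hs_cont: "isCont (hs \<rho>) T" using hs_has_derivative[OF rho T] by (rule DERIV_isCont)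
  have ev: "\<forall>\<^sub>F t in at_right 0. 0 < t \<and> t < T"
    using T by (intro eventually_conj eventually_at_right_less)
      (auto simp: eventually_at_right[OF T])
  have v_right: "filterlim v (at_right 0) (at_right 0)"
  proof (rule tendsto_imp_filterlim_at_right)
    have "isCont (\<lambda>t. hc \<rho> (T - t)) 0"
      by (rule isCont_o2[where g = "hc \<rho>" and f = "\<lambda>t. T - t"]) (auto intro!: continuous_intros simp: hc_cont)
    then have "((\<lambda>t. hc \<rho> (T - t)) \<longlongrightarrow> hc \<rho> (T - 0)) (at_right 0)"
      by (rule isCont_tendsto_compose) (rule tendsto_ident_at)
    from tendsto_diff[OF this tendsto_const[of "hc \<rho> T"]]
    show "(v \<longlongrightarrow> 0) (at_right 0)" by (simp add: v_def [abs_def])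
    show "\<forall>\<^sub>F t in at_right 0. 0 < v t" using ev by eventually_elim (auto intro: v_pos)
  qed
  \<comment> \<open>The part of D v^(-s) exp (- c v) that is smooth at t = 0; the remaining factor
    is t^(-s) (t \<open>hs \<rho> t\<close>)^s. Since \<open>\<psi>\<close> is differentiable at 0
    with value \<open>mehler (1 - s) c \<rho> T\<close>, and 1 - (t \<open>hs \<rho> t\<close>)^s is
    O(t), subtracting this value times t^(-s) leaves O(t^(1-s)).\<close>
  define \<psi> where "\<psi> t = D * hs \<rho> T powr (- s) * hs \<rho> (T - t) powr (- s) * exp (- (c * v t))" for t
  have \<psi>0: "\<psi> 0 = mehler (1 - s) c \<rho> T"
  proof -
    have "hs \<rho> T powr (1 + s) * hs \<rho> T powr (- s) * hs \<rho> T powr (- s) = hs \<rho> T powr (1 - s)"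
      by (simp only: powr_add [symmetric]) simp
    then show ?thesis using T by (simp add: \<psi>_def D_def v_def mehler_def mult_ac)
  qed
  have r_eq: "D * (v t powr (- s) * exp (- (c * v t))) = t powr (- s) * (t * hs \<rho> t) powr s * \<psi> t"
    if t: "0 < t" "t < T" for t
  proof -
    define a b d where "a = hs \<rho> T" and "b = hs \<rho> (T - t)" and "d = hs \<rho> t"
    have p: "0 < a" "0 < b" "0 < d" using hs_pos[OF rho] t T by (auto simp: a_def b_def d_def)
    have "v t powr (- s) = b powr (- s) * a powr (- s) * d powr s"
      unfolding v_eq[OF t] a_def[symmetric] b_def[symmetric] d_def[symmetric]
      using p by (simp add: powr_mult powr_divide powr_minus field_simps)
    moreover have "t powr (- s) * (t * d) powr s = d powr s"
      using t p by (simp add: powr_mult powr_minus)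
    ultimately show ?thesis
      by (simp add: \<psi>_def a_def b_def d_def mult_ac)
  qed
  have \<psi>_deriv: "\<exists>y. (\<psi> has_real_derivative y) (at 0)"
  proof -
    have "((\<lambda>t. hs \<rho> (T - t)) has_real_derivative (- (hs \<rho> T * hc \<rho> T)) * (- 1)) (at 0)"
      by (rule DERIV_chain2[where f = "hs \<rho>"])
         (use hs_has_derivative[OF rho T] in \<open>auto intro!: derivative_eq_intros\<close>)
    then have 1: "((\<lambda>t. hs \<rho> (T - t) powr (- s)) has_real_derivative
        (- s * hs \<rho> (T - 0) powr (- s - 1)) * ((- (hs \<rho> T * hc \<rho> T)) * (- 1))) (at 0)"
      by (rule DERIV_chain2[rotated]) (rule has_real_derivative_powr, use hsT in simp)
    have 2: "((\<lambda>t. exp (- (c * v t))) has_real_derivative exp (- (c * v 0)) * (- (c * (hs \<rho> (T - 0))\<^sup>2))) (at 0)"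
      by (rule DERIV_chain2[OF DERIV_exp]) (intro DERIV_minus DERIV_cmult v' T)
    show ?thesis
      unfolding \<psi>_def by (rule exI, rule DERIV_mult[OF DERIV_cmult[OF 1] 2])
  qed
  have pow0: "((\<lambda>t. t powr (1 - s)) \<longlongrightarrow> 0) (at_right (0::real))"
  proof -
    have "((\<lambda>t::real. t powr (1 - s)) \<longlongrightarrow> 0 powr (1 - s)) (at_right 0)"
      by (rule tendsto_powr2) (use s in \<open>auto simp: eventually_at_right_less intro: eventually_mono[OF eventually_at_right_less]\<close>)
    then show ?thesis by simp
  qed
  have r_lim: "((\<lambda>t. mehler (1 - s) c \<rho> T * t powr (- s) - D * (v t powr (- s) * exp (- (c * v t)))) \<longlongrightarrow> 0) (at_right 0)"
  proof -
    obtain y where y: "(\<psi> has_real_derivative y) (at 0)" using \<psi>_deriv by blast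
    have "((\<lambda>t. (\<psi> t - \<psi> 0) / (t - 0)) \<longlongrightarrow> y) (at 0)"
      using y by (simp add: has_field_derivative_iff)
    then have q: "((\<lambda>t. (\<psi> t - \<psi> 0) / t) \<longlongrightarrow> y) (at_right 0)"
      by (simp add: filterlim_at_split)
    have \<psi>c: "(\<psi> \<longlongrightarrow> \<psi> 0) (at_right 0)"
      using DERIV_isCont[OF y] by (simp add: isCont_def filterlim_at_split)
    have l1: "((\<lambda>t. t powr (1 - s) * ((\<psi> t - \<psi> 0) / t)) \<longlongrightarrow> 0 * y) (at_right 0)"
      by (intro tendsto_mult pow0 q)
    have l2: "((\<lambda>t. t powr (- s) * (1 - (t * hs \<rho> t) powr s) * \<psi> t) \<longlongrightarrow> 0) (at_right 0)"
    proof (rule Lim_null_comparison)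
      have "((\<lambda>t. \<rho> * t powr (1 - s) * \<bar>\<psi> t\<bar>) \<longlongrightarrow> \<rho> * 0 * \<bar>\<psi> 0\<bar>) (at_right 0)"
        by (intro tendsto_intros pow0 \<psi>c)
      then show "((\<lambda>t. \<rho> * t powr (1 - s) * \<bar>\<psi> t\<bar>) \<longlongrightarrow> 0) (at_right 0)" by simp
      show "\<forall>\<^sub>F t in at_right 0. norm (t powr (- s) * (1 - (t * hs \<rho> t) powr s) * \<psi> t) \<le> \<rho> * t powr (1 - s) * \<bar>\<psi> t\<bar>"
        using ev
      proof eventually_elim
        case (elim t)
        then have t: "0 < t" by simp
        have x: "0 < t * hs \<rho> t" "t * hs \<rho> t \<le> 1"
          using hs_pos[OF rho t] hs_le_inverse[OF rho t] t by (auto simp: field_simps)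
        have "(t * hs \<rho> t) powr 1 \<le> (t * hs \<rho> t) powr s" by (rule powr_mono') (use x s in auto)
        then have "1 - (t * hs \<rho> t) powr s \<le> \<rho> * t"
          using hs_ge[OF rho t] x by simp
        moreover have "0 \<le> 1 - (t * hs \<rho> t) powr s" using x s by (simp add: powr_le1)
        ultimately have "norm (t powr (- s) * (1 - (t * hs \<rho> t) powr s) * \<psi> t) \<le> t powr (- s) * (\<rho> * t) * \<bar>\<psi> t\<bar>"
          by (simp add: abs_mult mult_left_mono mult_right_mono)
        also have "t powr (- s) * (\<rho> * t) = \<rho> * t powr (1 - s)"
        proof -
          have "t powr (- s) * t powr 1 = t powr (1 - s)" by (simp only: powr_add [symmetric]) simp
          then show ?thesis using t by simp
        qed
        finally show ?case .
      qed
    qed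
    have "((\<lambda>t. t powr (- s) * (1 - (t * hs \<rho> t) powr s) * \<psi> t - t powr (1 - s) * ((\<psi> t - \<psi> 0) / t))
        \<longlongrightarrow> 0 - 0 * y) (at_right 0)"
      by (intro tendsto_diff l1 l2)
    then have "((\<lambda>t. mehler (1 - s) c \<rho> T * t powr (- s) - D * (v t powr (- s) * exp (- (c * v t)))) \<longlongrightarrow> 0 - 0 * y) (at_right 0)"
    proof (rule Lim_transform_eventually)
      show "\<forall>\<^sub>F t in at_right 0. t powr (- s) * (1 - (t * hs \<rho> t) powr s) * \<psi> t - t powr (1 - s) * ((\<psi> t - \<psi> 0) / t) =
         mehler (1 - s) c \<rho> T * t powr (- s) - D * (v t powr (- s) * exp (- (c * v t)))"
        using ev
      proof eventually_elim
        case (elim t)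
        have "t powr (1 - s) = t powr (- s) * t powr 1" by (simp only: powr_add [symmetric]) simp
        then have "t powr (1 - s) * ((\<psi> t - \<psi> 0) / t) = t powr (- s) * (\<psi> t - \<psi> 0)" using elim by simp
        then show ?case using elim r_eq[of t] unfolding \<psi>0 by (simp add: algebra_simps)
      qed
    qed
    then show ?thesis by simp
  qed
  have A0: "(A \<longlongrightarrow> D * (c powr s / s * Gamma (1 - s))) (at_right 0)"
  proof -
    have "filterlim (\<lambda>t. c * v t) (at_right 0) (at_right 0)"
    proof (rule tendsto_imp_filterlim_at_right)
      have "((\<lambda>t. c * v t) \<longlongrightarrow> c * 0) (at_right 0)"
        using v_right by (intro tendsto_intros) (auto simp: filterlim_at)
      then show "((\<lambda>t. c * v t) \<longlongrightarrow> 0) (at_right 0)" by simp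
      show "\<forall>\<^sub>F t in at_right 0. 0 < c * v t" using ev by eventually_elim (use v_pos c in simp)
    qed
    then have Vl: "((\<lambda>t. V (c * v t)) \<longlongrightarrow> 0) (at_right 0)"
      by (rule filterlim_compose[OF V(2)])
    have "((\<lambda>t. (mehler (1 - s) c \<rho> T * t powr (- s) - D * (v t powr (- s) * exp (- (c * v t)))) / s +
        D * (c powr s / s * (Gamma (1 - s) - V (c * v t)))) \<longlongrightarrow> 0 / s + D * (c powr s / s * (Gamma (1 - s) - 0))) (at_right 0)"
      using s by (intro tendsto_intros r_lim Vl) auto
    moreover have "A = (\<lambda>t. (mehler (1 - s) c \<rho> T * t powr (- s) - D * (v t powr (- s) * exp (- (c * v t)))) / s +
        D * (c powr s / s * (Gamma (1 - s) - V (c * v t))))"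
      by (rule ext) (simp add: A_def H_def algebra_simps diff_divide_distrib)
    ultimately show ?thesis by simp
  qed
  have v_top: "filterlim v at_top (at_left T)"
  proof -
    have "filterlim (\<lambda>t. T - t) (at_right 0) (at_left T)"
      by (rule tendsto_imp_filterlim_at_right)
         (auto intro!: tendsto_eq_intros simp: eventually_at_filter)
    then have "filterlim (\<lambda>t. inverse (T - t)) at_top (at_left T)"
      by (rule filterlim_compose[OF filterlim_inverse_at_top_right])
    then have "filterlim (\<lambda>t. - hc \<rho> T + inverse (T - t)) at_top (at_left T)"
      by (rule filterlim_tendsto_add_at_top[OF tendsto_const])
    then show ?thesis
    proof (rule filterlim_at_top_mono)
      have "\<forall>\<^sub>F t in at_left T. t < T" by (simp add: eventually_at_filter)
      then show "\<forall>\<^sub>F t in at_left T. - hc \<rho> T + inverse (T - t) \<le> v t"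
        by eventually_elim (use inverse_le_hc[OF rho] in \<open>auto simp: v_def inverse_eq_divide\<close>)
    qed
  qed
  have AT: "(A \<longlongrightarrow> mehler (1 - s) c \<rho> T / s * T powr (- s)) (at_left T)"
  proof -
    have 1: "filterlim (\<lambda>t. c * v t) at_top (at_left T)"
      by (rule filterlim_tendsto_pos_mult_at_top[OF tendsto_const c v_top])
    have Vl: "((\<lambda>t. V (c * v t)) \<longlongrightarrow> Gamma (1 - s)) (at_left T)"
      by (rule filterlim_compose[OF V(3) 1])
    have El: "((\<lambda>t. exp (- (c * v t))) \<longlongrightarrow> 0) (at_left T)"
      by (rule filterlim_compose[OF exp_at_bot]) (use 1 in \<open>simp add: filterlim_uminus_at_top\<close>)
    have Pl: "((\<lambda>t. v t powr (- s)) \<longlongrightarrow> 0) (at_left T)"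
      by (rule tendsto_neg_powr[OF _ v_top]) (use s in simp)
    have "((\<lambda>t. mehler (1 - s) c \<rho> T / s * t powr (- s) - D * (v t powr (- s) * exp (- (c * v t)) / s -
        c powr s / s * (Gamma (1 - s) - V (c * v t)))) \<longlongrightarrow>
        mehler (1 - s) c \<rho> T / s * T powr (- s) - D * (0 * 0 / s - c powr s / s * (Gamma (1 - s) - Gamma (1 - s)))) (at_left T)"
      using s T by (intro tendsto_intros Vl El Pl) auto
    then show ?thesis by (simp add: A_def [abs_def] H_def)
  qed
  have int1: "set_integrable lborel {0<..<T} increment" and int2: "set_integrable lborel {T<..} increment"
    by (rule set_integrable_subset[OF increment_integrable]; use T in auto)+
  have I1: "(LINT t:{0<..<T}|lborel. increment t) = mehler (1 - s) c \<rho> T / s * T powr (- s) - D * (c powr s / s * Gamma (1 - s))"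
  proof -
    have "set_integrable lborel {0<..<T} g"
      using int1 set_integrable_cong[of lborel lborel "{0<..<T}" "{0<..<T}" increment g] by (auto simp: inc)
    then have "(LBINT t=ereal 0..ereal T. g t) = mehler (1 - s) c \<rho> T / s * T powr (- s) - D * (c powr s / s * Gamma (1 - s))"
      using T A0 AT A' g_cont
      by (intro interval_integral_FTC_integrable[where F = A])
         (auto simp: ereal_tendsto_simps has_real_derivative_iff_has_vector_derivative [symmetric] einterval_eq)
    moreover have "(LBINT t=ereal 0..ereal T. g t) = (LINT t:{0<..<T}|lborel. g t)"
      using T by (simp add: interval_lebesgue_integral_def einterval_eq)
    moreover have "(LINT t:{0<..<T}|lborel. increment t) = (LINT t:{0<..<T}|lborel. g t)"
      by (rule set_lebesgue_integral_cong) (auto simp: inc)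
    ultimately show ?thesis by simp
  qed
  have I2: "(LINT t:{T<..}|lborel. increment t) = - (mehler (1 - s) c \<rho> T / s * T powr (- s))"
  proof -
    let ?g = "\<lambda>t. - mehler (1 - s) c \<rho> T * t powr (- 1 - s)"
    let ?F = "\<lambda>t. mehler (1 - s) c \<rho> T / s * t powr (- s)"
    have inc': "increment t = ?g t" if "T < t" for t
      using that T by (simp add: inc g_def mehler_def[of _ _ _ "T - t"])
    have "set_integrable lborel {T<..} ?g"
      using int2 set_integrable_cong[of lborel lborel "{T<..}" "{T<..}" increment ?g] by (auto simp: inc')
    moreover have "(?F has_real_derivative ?g t) (at t)" if "T < t" for t
    proof -
      have "- s - 1 = - 1 - s" by simp
      then show ?thesis
        using DERIV_cmult[OF has_real_derivative_powr[of t "- s"], of "mehler (1 - s) c \<rho> T / s"] that T s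
        by (simp only:) simp
    qed
    moreover have "isCont ?g t" if "T < t" for t
      using that T by (intro continuous_intros) auto
    moreover have "(?F \<longlongrightarrow> mehler (1 - s) c \<rho> T / s * T powr (- s)) (at_right T)"
      using T by (intro tendsto_intros) auto
    moreover have "(?F \<longlongrightarrow> mehler (1 - s) c \<rho> T / s * 0) at_top"
      using s by (intro tendsto_mult tendsto_const tendsto_neg_powr filterlim_ident) auto
    ultimately have "(LBINT t=ereal T..\<infinity>. ?g t) = mehler (1 - s) c \<rho> T / s * 0 - mehler (1 - s) c \<rho> T / s * T powr (- s)"
      by (intro interval_integral_FTC_integrable[where F = ?F])
         (auto simp: ereal_tendsto_simps has_real_derivative_iff_has_vector_derivative [symmetric] einterval_eq)
    moreover have "(LBINT t=ereal T..\<infinity>. ?g t) = (LINT t:{T<..}|lborel. ?g t)"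
      by (rule interval_integral_to_infinity_eq)
    moreover have "(LINT t:{T<..}|lborel. increment t) = (LINT t:{T<..}|lborel. ?g t)"
      by (rule set_lebesgue_integral_cong) (auto simp: inc')
    ultimately show ?thesis by simp
  qed
  have "(LINT t:{0<..}|lborel. increment t) = (LINT t:{0<..<T} \<union> {T<..}|lborel. increment t)"
    unfolding set_lebesgue_integral_def
  proof (rule integral_cong_AE)
    show "AE t in lborel. indicator {0<..} t *\<^sub>R increment t = indicator ({0<..<T} \<union> {T<..}) t *\<^sub>R increment t"
      using AE_lborel_singleton[of T] by eventually_elim (use T in \<open>auto simp: indicator_def\<close>)
  qed (unfold increment_def, measurable)
  also have "\<dots> = (LINT t:{0<..<T}|lborel. increment t) + (LINT t:{T<..}|lborel. increment t)"
    by (rule set_integral_Un) (use int1 int2 in auto)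
  also have "\<dots> = - (Gamma (1 - s) / s * c powr s * D)"
    unfolding I1 I2 by simp
  finally show ?thesis by (simp add: D_def)
qed

end

section \<open>Fourier representation of the kernels\<close>

text \<open>The sum of the |x.i| over the basis is at most k |x|, so with b = a/k the function lies
  below a product of one-dimensional exponentials.\<close>

lemma integrable_exp_minus_norm:
  fixes a :: real
  assumes a: "0 < a"
  shows "integrable lborel (\<lambda>x::'b::euclidean_space. exp (- (a * norm x)))"
proof -
  have half: "integrable lborel (\<lambda>x::real. indicator {0..} x *\<^sub>R exp (- (b * x)))" if "0 < b" for b
    using set_integrable_lborelI_nonneg[OF has_integral_exp_minus_to_infinity[OF that, of 0]]
    by (simp add: set_integrable_def)
  have line: "integrable lborel (\<lambda>x::real. exp (- (b * \<bar>x\<bar>)))" if b: "0 < b" for b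
  proof (rule Bochner_Integration.integrable_bound)
    show "integrable lborel (\<lambda>x::real. indicator {0..} x *\<^sub>R exp (- (b * x)) +
        indicator {0..} (0 + (- 1) * x) *\<^sub>R exp (- (b * (0 + (- 1) * x))))"
      by (intro Bochner_Integration.integrable_add half b
            lborel_integrable_real_affine[where c = "- 1" and t = 0]) simp
    show "AE x in lborel. norm (exp (- (b * \<bar>x\<bar>))) \<le> norm (indicator {0..} x *\<^sub>R exp (- (b * x)) +
        indicator {0..} (0 + (- 1) * x) *\<^sub>R exp (- (b * (0 + (- 1) * x))))"
      by (rule AE_I2) (auto simp: indicator_def abs_if)
  qed simp
  define b where "b = a / real DIM('b)"
  have b: "0 < b" using a by (simp add: b_def)
  have "integrable lborel (\<lambda>x::'b. \<Prod>i\<in>Basis. complex_of_real (exp (- (b * \<bar>x \<bullet> i\<bar>))))"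
    by (rule lborel_prod_coordinates(1)) (use line[OF b] in auto)
  then show ?thesis
  proof (rule Bochner_Integration.integrable_bound)
    show "AE x in lborel. norm (exp (- (a * norm x))) \<le>
        norm (\<Prod>i\<in>Basis. complex_of_real (exp (- (b * \<bar>(x::'b) \<bullet> i\<bar>))))"
    proof (rule AE_I2)
      fix x :: 'b
      have "b * (\<Sum>i\<in>Basis. \<bar>x \<bullet> i\<bar>) \<le> b * (\<Sum>i\<in>(Basis::'b set). norm x)"
        using b by (intro mult_left_mono sum_mono Basis_le_norm) auto
      also have "\<dots> = a * norm x" by (simp add: b_def)
      finally have "exp (- (a * norm x)) \<le> exp (- (b * (\<Sum>i\<in>Basis. \<bar>x \<bullet> i\<bar>)))" by simp
      also have "\<dots> = (\<Prod>i\<in>Basis. exp (- (b * \<bar>x \<bullet> i\<bar>)))"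
        by (simp add: exp_sum [symmetric] sum_negf sum_distrib_left)
      finally show "norm (exp (- (a * norm x))) \<le> norm (\<Prod>i\<in>Basis. complex_of_real (exp (- (b * \<bar>x \<bullet> i\<bar>))))"
        by (simp add: prod_norm [symmetric])
    qed
  qed simp
qed

lemma integrable_powr_exp_inverse:
  fixes a c :: real
  assumes a: "1 < a" and c: "0 < c"
  shows "set_integrable lborel {0<..} (\<lambda>t::real. t powr (- a) * exp (- (c / t)))"
proof -
  obtain M where M: "0 < M" "\<And>x. 0 \<le> x \<Longrightarrow> x powr a * exp (- (c * x)) \<le> M"
    using powr_mult_exp_bounded[of a c] a c by auto
  have 2: "set_integrable lborel {1..} (\<lambda>t::real. t powr (- a))"
    by (rule set_integrable_lborelI_nonneg[OF has_integral_powr_to_inf]) (use a in auto)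
  have "integrable lborel (\<lambda>t::real. M * indicator {0..1} t + indicator {1..} t *\<^sub>R t powr (- a))"
    using 2 unfolding set_integrable_def by (intro Bochner_Integration.integrable_add) auto
  then show ?thesis
    unfolding set_integrable_def
  proof (rule Bochner_Integration.integrable_bound)
    show "AE t in lborel. norm (indicator {0<..} t *\<^sub>R (t powr (- a) * exp (- (c / t)))) \<le>
       norm (M * indicator {0..1} t + indicator {1..} t *\<^sub>R t powr (- a))"
    proof (rule AE_I2)
      fix t :: real
      have 1: "t powr (- a) * exp (- (c / t)) \<le> M" if "0 < t"
        using M(2)[of "1 / t"] that by (simp add: powr_divide powr_minus_divide)
      have 2: "t powr (- a) * exp (- (c / t)) \<le> t powr (- a)" if "0 < t"
        using that c by (intro mult_right_le_one_le) auto
      show "norm (indicator {0<..} t *\<^sub>R (t powr (- a) * exp (- (c / t)))) \<le>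
         norm (M * indicator {0..1} t + indicator {1..} t *\<^sub>R t powr (- a))"
      proof (cases "0 < t")
        case True
        then show ?thesis using 1 2 M(1)
          by (cases "t \<le> 1") (auto simp: indicator_def intro: order.trans)
      qed simp
    qed
  qed auto
qed

text \<open>Keeps the exponential decay in \<rho> at the price of \<open>2 powr a\<close>, for
  integration over the dual variable. The companion \<open>mehler_le_powr\<close> is uniform in
  \<rho> and serves where \<rho> is fixed or a supremum is wanted.\<close>

lemma mehler_le:
  assumes "0 \<le> \<rho>" "0 \<le> c" "0 < a" "0 < t"
  shows "mehler a c \<rho> t \<le> 2 powr a * (t powr (- a) * exp (- (c / t)) * exp (- (a * t / 2 * \<rho>)))"
proof -
  have "hs \<rho> t powr a \<le> (2 / t * exp (- (\<rho> * t / 2))) powr a"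
    using assms hs_pos[of \<rho> t] hs_exp_decay[of \<rho> t] by (intro powr_mono2) auto
  also have "\<dots> = 2 powr a * t powr (- a) * exp (- (a * t / 2 * \<rho>))"
  proof -
    have "exp (- (\<rho> * t / 2)) powr a = exp (- (a * t / 2 * \<rho>))"
      by (simp add: powr_def algebra_simps)
    moreover have "(2 / t) powr a = 2 powr a * t powr (- a)"
      using assms powr_divide[of 2 t a] powr_minus_divide[of t a] by simp
    ultimately show ?thesis
      using assms by (simp only: powr_mult[of "2 / t"])
  qed
  finally have 1: "hs \<rho> t powr a \<le> 2 powr a * t powr (- a) * exp (- (a * t / 2 * \<rho>))" .
  have "c * (1 / t) \<le> c * hc \<rho> t"
    using assms by (intro mult_left_mono inverse_le_hc) auto
  then have "exp (- (c * hc \<rho> t)) \<le> exp (- (c / t))" by simp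
  from mult_mono[OF 1 this] show ?thesis using assms by (simp add: mehler_def mult_ac)
qed

lemma mehler_le_powr:
  assumes "0 \<le> \<rho>" "0 \<le> c" "0 < a" "0 < t"
  shows "mehler a c \<rho> t \<le> t powr (- a) * exp (- (c / t))"
proof -
  have "hs \<rho> t powr a \<le> (1 / t) powr a"
    using assms hs_pos[of \<rho> t] hs_le_inverse[of \<rho> t] by (intro powr_mono2) auto
  also have "\<dots> = t powr (- a)"
    using assms powr_divide[of 1 t a] powr_minus_divide[of t a] by simp
  finally have 1: "hs \<rho> t powr a \<le> t powr (- a)" .
  have "c * (1 / t) \<le> c * hc \<rho> t"
    using assms by (intro mult_left_mono inverse_le_hc) auto
  then have "exp (- (c * hc \<rho> t)) \<le> exp (- (c / t))" by simp
  from mult_mono[OF 1 this] show ?thesis using assms by (simp add: mehler_def)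
qed

lemma mehler_antimono:
  assumes "0 \<le> \<rho>" "c \<le> d"
  shows "mehler a d \<rho> t \<le> mehler a c \<rho> t"
proof (cases "0 < t")
  case True
  then have "exp (- (d * hc \<rho> t)) \<le> exp (- (c * hc \<rho> t))"
    using assms hc_pos[OF assms(1) True] by simp
  then show ?thesis using True by (simp add: mehler_def mult_left_mono)
qed (simp add: mehler_def)

lemma mehler_fixed_time_integrable:
  fixes a c t :: real
  assumes "0 \<le> c" "0 < a" "0 < t"
  shows "integrable lborel (\<lambda>\<mu>::'b::euclidean_space. mehler a c (norm \<mu>) t)"
proof (rule Bochner_Integration.integrable_bound)
  show "integrable lborel (\<lambda>\<mu>::'b. 2 powr a * (t powr (- a) * exp (- (c / t)) * exp (- (a * t / 2 * norm \<mu>))))"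
    using assms by (intro integrable_mult_right integrable_exp_minus_norm) auto
  show "AE \<mu> in lborel. norm (mehler a c (norm (\<mu>::'b)) t) \<le>
     norm (2 powr a * (t powr (- a) * exp (- (c / t)) * exp (- (a * t / 2 * norm \<mu>))))"
    using mehler_le[OF norm_ge_zero assms] by (auto simp: mehler_nonneg)
qed measurable

text \<open>Integrating exp (- a t |\<mu>| / 2) over \<mu> gives a multiple of t^(-k), so the
  condition 1 < a + k controls large t; near t = 0 the factor exp (- c / t) with c > 0 beats every
  power.\<close>

lemma mehler_integrable:
  fixes a c :: real
  assumes a: "0 < a" "1 < a + real DIM('b)" and c: "0 < c"
  shows "integrable (lborel \<Otimes>\<^sub>M lborel) (\<lambda>p::real \<times> 'b::euclidean_space. mehler a c (norm (snd p)) (fst p))"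
proof -
  let ?D = "\<lambda>p::real \<times> 'b. 2 powr a * (indicator {0<..} (fst p) * (fst p powr (- a) * exp (- (c / fst p)) * exp (- (a * fst p / 2 * norm (snd p)))))"
  define J where "J = (LINT \<mu>|lborel. exp (- (a / 2 * norm (\<mu>::'b))))"
  have J: "(LINT \<mu>|lborel. exp (- (a * t / 2 * norm (\<mu>::'b)))) = t powr (- real DIM('b)) * J" if t: "0 < t" for t
  proof -
    have "J = t ^ DIM('b) * (LINT \<mu>|lborel. exp (- (a / 2 * norm (0 + t *\<^sub>R (\<mu>::'b)))))"
      unfolding J_def using t lborel_affine_subst(2)[of t "\<lambda>\<mu>. exp (- (a / 2 * norm (\<mu>::'b)))" 0] by simp
    also have "(LINT \<mu>|lborel. exp (- (a / 2 * norm (0 + t *\<^sub>R (\<mu>::'b))))) = (LINT \<mu>|lborel. exp (- (a * t / 2 * norm (\<mu>::'b))))"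
      using t by (intro Bochner_Integration.integral_cong) auto
    finally show ?thesis using t by (simp add: powr_minus powr_realpow)
  qed
  have "integrable (lborel \<Otimes>\<^sub>M lborel) ?D"
  proof (rule lborel_pair.Fubini_integrable)
    show "AE x in lborel. integrable lborel (\<lambda>y. ?D (x, y))"
    proof (rule AE_I2)
      fix x :: real
      show "integrable lborel (\<lambda>y. ?D (x, y))"
      proof (cases "0 < x")
        case True
        then have "integrable lborel (\<lambda>y::'b. exp (- (a * x / 2 * norm y)))"
          using a by (intro integrable_exp_minus_norm) simp
        from integrable_mult_right[OF this] show ?thesis by simp
      qed simp
    qed
    have "integrable lborel (\<lambda>x. 2 powr a * J * (indicator {0<..} x *\<^sub>R (x powr (- (a + real DIM('b))) * exp (- (c / x)))))"
      using integrable_powr_exp_inverse[OF a(2) c] unfolding set_integrable_def by (intro integrable_mult_right)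
    also have "(\<lambda>x. 2 powr a * J * (indicator {0<..} x *\<^sub>R (x powr (- (a + real DIM('b))) * exp (- (c / x))))) =
      (\<lambda>x. LINT y|lborel. norm (?D (x, y)))"
    proof
      fix x :: real
      show "2 powr a * J * (indicator {0<..} x *\<^sub>R (x powr (- (a + real DIM('b))) * exp (- (c / x)))) =
        (LINT y|lborel. norm (?D (x, y)))"
      proof (cases "0 < x")
        case True
        have "(LINT y|lborel. norm (?D (x, y))) = 2 powr a * (x powr (- a) * exp (- (c / x)) * (x powr (- real DIM('b)) * J))"
          using True by (simp add: J [symmetric])
        also have "\<dots> = 2 powr a * J * ((x powr (- a) * x powr (- real DIM('b))) * exp (- (c / x)))" by simp
        also have "x powr (- a) * x powr (- real DIM('b)) = x powr (- (a + real DIM('b)))"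
          by (simp add: powr_add [symmetric])
        finally show ?thesis using True by simp
      qed simp
    qed
    finally show "integrable lborel (\<lambda>x. LINT y|lborel. norm (?D (x, y)))" .
  qed measurable
  then show ?thesis
  proof (rule Bochner_Integration.integrable_bound)
    show "AE p in lborel \<Otimes>\<^sub>M lborel. norm (mehler a c (norm (snd p)) (fst p)) \<le> norm (?D p)"
    proof (rule AE_I2)
      fix p :: "real \<times> 'b"
      show "norm (mehler a c (norm (snd p)) (fst p)) \<le> norm (?D p)"
        using mehler_le[of "norm (snd p)" c a "fst p"] a c
        by (cases "0 < fst p") (auto simp: mehler_nonneg mehler_def[of _ _ _ "fst p"] not_less intro: order.trans[OF _ abs_ge_self])
    qed
  qed measurable
qed

text \<open>What the substitution \<lambda> = t \<mu> leaves of the prefactor of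
  \<open>q_kernel\<close>: the Jacobian t^k and the rescaled amplitude cancel every power of t, and
  2^k / (4 pi)^k = 1 / (2 pi)^k.\<close>

definition kernel_const :: "real \<Rightarrow> nat \<Rightarrow> nat \<Rightarrow> real" where
  "kernel_const r m k = (4 * pi) powr (- (real m / 2 + 1 - r)) / (2 * pi) ^ k"

lemma q_kernel_fourier:
  fixes z :: "'a::euclidean_space" and \<sigma> :: "'b::euclidean_space"
  assumes t: "0 < t"
  shows "q_kernel r (z, \<sigma>) t y = complex_of_real (kernel_const r DIM('a) DIM('b)) *
    fourier (\<lambda>\<mu>. complex_of_real (mehler (real DIM('a) / 2 + 1 - r) (((norm z)\<^sup>2 + y\<^sup>2) / 4) (norm \<mu>) t)) \<sigma>"
proof -
  define N where "N = real DIM('a) / 2 + 1 - r"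
  define A where "A = (norm z)\<^sup>2 + y\<^sup>2"
  let ?F = "\<lambda>l::'b. exp (- (\<i> / complex_of_real t) * complex_of_real (\<sigma> \<bullet> l)) *
        complex_of_real ((norm l / sinh (norm l)) powr N) *
        complex_of_real (exp (- (A / (4 * t)) * (norm l / tanh (norm l))))"
  let ?G = "\<lambda>\<mu>::'b. exp (- (\<i> * complex_of_real (\<sigma> \<bullet> \<mu>))) * complex_of_real (mehler N (A / 4) (norm \<mu>) t)"
  have F: "?F (0 + t *\<^sub>R \<mu>) = complex_of_real (t powr N) * ?G \<mu>" if "\<mu> \<noteq> 0" for \<mu>
  proof -
    have "norm (t *\<^sub>R \<mu>) / sinh (norm (t *\<^sub>R \<mu>)) = t * hs (norm \<mu>) t"
      using that t by (simp add: hs_def mult.commute)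
    moreover have "(A / (4 * t)) * (norm (t *\<^sub>R \<mu>) / tanh (norm (t *\<^sub>R \<mu>))) = A / 4 * hc (norm \<mu>) t"
      using that t by (simp add: hc_def mult.commute)
    moreover have "- (\<i> / complex_of_real t) * complex_of_real (\<sigma> \<bullet> (t *\<^sub>R \<mu>)) = - (\<i> * complex_of_real (\<sigma> \<bullet> \<mu>))"
      using t by simp
    ultimately show ?thesis
      using t by (simp only: add_0 mult_minus_left powr_mult) (simp add: mehler_def)
  qed
  have [measurable]: "(sinh :: real \<Rightarrow> real) \<in> borel_measurable borel" "(tanh :: real \<Rightarrow> real) \<in> borel_measurable borel"
    by (intro borel_measurable_continuous_onI continuous_intros; simp)+
  have "(LINT l|lborel. ?F l) = (\<bar>t\<bar> ^ DIM('b)) *\<^sub>R (LINT \<mu>|lborel. ?F (0 + t *\<^sub>R \<mu>))"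
    by (rule lborel_affine_subst(2)) (use t in simp)
  \<comment> \<open>The integrands may differ at \<mu> = 0, where the quotients in
    \<open>q_kernel\<close> are 0 whereas \<open>hs\<close> and \<open>hc\<close> take their
    limits.\<close>
  also have "(LINT \<mu>|lborel. ?F (0 + t *\<^sub>R \<mu>)) = (LINT \<mu>|lborel. complex_of_real (t powr N) * ?G \<mu>)"
  proof (rule integral_cong_AE)
    show "AE \<mu> in lborel. ?F (0 + t *\<^sub>R \<mu>) = complex_of_real (t powr N) * ?G \<mu>"
      using AE_lborel_singleton[of "0::'b"] by eventually_elim (rule F)
  qed measurable
  also have "\<dots> = complex_of_real (t powr N) * fourier (\<lambda>\<mu>. complex_of_real (mehler N (A / 4) (norm \<mu>) t)) \<sigma>"
    unfolding fourier_def by (rule integral_mult_right_zero)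
  finally have "q_kernel r (z, \<sigma>) t y =
      complex_of_real (2 ^ DIM('b) / (4 * pi * t) powr (N + real DIM('b)) * (t ^ DIM('b) * t powr N)) *
      fourier (\<lambda>\<mu>. complex_of_real (mehler N (A / 4) (norm \<mu>) t)) \<sigma>"
    using t unfolding q_kernel_def N_def A_def by (simp add: scaleR_conv_of_real algebra_simps)
  also have "2 ^ DIM('b) / (4 * pi * t) powr (N + real DIM('b)) * (t ^ DIM('b) * t powr N) =
      kernel_const r DIM('a) DIM('b)"
  proof -
    have "(4 * pi * t) powr (N + real DIM('b)) = (4 * pi) powr N * t powr N * ((4 * pi) ^ DIM('b) * t ^ DIM('b))"
      using t by (simp add: powr_add powr_mult powr_realpow power_mult_distrib)
    moreover have "(4 * pi) ^ DIM('b) = 2 ^ DIM('b) * (2 * pi) ^ DIM('b)"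
      using power_mult_distrib[of 2 "2 * pi" "DIM('b)"] by simp
    moreover have "kernel_const r DIM('a) DIM('b) = 1 / ((4 * pi) powr N * (2 * pi) ^ DIM('b))"
      unfolding kernel_const_def N_def [symmetric] powr_minus_divide by simp
    ultimately show ?thesis using t by (simp only:) (simp add: field_simps)
  qed
  finally show ?thesis by (simp add: N_def A_def)
qed

lemma integrable_character_mult_snd:
  fixes f :: "'c::euclidean_space \<times> 'b::euclidean_space \<Rightarrow> complex"
  assumes f: "integrable (lborel \<Otimes>\<^sub>M lborel) f"
  shows "integrable (lborel \<Otimes>\<^sub>M lborel) (\<lambda>p. exp (- (\<i> * complex_of_real (\<sigma> \<bullet> snd p))) * f p)"
proof (rule Bochner_Integration.integrable_bound[OF f])
  have [measurable]: "f \<in> borel_measurable (lborel \<Otimes>\<^sub>M lborel)" using f by auto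
  show "(\<lambda>p. exp (- (\<i> * complex_of_real (\<sigma> \<bullet> snd p))) * f p) \<in> borel_measurable (lborel \<Otimes>\<^sub>M lborel)"
    by measurable
qed (simp add: norm_mult)

lemma fourier_integral_pair:
  fixes f :: "real \<times> 'b::euclidean_space \<Rightarrow> real"
  assumes f: "integrable (lborel \<Otimes>\<^sub>M lborel) f"
  shows "fourier (\<lambda>\<mu>. complex_of_real (LINT t|lborel. f (t, \<mu>))) \<sigma> =
      (LINT p|(lborel \<Otimes>\<^sub>M lborel). exp (- (\<i> * complex_of_real (\<sigma> \<bullet> snd p))) * complex_of_real (f p))"
    and "(LINT t|lborel. fourier (\<lambda>\<mu>. complex_of_real (f (t, \<mu>))) \<sigma>) =
      (LINT p|(lborel \<Otimes>\<^sub>M lborel). exp (- (\<i> * complex_of_real (\<sigma> \<bullet> snd p))) * complex_of_real (f p))"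
proof -
  let ?W = "\<lambda>p. exp (- (\<i> * complex_of_real (\<sigma> \<bullet> snd p))) * complex_of_real (f p)"
  have W: "integrable (lborel \<Otimes>\<^sub>M lborel) ?W"
    by (intro integrable_character_mult_snd integrable_of_real f)
  show "(LINT t|lborel. fourier (\<lambda>\<mu>. complex_of_real (f (t, \<mu>))) \<sigma>) = (LINT p|(lborel \<Otimes>\<^sub>M lborel). ?W p)"
    using lborel_pair.integral_fst'[OF W] by (simp add: fourier_def)
  have "(LINT p|(lborel \<Otimes>\<^sub>M lborel). ?W p) = (LINT \<mu>|lborel. (LINT t|lborel. ?W (t, \<mu>)))"
    using lborel_pair.integral_snd[of "\<lambda>t \<mu>. ?W (t, \<mu>)"] W by (simp add: case_prod_unfold)
  also have "\<dots> = fourier (\<lambda>\<mu>. complex_of_real (LINT t|lborel. f (t, \<mu>))) \<sigma>"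
    unfolding fourier_def by simp
  finally show "fourier (\<lambda>\<mu>. complex_of_real (LINT t|lborel. f (t, \<mu>))) \<sigma> = (LINT p|(lborel \<Otimes>\<^sub>M lborel). ?W p)"
    by simp
qed

text \<open>Two forms for two uses: the absolutely convergent integral over time and frequency
  together serves the final comparison of \<open>e_kernel s\<close> with
  \<open>e_kernel (- s)\<close>, and the transform of a single function of \<mu> is the input of the
  Parseval formula.\<close>

lemma e_kernel_fourier:
  fixes z :: "'a::euclidean_space" and \<sigma> :: "'b::euclidean_space"
  assumes r: "r < 1" and y: "0 < y"
  defines "f \<equiv> \<lambda>p. mehler (real DIM('a) / 2 + 1 - r) (((norm z)\<^sup>2 + y\<^sup>2) / 4) (norm (snd p)) (fst p)"
  shows "e_kernel r (z, \<sigma>) y = complex_of_real (kernel_const r DIM('a) DIM('b)) *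
      (LINT p|(lborel \<Otimes>\<^sub>M lborel). exp (- (\<i> * complex_of_real (\<sigma> \<bullet> snd p))) * complex_of_real (f p))"
    and "e_kernel r (z, \<sigma>) y = complex_of_real (kernel_const r DIM('a) DIM('b)) *
      fourier (\<lambda>\<mu>. complex_of_real (LINT t|lborel. f (t, \<mu>))) \<sigma>"
proof -
  have "0 < ((norm z)\<^sup>2 + y\<^sup>2) / 4" using y by (simp add: add_nonneg_pos)
  moreover have "0 < real DIM('b)" "0 < real DIM('a)" by simp_all
  then have "0 < real DIM('a) / 2 + 1 - r" "1 < real DIM('a) / 2 + 1 - r + real DIM('b)"
    using r DIM_positive[where 'a='b] by linarith+
  ultimately have f: "integrable (lborel \<Otimes>\<^sub>M lborel) (f :: real \<times> 'b \<Rightarrow> real)"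
    unfolding f_def by (intro mehler_integrable)
  have "e_kernel r (z, \<sigma>) y =
      (LINT t|lborel. complex_of_real (kernel_const r DIM('a) DIM('b)) * fourier (\<lambda>\<mu>. complex_of_real (f (t, \<mu>))) \<sigma>)"
    unfolding e_kernel_def set_lebesgue_integral_def
  proof (intro Bochner_Integration.integral_cong refl)
    fix t :: real
    show "indicat_real {0<..} t *\<^sub>R q_kernel r (z, \<sigma>) t y =
        complex_of_real (kernel_const r DIM('a) DIM('b)) * fourier (\<lambda>\<mu>. complex_of_real (f (t, \<mu>))) \<sigma>"
    proof (cases "0 < t")
      case True
      then show ?thesis by (simp add: q_kernel_fourier f_def)
    next
      case False
      then show ?thesis by (simp add: f_def mehler_def fourier_def)
    qed
  qed
  then show 1: "e_kernel r (z, \<sigma>) y = complex_of_real (kernel_const r DIM('a) DIM('b)) *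
      (LINT p|(lborel \<Otimes>\<^sub>M lborel). exp (- (\<i> * complex_of_real (\<sigma> \<bullet> snd p))) * complex_of_real (f p))"
    by (simp add: fourier_integral_pair(2)[OF f])
  show "e_kernel r (z, \<sigma>) y = complex_of_real (kernel_const r DIM('a) DIM('b)) *
      fourier (\<lambda>\<mu>. complex_of_real (LINT t|lborel. f (t, \<mu>))) \<sigma>"
    unfolding 1 fourier_integral_pair(1)[OF f] ..
qed

section \<open>The convolution operator on groups of Heisenberg type\<close>

context
  fixes br :: "'a::euclidean_space \<times> 'b::euclidean_space \<Rightarrow> 'a \<times> 'b \<Rightarrow> 'a \<times> 'b"
  assumes ht: "heisenberg_type br"
begin

lemma heisenberg_type_lie_bracket: "lie_bracket br"
  using ht by (simp add: heisenberg_type_def)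

lemma bracket_antisym: "br u v = - br v u"
proof -
  have b: "bilinear br" and alt: "\<And>x. br x x = 0"
    using heisenberg_type_lie_bracket by (auto simp: lie_bracket_def)
  have "br (u + v) (u + v) = br u u + br u v + (br v u + br v v)"
    by (simp add: bilinear_ladd[OF b] bilinear_radd[OF b])
  then show ?thesis by (simp add: alt eq_neg_iff_add_eq_0)
qed

lemma kaplan_skew: "kaplan br \<mu> z \<bullet> \<zeta> = - (kaplan br \<mu> \<zeta> \<bullet> z)"
proof -
  have "snd (br (z, 0) (\<zeta>, 0)) = - snd (br (\<zeta>, 0) (z, 0))"
    by (subst bracket_antisym) simp
  then show ?thesis by (simp add: kaplan_inner[OF heisenberg_type_lie_bracket])
qed

lemma kaplan_orthogonal: "kaplan br \<mu> z \<bullet> z = 0"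
  using kaplan_skew[of \<mu> z z] by simp

text \<open>By skewness |J(\<mu>)z|^2 = - <J(\<mu>)J(\<mu>)z, z>, and J(\<mu>)^2 = -
  |\<mu>|^2.\<close>

lemma norm_kaplan: "norm (kaplan br \<mu> z) = norm \<mu> * norm z"
proof -
  have "kaplan br \<mu> (kaplan br \<mu> z) = - ((norm \<mu>)\<^sup>2 *\<^sub>R z)"
    using ht by (simp add: heisenberg_type_def)
  then have "(norm (kaplan br \<mu> z))\<^sup>2 = (norm \<mu> * norm z)\<^sup>2"
    using kaplan_skew[of \<mu> z "kaplan br \<mu> z"]
    by (simp add: power2_norm_eq_inner power_mult_distrib)
  then show ?thesis by (simp add: power2_eq_iff_nonneg)
qed

text \<open>For unit vectors z and \<mu> the vectors z and J(\<mu>)z are orthonormal. The bound is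
  used as m/2 >= 1: it lifts the exponent m/2 + 1 - s above 1, so that the time integral of
  \<open>mehler\<close> is bounded uniformly in the frequency.\<close>

lemma heisenberg_type_DIM: "2 \<le> DIM('a)"
proof -
  obtain z :: 'a where z: "z \<in> Basis" using nonempty_Basis by blast
  obtain \<mu> :: 'b where \<mu>: "\<mu> \<in> Basis" using nonempty_Basis by blast
  have n: "norm (kaplan br \<mu> z) = 1" by (simp add: norm_kaplan z \<mu>)
  have "z \<noteq> kaplan br \<mu> z"
    using kaplan_orthogonal[of \<mu> z] z by (metis inner_same_Basis zero_neq_one)
  moreover have "independent {z, kaplan br \<mu> z}"
    by (rule pairwise_orthogonal_independent)
       (use z n kaplan_orthogonal[of \<mu> z] in
         \<open>auto simp: pairwise_def orthogonal_def inner_commute nonzero_Basis\<close>)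
  ultimately show ?thesis
    using independent_card_le_dim[of "{z, kaplan br \<mu> z}" UNIV] by (simp add: independent_card_le_dim dim_UNIV)
qed

lemma gmul_ginv:
  "gmul br (ginv (\<zeta>, \<tau>)) (z, \<sigma>) = (z - \<zeta>, \<sigma> - (1 / 2) *\<^sub>R snd (br (\<zeta>, 0) (z, 0)) - \<tau>)"
proof -
  have b: "bilinear br" using heisenberg_type_lie_bracket by (simp add: lie_bracket_def)
  have "br (- \<zeta>, 0) (z, 0) = - br (\<zeta>, 0) (z, 0)"
    using bilinear_lneg[OF b, of "(\<zeta>, 0)" "(z, 0)"] by simp
  then have "(\<Sum>\<epsilon>\<in>Basis. (kaplan br \<epsilon> (- \<zeta>) \<bullet> z) *\<^sub>R \<epsilon>) = - snd (br (\<zeta>, 0) (z, 0))"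
    by (simp add: kaplan_inner[OF heisenberg_type_lie_bracket] sum_negf euclidean_representation)
  then show ?thesis by (simp add: gmul_def ginv_def)
qed

lemma bracket_inner: "snd (br (\<zeta>, 0) (z, 0)) \<bullet> \<mu> = - (\<zeta> \<bullet> kaplan br \<mu> z)"
  using kaplan_inner[OF heisenberg_type_lie_bracket, of \<mu> \<zeta> z] kaplan_skew[of \<mu> \<zeta> z] by (simp add: inner_commute)

text \<open>
  On the Fourier side in \<open>\<sigma>\<close> the group convolution is a twisted convolution of Gaussians in the
  horizontal variable, and the \<open>coth\<close> addition theorem turns it into a semigroup law.
\<close>

lemma twisted_gaussian_convolution:
  fixes z :: 'a and \<mu> :: 'b and t \<tau> :: real
  assumes t: "0 < t" and \<tau>: "0 < \<tau>"
  defines "n \<equiv> real DIM('a) / 2" and "\<rho> \<equiv> norm \<mu>"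
  shows "(LINT \<zeta>|lborel. exp (\<i> / 2 * complex_of_real (snd (br (\<zeta>, 0) (z, 0)) \<bullet> \<mu>)) *
        complex_of_real (hs \<rho> t powr n * exp (- ((norm (z - \<zeta>))\<^sup>2 / 4 * hc \<rho> t)) *
          (hs \<rho> \<tau> powr n * exp (- ((norm \<zeta>)\<^sup>2 / 4 * hc \<rho> \<tau>))))) =
    complex_of_real ((4 * pi) powr n * (hs \<rho> (\<tau> + t) powr n * exp (- ((norm z)\<^sup>2 / 4 * hc \<rho> (\<tau> + t)))))"
proof -
  define p q where "p = hc \<rho> t" and "q = hc \<rho> \<tau>"
  define a where "a = (p + q) / 4"
  \<comment> \<open>\<open>v\<close> comes from expanding |z - \<zeta>|^2 and \<open>w\<close> from
    the phase of the bracket. They are orthogonal by skewness, so the Gaussian integral is real, and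
    |w|^2 = \<rho>^2 |z|^2 / 4 supplies the \<rho>^2 of \<open>hc_mult\<close>.\<close>
  define v where "v = (p / 2) *\<^sub>R z"
  define w where "w = - ((1 / 2) *\<^sub>R kaplan br \<mu> z)"
  have rho: "0 \<le> \<rho>" by (simp add: \<rho>_def)
  have pq: "0 < p" "0 < q" using hc_pos[OF rho] t \<tau> by (auto simp: p_def q_def)
  have a: "0 < a" using pq by (simp add: a_def)
  define K where "K = hs \<rho> t powr n * hs \<rho> \<tau> powr n * exp (- ((norm z)\<^sup>2 / 4 * p))"
  have eq: "exp (\<i> / 2 * complex_of_real (snd (br (\<zeta>, 0) (z, 0)) \<bullet> \<mu>)) *
        complex_of_real (hs \<rho> t powr n * exp (- ((norm (z - \<zeta>))\<^sup>2 / 4 * hc \<rho> t)) *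
          (hs \<rho> \<tau> powr n * exp (- ((norm \<zeta>)\<^sup>2 / 4 * hc \<rho> \<tau>)))) =
     complex_of_real K * exp (complex_of_real (- (a * (norm \<zeta>)\<^sup>2) + \<zeta> \<bullet> v) + \<i> * complex_of_real (\<zeta> \<bullet> w))" for \<zeta>
  proof -
    have 1: "\<i> / 2 * complex_of_real (snd (br (\<zeta>, 0) (z, 0)) \<bullet> \<mu>) = \<i> * complex_of_real (\<zeta> \<bullet> w)"
      by (simp add: bracket_inner w_def)
    have z: "(norm (z - \<zeta>))\<^sup>2 = (norm z)\<^sup>2 + (norm \<zeta>)\<^sup>2 - 2 * (\<zeta> \<bullet> z)"
      unfolding power2_norm_eq_inner by (simp add: inner_diff_left inner_diff_right inner_commute)
    have 2: "- ((norm (z - \<zeta>))\<^sup>2 / 4 * p) + - ((norm \<zeta>)\<^sup>2 / 4 * q) =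
        - ((norm z)\<^sup>2 / 4 * p) + (- (a * (norm \<zeta>)\<^sup>2) + \<zeta> \<bullet> v)"
      unfolding z by (simp add: a_def v_def field_simps)
    have "exp (- ((norm (z - \<zeta>))\<^sup>2 / 4 * p)) * exp (- ((norm \<zeta>)\<^sup>2 / 4 * q)) =
        exp (- ((norm z)\<^sup>2 / 4 * p)) * exp (- (a * (norm \<zeta>)\<^sup>2) + \<zeta> \<bullet> v)"
      by (simp only: exp_add [symmetric] 2)
    then have 3: "hs \<rho> t powr n * exp (- ((norm (z - \<zeta>))\<^sup>2 / 4 * p)) * (hs \<rho> \<tau> powr n * exp (- ((norm \<zeta>)\<^sup>2 / 4 * q))) =
        K * exp (- (a * (norm \<zeta>)\<^sup>2) + \<zeta> \<bullet> v)"
      by (simp add: K_def mult_ac)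
    show ?thesis
      unfolding 1 p_def [symmetric] q_def [symmetric] 3
      by (simp only: exp_add exp_of_real of_real_mult mult_ac)
  qed
  have vw: "v \<bullet> w = 0" using kaplan_orthogonal[of \<mu> z] by (simp add: v_def w_def inner_commute)
  have nv: "(norm v)\<^sup>2 - (norm w)\<^sup>2 = (norm z)\<^sup>2 / 4 * (p\<^sup>2 - \<rho>\<^sup>2)"
    by (simp add: v_def w_def norm_kaplan \<rho>_def power_mult_distrib power_divide algebra_simps)
  have ex: "- ((norm z)\<^sup>2 / 4 * p) + ((norm v)\<^sup>2 - (norm w)\<^sup>2) / (4 * a) = - ((norm z)\<^sup>2 / 4 * hc \<rho> (\<tau> + t))"
  proof -
    have "hc \<rho> (\<tau> + t) = (p * q + \<rho>\<^sup>2) / (p + q)"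
      using hc_mult[OF rho t \<tau>] pq by (simp add: p_def q_def add.commute field_simps)
    moreover have "- p + (p\<^sup>2 - \<rho>\<^sup>2) / (p + q) = - ((p * q + \<rho>\<^sup>2) / (p + q))"
      using pq by (simp add: field_simps power2_eq_square)
    moreover have "- ((norm z)\<^sup>2 / 4 * p) + ((norm z)\<^sup>2 / 4 * (p\<^sup>2 - \<rho>\<^sup>2)) / (4 * a) =
        (norm z)\<^sup>2 / 4 * (- p + (p\<^sup>2 - \<rho>\<^sup>2) / (p + q))"
    proof -
      have "4 * a = p + q" by (simp add: a_def)
      then show ?thesis by (simp only: distrib_left times_divide_eq_right mult_minus_right)
    qed
    ultimately show ?thesis unfolding nv by simp
  qed
  have amp: "hs \<rho> t powr n * hs \<rho> \<tau> powr n * (pi / a) powr n = (4 * pi) powr n * hs \<rho> (\<tau> + t) powr n"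
  proof -
    have "hs \<rho> t * hs \<rho> \<tau> * (pi / a) = 4 * pi * hs \<rho> (\<tau> + t)"
      using hs_mult[OF rho t \<tau>] pq by (simp add: a_def p_def q_def add.commute)
    then show ?thesis by (simp only: powr_mult [symmetric])
  qed
  have "(LINT \<zeta>|lborel. complex_of_real K * exp (complex_of_real (- (a * (norm \<zeta>)\<^sup>2) + \<zeta> \<bullet> v) + \<i> * complex_of_real (\<zeta> \<bullet> w))) =
     complex_of_real K * (complex_of_real ((pi / a) powr n) * exp (complex_of_real (((norm v)\<^sup>2 - (norm w)\<^sup>2) / (4 * a))))"
    using gaussian_integral(2)[OF a, of v w] vw by (simp add: n_def)
  also have "\<dots> = complex_of_real (K * ((pi / a) powr n * exp (((norm v)\<^sup>2 - (norm w)\<^sup>2) / (4 * a))))"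
    by (simp only: exp_of_real of_real_mult)
  also have "K * ((pi / a) powr n * exp (((norm v)\<^sup>2 - (norm w)\<^sup>2) / (4 * a))) =
      (hs \<rho> t powr n * hs \<rho> \<tau> powr n * (pi / a) powr n) * exp (- ((norm z)\<^sup>2 / 4 * p) + ((norm v)\<^sup>2 - (norm w)\<^sup>2) / (4 * a))"
    by (simp only: K_def exp_add mult_ac)
  also have "\<dots> = (4 * pi) powr n * (hs \<rho> (\<tau> + t) powr n * exp (- ((norm z)\<^sup>2 / 4 * hc \<rho> (\<tau> + t))))"
    unfolding amp ex by simp
  finally show ?thesis unfolding eq .
qed

end

text \<open>Squares stay within the family, so the L^2 hypotheses of the Parseval formula reduce to
  integrability of \<open>mehler\<close> with doubled parameters.\<close>

lemma mehler_power2: "(mehler a c \<rho> t)\<^sup>2 = mehler (2 * a) (2 * c) \<rho> t"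
proof -
  have "(hs \<rho> t powr a)\<^sup>2 = hs \<rho> t powr (2 * a)"
    by (simp add: power2_eq_square powr_add [symmetric])
  moreover have "(exp (- (c * hc \<rho> t)))\<^sup>2 = exp (- (2 * c * hc \<rho> t))"
    by (simp add: power2_eq_square exp_add [symmetric])
  ultimately show ?thesis by (simp add: mehler_def power_mult_distrib)
qed

text \<open>Pulls out a Gaussian in the horizontal variable that does not depend on \<rho>, leaving
  a factor that does not depend on the horizontal variable.\<close>

lemma mehler_le_exp:
  assumes "0 \<le> \<rho>" "0 \<le> c" "0 < t"
  shows "mehler a c \<rho> t \<le> exp (- (c / t)) * mehler a 0 \<rho> t"
proof -
  have "c * (1 / t) \<le> c * hc \<rho> t" using assms by (intro mult_left_mono inverse_le_hc) auto
  then have "exp (- (c * hc \<rho> t)) \<le> exp (- (c / t))" by simp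
  then have "hs \<rho> t powr a * exp (- (c * hc \<rho> t)) \<le> hs \<rho> t powr a * exp (- (c / t))"
    by (rule mult_left_mono) simp
  then show ?thesis using assms by (simp add: mehler_def mult_ac)
qed

lemma mehler_time_integrable:
  assumes a: "1 < a" and c: "0 < c" and rho: "0 \<le> \<rho>"
  shows "integrable lborel (mehler a c \<rho>)"
    and "(LINT t|lborel. mehler a c \<rho> t) \<le> (LINT t:{0<..}|lborel. t powr (- a) * exp (- (c / t)))"
proof -
  let ?g = "\<lambda>t::real. indicator {0<..} t *\<^sub>R (t powr (- a) * exp (- (c / t)))"
  have g: "integrable lborel ?g"
    using integrable_powr_exp_inverse[OF a c] by (simp add: set_integrable_def)
  have le: "mehler a c \<rho> t \<le> ?g t" for t
    using mehler_le_powr[of \<rho> c a t] a c rho by (cases "0 < t") (auto simp: mehler_def)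
  show "integrable lborel (mehler a c \<rho>)"
    by (rule Bochner_Integration.integrable_bound[OF g])
       (auto simp: mehler_nonneg intro!: order.trans[OF le])
  then show "(LINT t|lborel. mehler a c \<rho> t) \<le> (LINT t:{0<..}|lborel. t powr (- a) * exp (- (c / t)))"
    unfolding set_lebesgue_integral_def by (rule integral_mono[OF _ g le])
qed

lemma mehler_continuous:
  fixes \<mu> :: "'b::euclidean_space"
  assumes t: "0 < t" and \<mu>: "\<mu> \<noteq> 0"
  shows "isCont (\<lambda>\<mu>::'b. complex_of_real (mehler a c (norm \<mu>) t)) \<mu>"
proof -
  have "continuous_on (- {0}) (\<lambda>\<mu>::'b. (norm \<mu> / sinh (norm \<mu> * t)) powr a *
      exp (- (c * (norm \<mu> / tanh (norm \<mu> * t)))))"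
    using t by (intro continuous_intros) auto
  then have "continuous_on (- {0}) (\<lambda>\<mu>::'b. mehler a c (norm \<mu>) t)"
    by (rule continuous_on_cong[THEN iffD1, rotated 2]) (use t in \<open>auto simp: mehler_def hs_def hc_def\<close>)
  then have "isCont (\<lambda>\<mu>::'b. mehler a c (norm \<mu>) t) \<mu>"
    using \<mu> by (auto simp: continuous_on_eq_continuous_at open_Compl)
  then show ?thesis by (intro continuous_intros)
qed

section \<open>The operators of the pointwise formula and \<open>conf_frac_Laplacian\<close> acting
  on \<open>e_kernel s\<close>\<close>

context
  fixes br :: "'a::euclidean_space \<times> 'b::euclidean_space \<Rightarrow> 'a \<times> 'b \<Rightarrow> 'a \<times> 'b"
  assumes ht: "heisenberg_type br"
begin

text \<open>For fixed \<zeta> the integral over the centre is a convolution of two Fourier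
  transforms, by the Parseval formula the transform of the product of the \<open>mehler\<close>
  factors; the bracket enters only through the shifted point
  \<open>\<sigma>\<^sub>0 \<zeta>\<close>. The integral over \<zeta> is then the twisted Gaussian
  convolution, and shifting the time variable by t makes \<open>fst p\<close> the total
  time.\<close>

lemma P_op_e_kernel:
  fixes s y t :: real and z :: 'a and \<sigma> :: 'b
  assumes s: "0 < s" "s < 1" and y: "0 < y" and t: "0 < t"
  shows "P_op br s t (\<lambda>h. e_kernel s h y) (z, \<sigma>) = complex_of_real (kernel_const s DIM('a) DIM('b)) *
    (LINT p|(lborel \<Otimes>\<^sub>M lborel). exp (- (\<i> * complex_of_real (\<sigma> \<bullet> snd p))) *
      complex_of_real (mehler (real DIM('a) / 2) ((norm z)\<^sup>2 / 4) (norm (snd p)) (fst p) *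
        ((t * hs (norm (snd p)) t) powr (1 + s) * mehler (1 - s) (y\<^sup>2 / 4) (norm (snd p)) (fst p - t))))"
proof -
  define n where "n = real DIM('a) / 2"
  define c where "c = y\<^sup>2 / 4"
  have n: "1 \<le> n" using heisenberg_type_DIM[OF ht] by (simp add: n_def)
  have c: "0 < c" using y by (simp add: c_def)
  define b where "b \<zeta> = snd (br (\<zeta>, 0) (z, 0))" for \<zeta>
  have b_meas [measurable]: "b \<in> borel_measurable borel"
  proof -
    have bil: "bilinear br" using heisenberg_type_lie_bracket[OF ht] by (simp add: lie_bracket_def)
    have "linear (\<lambda>\<zeta>. br (\<zeta>, 0) (z, 0))"
    proof (rule linearI)
      fix u v :: 'a and r :: real
      show "br (u + v, 0) (z, 0) = br (u, 0) (z, 0) + br (v, 0) (z, 0)"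
        using bilinear_ladd[OF bil, of "(u, 0)" "(v, 0)"] by simp
      show "br (r *\<^sub>R u, 0) (z, 0) = r *\<^sub>R br (u, 0) (z, 0)"
        using bilinear_lmul[OF bil, of r "(u, 0)"] by simp
    qed
    then have "linear b" unfolding b_def by (rule linear_compose[of _ snd, unfolded o_def]) (rule linear_snd)
    then show ?thesis
      by (intro borel_measurable_continuous_onI linear_continuous_on) (simp add: linear_conv_bounded_linear)
  qed
  define \<sigma>\<^sub>0 where "\<sigma>\<^sub>0 \<zeta> = \<sigma> - (1 / 2) *\<^sub>R b \<zeta>" for \<zeta>
  define fm where "fm \<zeta> \<mu> = mehler (n + 1 + s) ((norm (z - \<zeta>))\<^sup>2 / 4) (norm \<mu>) t" for \<zeta> and \<mu> :: 'b
  define hm where "hm \<zeta> p = mehler (n + 1 - s) (((norm \<zeta>)\<^sup>2 + y\<^sup>2) / 4) (norm (snd p)) (fst p)" for \<zeta> :: 'a and p :: "real \<times> 'b"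
  define f where "f \<zeta> \<mu> = complex_of_real (fm \<zeta> \<mu>)" for \<zeta> \<mu>
  define h where "h \<zeta> \<mu> = complex_of_real (LINT \<tau>|lborel. hm \<zeta> (\<tau>, \<mu>))" for \<zeta> \<mu>
  define Cf where "Cf = (4 * pi * t) powr (1 + s) * kernel_const (- s) DIM('a) DIM('b)"
  define Cu where "Cu = kernel_const s DIM('a) DIM('b)"
  define Q where "Q p = fourier (f (fst p)) (\<sigma>\<^sub>0 (fst p) - snd p) * fourier (h (fst p)) (snd p)" for p
  have [measurable]: "\<sigma>\<^sub>0 \<in> borel_measurable borel" unfolding \<sigma>\<^sub>0_def [abs_def] by measurable
  have K: "K_kernel s (gmul br (ginv p) (z, \<sigma>)) t * e_kernel s p y = complex_of_real (Cf * Cu) * Q p" for p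
  proof (cases p)
    case (Pair \<zeta> \<tau>)
    have "K_kernel s (gmul br (ginv (\<zeta>, \<tau>)) (z, \<sigma>)) t = complex_of_real Cf * fourier (f \<zeta>) (\<sigma>\<^sub>0 \<zeta> - \<tau>)"
      unfolding K_kernel_def gmul_ginv[OF ht] q_kernel_fourier[OF t]
      by (simp add: Cf_def f_def [abs_def] fm_def n_def \<sigma>\<^sub>0_def b_def)
    moreover have "e_kernel s (\<zeta>, \<tau>) y = complex_of_real Cu * fourier (h \<zeta>) \<tau>"
      using e_kernel_fourier(2)[OF s(2) y, of \<zeta> \<tau>] by (simp add: Cu_def h_def [abs_def] hm_def n_def)
    ultimately show ?thesis by (simp add: Pair Q_def)
  qed
  have exps: "0 < n + 1 + s" "1 < n + 1 - s" "0 < n + 1 - s" using n s by auto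
  have cc: "c \<le> ((norm \<zeta>)\<^sup>2 + y\<^sup>2) / 4" "0 < ((norm \<zeta>)\<^sup>2 + y\<^sup>2) / 4" for \<zeta> :: 'a
    using y by (auto simp: c_def add_nonneg_pos)
  have f_int: "integrable lborel (f \<zeta>)" for \<zeta>
    unfolding f_def fm_def by (intro integrable_of_real mehler_fixed_time_integrable exps t) simp
  have f2: "(cmod (f \<zeta> \<mu>))\<^sup>2 = mehler (2 * (n + 1 + s)) (2 * ((norm (z - \<zeta>))\<^sup>2 / 4)) (norm \<mu>) t" for \<zeta> \<mu>
    unfolding f_def fm_def norm_of_real power2_abs mehler_power2 ..
  have f2_int: "integrable lborel (\<lambda>\<mu>. (cmod (f \<zeta> \<mu>))\<^sup>2)" for \<zeta>
    unfolding f2 by (intro mehler_fixed_time_integrable) (use exps t in auto)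
  \<comment> \<open>As 1 / t <= \<open>hc\<close>, this Gaussian bounds the one in
    \<open>f \<zeta> \<mu>\<close> for all \<mu> at once; it carries the integrability in \<zeta> of
    everything below.\<close>
  define g where "g \<zeta> = exp (- ((norm (z - \<zeta>))\<^sup>2 / (4 * t)))" for \<zeta>
  have g_pos: "0 < g \<zeta>" for \<zeta> by (simp add: g_def)
  define Nf where "Nf = (LINT \<mu>|lborel. mehler (2 * (n + 1 + s)) 0 (norm (\<mu>::'b)) t)"
  have f2_le: "(LINT \<mu>|lborel. (cmod (f \<zeta> \<mu>))\<^sup>2) \<le> (g \<zeta>)\<^sup>2 * Nf" for \<zeta>
  proof -
    have i0: "integrable lborel (\<lambda>\<mu>::'b. mehler (2 * (n + 1 + s)) 0 (norm \<mu>) t)"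
      by (intro mehler_fixed_time_integrable) (use exps t in auto)
    have gg: "exp (- (2 * ((norm (z - \<zeta>))\<^sup>2 / 4) / t)) = (g \<zeta>)\<^sup>2"
      by (simp add: g_def power2_eq_square exp_add [symmetric])
    have "(LINT \<mu>|lborel. (cmod (f \<zeta> \<mu>))\<^sup>2) \<le> (LINT \<mu>|lborel. (g \<zeta>)\<^sup>2 * mehler (2 * (n + 1 + s)) 0 (norm (\<mu>::'b)) t)"
      unfolding f2 gg [symmetric]
      by (intro integral_mono integrable_mult_right i0 mehler_le_exp mehler_fixed_time_integrable) (use exps t in auto)
    then show ?thesis by (simp add: Nf_def)
  qed
  have f_bound: "cmod (f \<zeta> \<mu>) \<le> t powr (- (n + 1 + s)) * g \<zeta>" for \<zeta> \<mu>
    using mehler_le_powr[of "norm \<mu>" "(norm (z - \<zeta>))\<^sup>2 / 4" "n + 1 + s" t] exps t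
    by (simp add: f_def fm_def mehler_nonneg g_def)
  have f_cont: "isCont (f \<zeta>) \<mu>" if "\<mu> \<noteq> 0" for \<zeta> \<mu>
    unfolding f_def fm_def by (rule mehler_continuous[OF t that])
  have DIMb: "1 \<le> real DIM('b)" using DIM_positive[where 'a = 'b] by linarith
  have hm_int: "integrable (lborel \<Otimes>\<^sub>M lborel) (hm \<zeta>)" for \<zeta>
    unfolding hm_def by (intro mehler_integrable cc) (use exps DIMb in auto)
  define B where "B = (LINT t:{0<..}|lborel. t powr (- (n + 1 - s)) * exp (- (c / t)))"
  \<comment> \<open>Dropping |\<zeta>|^2 from the exponent gives a majorant of
    \<open>h \<zeta>\<close> that is free of \<zeta>. It is integrable and bounded by
    \<open>B\<close>, so the L^2 norms of all \<open>h \<zeta>\<close> have a common bound.\<close>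
  define h0 where "h0 \<mu> = (LINT \<tau>|lborel. mehler (n + 1 - s) c (norm (\<mu>::'b)) \<tau>)" for \<mu>
  have h0_int: "integrable lborel h0"
  proof -
    have "integrable (lborel \<Otimes>\<^sub>M lborel) (\<lambda>p. mehler (n + 1 - s) c (norm (snd p :: 'b)) (fst p))"
      by (intro mehler_integrable c) (use exps DIMb in auto)
    then have "integrable (lborel \<Otimes>\<^sub>M lborel) (\<lambda>(\<tau>, \<mu>::'b). mehler (n + 1 - s) c (norm \<mu>) \<tau>)"
      by (simp add: case_prod_unfold)
    from lborel_pair.integrable_snd[OF this] show ?thesis by (simp add: h0_def [abs_def])
  qed
  have h_le: "cmod (h \<zeta> \<mu>) \<le> h0 \<mu>" "h0 \<mu> \<le> B" "0 \<le> h0 \<mu>" for \<zeta> \<mu>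
  proof -
    have "(LINT \<tau>|lborel. hm \<zeta> (\<tau>, \<mu>)) \<le> h0 \<mu>"
      unfolding h0_def hm_def fst_conv snd_conv
      by (intro integral_mono mehler_time_integrable(1) mehler_antimono exps c cc norm_ge_zero)
    moreover have "0 \<le> (LINT \<tau>|lborel. hm \<zeta> (\<tau>, \<mu>))"
      by (rule Bochner_Integration.integral_nonneg) (simp add: hm_def mehler_nonneg)
    ultimately show "cmod (h \<zeta> \<mu>) \<le> h0 \<mu>" by (simp add: h_def)
    show "h0 \<mu> \<le> B"
      unfolding h0_def B_def by (rule mehler_time_integrable(2)[OF exps(2) c norm_ge_zero])
    show "0 \<le> h0 \<mu>"
      unfolding h0_def by (rule Bochner_Integration.integral_nonneg) (simp add: mehler_nonneg)
  qed
  have h_meas [measurable]: "h \<zeta> \<in> borel_measurable borel" for \<zeta>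
    unfolding h_def [abs_def] hm_def by measurable
  have h_int: "integrable lborel (h \<zeta>)" for \<zeta>
    by (rule Bochner_Integration.integrable_bound[OF h0_int]) (use h_le in auto)
  have h2_le: "(cmod (h \<zeta> \<mu>))\<^sup>2 \<le> B * h0 \<mu>" for \<zeta> \<mu>
    unfolding power2_eq_square
    using order.trans[OF h_le(1,2)] h_le(1,3) by (intro mult_mono) (auto intro: order.trans[OF norm_ge_zero])
  have h2_int: "integrable lborel (\<lambda>\<mu>. (cmod (h \<zeta> \<mu>))\<^sup>2)" for \<zeta>
    by (rule Bochner_Integration.integrable_bound[OF integrable_mult_right[OF h0_int, of B]])
       (auto intro!: order.trans[OF h2_le])
  define Nh where "Nh = B * (LINT \<mu>|lborel. h0 \<mu>)"
  have h2_le': "(LINT \<mu>|lborel. (cmod (h \<zeta> \<mu>))\<^sup>2) \<le> Nh" for \<zeta>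
    unfolding Nh_def integral_mult_right_zero [symmetric]
    by (intro integral_mono h2_int integrable_mult_right h0_int h2_le)
  have gauss: "integrable lborel g"
  proof -
    have "integrable lborel (\<lambda>x::'a. exp (- (1 / (4 * t) * (norm x)\<^sup>2)))"
      by (rule gaussian_integrable) (use t in simp)
    then have "integrable lborel (\<lambda>\<zeta>::'a. exp (- (1 / (4 * t) * (norm (z + (- 1) *\<^sub>R \<zeta>))\<^sup>2)))"
      using lborel_affine_subst(1)[of "- 1" "\<lambda>x::'a. exp (- (1 / (4 * t) * (norm x)\<^sup>2))" z] by simp
    then show ?thesis by (simp add: g_def [abs_def])
  qed
  have Q_meas: "Q \<in> borel_measurable (lborel \<Otimes>\<^sub>M lborel)"
    unfolding Q_def [abs_def] fourier_def f_def fm_def h_def hm_def by measurable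
  \<comment> \<open>the weight \<open>1 / g\<close> in the AM-GM bound makes both terms decay like \<open>g\<close>\<close>
  have Q_bound: "(LINT \<tau>|lborel. cmod (Q (\<zeta>, \<tau>))) \<le> (2 * pi) ^ DIM('b) * (Nf + Nh) / 2 * g \<zeta>" for \<zeta>
  proof -
    have "(LINT \<tau>|lborel. cmod (Q (\<zeta>, \<tau>))) \<le> (2 * pi) ^ DIM('b) *
        (1 / g \<zeta> * (LINT \<mu>|lborel. (cmod (f \<zeta> \<mu>))\<^sup>2) + (LINT \<mu>|lborel. (cmod (h \<zeta> \<mu>))\<^sup>2) / (1 / g \<zeta>)) / 2"
      unfolding Q_def fst_conv snd_conv
      by (rule fourier_product_L1_bound[OF f_int f2_int h_int h2_int]) (use g_pos in simp)
    also have "\<dots> \<le> (2 * pi) ^ DIM('b) * (1 / g \<zeta> * ((g \<zeta>)\<^sup>2 * Nf) + Nh / (1 / g \<zeta>)) / 2"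
      using g_pos[of \<zeta>] f2_le[of \<zeta>] h2_le'[of \<zeta>]
      by (intro divide_right_mono mult_left_mono add_mono) auto
    also have "\<dots> = (2 * pi) ^ DIM('b) * (Nf + Nh) / 2 * g \<zeta>"
      using g_pos[of \<zeta>] by (simp add: power2_eq_square algebra_simps add_divide_distrib)
    finally show ?thesis .
  qed
  have Q_int: "integrable (lborel \<Otimes>\<^sub>M lborel) Q"
  proof (rule lborel_pair.Fubini_integrable[OF Q_meas])
    show "AE \<zeta> in lborel. integrable lborel (\<lambda>\<tau>. Q (\<zeta>, \<tau>))"
      unfolding Q_def fst_conv snd_conv
      by (intro AE_I2 fourier_product_integrable[OF f_int f2_int h_int h2_int])
    show "integrable lborel (\<lambda>\<zeta>. LINT \<tau>|lborel. norm (Q (\<zeta>, \<tau>)))"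
    proof (rule Bochner_Integration.integrable_bound[OF integrable_mult_right[OF gauss]])
      show "AE \<zeta> in lborel. norm (LINT \<tau>|lborel. norm (Q (\<zeta>, \<tau>))) \<le>
          norm ((2 * pi) ^ DIM('b) * (Nf + Nh) / 2 * g \<zeta>)"
        using order.trans[OF Q_bound abs_ge_self] by simp
      show "(\<lambda>\<zeta>. LINT \<tau>|lborel. norm (Q (\<zeta>, \<tau>))) \<in> borel_measurable lborel"
        using Q_meas by measurable
    qed
  qed
  \<comment> \<open>The integrand after Parseval with time not yet integrated out. It is absolutely
    integrable in \<zeta>, time and frequency jointly, so \<zeta> can be integrated first.\<close>
  define X where "X = (\<lambda>(\<zeta>, p). exp (- (\<i> * complex_of_real (\<sigma>\<^sub>0 \<zeta> \<bullet> snd p))) * complex_of_real (fm \<zeta> (snd p) * hm \<zeta> p))"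
  have X_norm: "cmod (X (\<zeta>, p)) \<le> g \<zeta> * (t powr (- (n + 1 + s)) * hm \<zeta> p)" for \<zeta> p
  proof -
    have "cmod (f \<zeta> (snd p)) * hm \<zeta> p \<le> (t powr (- (n + 1 + s)) * g \<zeta>) * hm \<zeta> p"
      by (intro mult_right_mono f_bound) (simp add: hm_def mehler_nonneg)
    then show ?thesis by (simp add: X_def norm_mult f_def hm_def mehler_nonneg mult_ac)
  qed
  have fh_int: "integrable (lborel \<Otimes>\<^sub>M lborel) (\<lambda>p. fm \<zeta> (snd p) * hm \<zeta> p)" for \<zeta>
  proof (rule Bochner_Integration.integrable_bound[OF integrable_mult_right[OF hm_int[of \<zeta>], of "t powr (- (n + 1 + s)) * g \<zeta>"]])
    show "(\<lambda>p. fm \<zeta> (snd p) * hm \<zeta> p) \<in> borel_measurable (lborel \<Otimes>\<^sub>M lborel)"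
      unfolding fm_def hm_def by measurable
    show "AE p in lborel \<Otimes>\<^sub>M lborel. norm (fm \<zeta> (snd p) * hm \<zeta> p) \<le> norm (t powr (- (n + 1 + s)) * g \<zeta> * hm \<zeta> p)"
    proof (rule AE_I2)
      fix p
      have "cmod (X (\<zeta>, p)) = norm (fm \<zeta> (snd p) * hm \<zeta> p)" by (simp add: X_def norm_mult abs_mult)
      then show "norm (fm \<zeta> (snd p) * hm \<zeta> p) \<le> norm (t powr (- (n + 1 + s)) * g \<zeta> * hm \<zeta> p)"
        using order.trans[OF X_norm abs_ge_self, of \<zeta> p] by (simp add: mult_ac)
    qed
  qed
  have X_int: "integrable (lborel \<Otimes>\<^sub>M lborel) X"
  proof (rule Bochner_Integration.integrable_bound)
    have "integrable lborel (\<lambda>p::real \<times> 'b. t powr (- (n + 1 + s)) * mehler (n + 1 - s) c (norm (snd p)) (fst p))"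
      unfolding lborel_prod [symmetric] by (intro integrable_mult_right mehler_integrable c) (use exps DIMb in auto)
    from integrable_mult_pair[OF gauss this]
    show "integrable (lborel \<Otimes>\<^sub>M lborel)
        (\<lambda>q. g (fst q) * (t powr (- (n + 1 + s)) * mehler (n + 1 - s) c (norm (snd (snd q) :: 'b)) (fst (snd q))))" .
    show "X \<in> borel_measurable (lborel \<Otimes>\<^sub>M lborel)"
      unfolding X_def fm_def hm_def case_prod_unfold by measurable
    show "AE q in lborel \<Otimes>\<^sub>M lborel. norm (X q) \<le>
        norm (g (fst q) * (t powr (- (n + 1 + s)) * mehler (n + 1 - s) c (norm (snd (snd q) :: 'b)) (fst (snd q))))"
    proof (rule AE_I2)
      fix q :: "'a \<times> (real \<times> 'b)"
      obtain \<zeta> p where q: "q = (\<zeta>, p)" by (cases q)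
      have "norm (X q) \<le> g \<zeta> * (t powr (- (n + 1 + s)) * hm \<zeta> p)" unfolding q by (rule X_norm)
      also have "\<dots> \<le> g \<zeta> * (t powr (- (n + 1 + s)) * mehler (n + 1 - s) c (norm (snd p)) (fst p))"
        using g_pos[of \<zeta>] unfolding hm_def by (intro mult_left_mono mehler_antimono cc) auto
      finally show "norm (X q) \<le>
          norm (g (fst q) * (t powr (- (n + 1 + s)) * mehler (n + 1 - s) c (norm (snd (snd q) :: 'b)) (fst (snd q))))"
        using abs_ge_self order.trans by (fastforce simp: q)
    qed
  qed
  have slice: "(LINT \<tau>|lborel. Q (\<zeta>, \<tau>)) = (2 * pi) ^ DIM('b) * (LINT p|lborel. X (\<zeta>, p))" for \<zeta>
  proof -
    have "(LINT \<tau>|lborel. Q (\<zeta>, \<tau>)) = (2 * pi) ^ DIM('b) * fourier (\<lambda>\<mu>. f \<zeta> \<mu> * h \<zeta> \<mu>) (\<sigma>\<^sub>0 \<zeta>)"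
      unfolding Q_def fst_conv snd_conv
      by (rule fourier_parseval[OF f_int f2_int h_int h2_int f_bound f_cont])
    also have "(\<lambda>\<mu>. f \<zeta> \<mu> * h \<zeta> \<mu>) = (\<lambda>\<mu>. complex_of_real (LINT \<tau>|lborel. fm \<zeta> (snd (\<tau>, \<mu>)) * hm \<zeta> (\<tau>, \<mu>)))"
      by (simp add: f_def h_def)
    also have "fourier \<dots> (\<sigma>\<^sub>0 \<zeta>) = (LINT p|lborel. X (\<zeta>, p))"
      using fourier_integral_pair(1)[OF fh_int[of \<zeta>], of "\<sigma>\<^sub>0 \<zeta>"] by (simp add: X_def lborel_prod)
    finally show ?thesis .
  qed
  define G where "G p = exp (- (\<i> * complex_of_real (\<sigma> \<bullet> snd p))) *
      complex_of_real (mehler n ((norm z)\<^sup>2 / 4) (norm (snd p)) (fst p) *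
        (hs (norm (snd p)) t powr (1 + s) * mehler (1 - s) c (norm (snd p)) (fst p - t)))" for p :: "real \<times> 'b"
  have inner: "(LINT \<zeta>|lborel. X (\<zeta>, (\<tau>, \<mu>))) = complex_of_real ((4 * pi) powr n) * G ((t, 0) + 1 *\<^sub>R (\<tau>, \<mu>))" for \<tau> \<mu>
  proof (cases "0 < \<tau>")
    case False
    \<comment> \<open>Both sides are 0: on the left \<open>hm\<close> vanishes for \<tau> <= 0, on
      the right the factor \<open>mehler (1 - s) c\<close> at time (\<tau> + t) - t.\<close>
    then show ?thesis by (simp add: X_def hm_def mehler_def G_def mehler_def)
  next
    case True
    define \<rho> where "\<rho> = norm \<mu>"
    define D where "D = exp (- (\<i> * complex_of_real (\<sigma> \<bullet> \<mu>))) * complex_of_real (hs \<rho> t powr (1 + s) * mehler (1 - s) c \<rho> \<tau>)"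
    have "X (\<zeta>, (\<tau>, \<mu>)) = D * (exp (\<i> / 2 * complex_of_real (snd (br (\<zeta>, 0) (z, 0)) \<bullet> \<mu>)) *
        complex_of_real (hs \<rho> t powr n * exp (- ((norm (z - \<zeta>))\<^sup>2 / 4 * hc \<rho> t)) *
          (hs \<rho> \<tau> powr n * exp (- ((norm \<zeta>)\<^sup>2 / 4 * hc \<rho> \<tau>)))))" for \<zeta>
    proof -
      have 1: "exp (- (\<i> * complex_of_real (\<sigma>\<^sub>0 \<zeta> \<bullet> \<mu>))) = exp (- (\<i> * complex_of_real (\<sigma> \<bullet> \<mu>))) *
          exp (\<i> / 2 * complex_of_real (snd (br (\<zeta>, 0) (z, 0)) \<bullet> \<mu>))"
        by (simp add: exp_add [symmetric] \<sigma>\<^sub>0_def b_def inner_diff_left algebra_simps)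
      have 2: "hs \<rho> t powr (n + 1 + s) = hs \<rho> t powr n * hs \<rho> t powr (1 + s)"
        by (simp add: powr_add [symmetric] add.assoc)
      have 3: "hs \<rho> \<tau> powr (n + 1 - s) = hs \<rho> \<tau> powr n * hs \<rho> \<tau> powr (1 - s)"
        by (simp add: powr_add [symmetric] add_diff_eq)
      have 4: "exp (- (((norm \<zeta>)\<^sup>2 + y\<^sup>2) / 4 * hc \<rho> \<tau>)) = exp (- ((norm \<zeta>)\<^sup>2 / 4 * hc \<rho> \<tau>)) * exp (- (c * hc \<rho> \<tau>))"
        by (simp add: exp_add [symmetric] c_def algebra_simps add_divide_distrib)
      have "fm \<zeta> \<mu> * hm \<zeta> (\<tau>, \<mu>) = hs \<rho> t powr (1 + s) * mehler (1 - s) c \<rho> \<tau> *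
          (hs \<rho> t powr n * exp (- ((norm (z - \<zeta>))\<^sup>2 / 4 * hc \<rho> t)) *
          (hs \<rho> \<tau> powr n * exp (- ((norm \<zeta>)\<^sup>2 / 4 * hc \<rho> \<tau>))))"
        unfolding fm_def hm_def fst_conv snd_conv \<rho>_def [symmetric] mehler_def mehler_def 2 3 4 using True t by simp
      then have F: "complex_of_real (fm \<zeta> \<mu> * hm \<zeta> (\<tau>, \<mu>)) = complex_of_real \<dots>" by (rule arg_cong)
      have "X (\<zeta>, (\<tau>, \<mu>)) = exp (- (\<i> * complex_of_real (\<sigma>\<^sub>0 \<zeta> \<bullet> \<mu>))) * complex_of_real (fm \<zeta> \<mu> * hm \<zeta> (\<tau>, \<mu>))"
        by (simp add: X_def)
      then show ?thesis unfolding 1 F D_def by (simp only: of_real_mult mult_ac)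
    qed
    then have "(LINT \<zeta>|lborel. X (\<zeta>, (\<tau>, \<mu>))) =
        D * complex_of_real ((4 * pi) powr n * (hs \<rho> (\<tau> + t) powr n * exp (- ((norm z)\<^sup>2 / 4 * hc \<rho> (\<tau> + t)))))"
      using twisted_gaussian_convolution[OF ht t True, of z \<mu>] by (simp add: n_def \<rho>_def)
    also have "hs \<rho> (\<tau> + t) powr n * exp (- ((norm z)\<^sup>2 / 4 * hc \<rho> (\<tau> + t))) = mehler n ((norm z)\<^sup>2 / 4) \<rho> (\<tau> + t)"
      using True t by (simp add: mehler_def)
    finally show ?thesis by (simp add: D_def G_def \<rho>_def add.commute mult_ac)
  qed
  \<comment> \<open>The (2 pi)^k of Parseval and the (4 pi)^n of the Gaussian integral cancel
    against the kernel constant and the prefactor of \<open>K_kernel\<close>. The surviving t^(1+s)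
    turns the power of \<open>hs\<close> into one of \<open>t * hs\<close>.\<close>
  have const: "Cf * (2 * pi) ^ DIM('b) * (4 * pi) powr n = t powr (1 + s)"
  proof -
    have "(4 * pi * t) powr (1 + s) = (4 * pi) powr (1 + s) * t powr (1 + s)" by (rule powr_mult)
    moreover have "(4 * pi) powr (1 + s) * (4 * pi) powr (- (n + 1 + s)) * (4 * pi) powr n = 1"
      by (simp only: powr_add [symmetric]) simp
    ultimately show ?thesis
      by (simp add: Cf_def kernel_const_def n_def)
  qed
  have "P_op br s t (\<lambda>h. e_kernel s h y) (z, \<sigma>) = complex_of_real (Cf * Cu) * (LINT p|(lborel \<Otimes>\<^sub>M lborel). Q p)"
    unfolding P_op_def K lborel_prod by (rule integral_mult_right_zero)
  also have "(LINT p|(lborel \<Otimes>\<^sub>M lborel). Q p) = (LINT \<zeta>|lborel. (LINT \<tau>|lborel. Q (\<zeta>, \<tau>)))"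
    by (rule lborel_pair.integral_fst'[OF Q_int, symmetric])
  also have "\<dots> = (2 * pi) ^ DIM('b) * (LINT \<zeta>|lborel. (LINT p|lborel. X (\<zeta>, p)))"
    unfolding slice by (rule integral_mult_right_zero)
  also have "(LINT \<zeta>|lborel. (LINT p|lborel. X (\<zeta>, p))) = (LINT p|lborel. (LINT \<zeta>|lborel. X (\<zeta>, p)))"
    by (rule lborel_pair.Fubini_integral [symmetric]) (use X_int in simp)
  also have "\<dots> = (LINT p|lborel. complex_of_real ((4 * pi) powr n) * G ((t, 0) + 1 *\<^sub>R p))"
  proof (rule Bochner_Integration.integral_cong[OF refl])
    fix p :: "real \<times> 'b"
    show "(LINT \<zeta>|lborel. X (\<zeta>, p)) = complex_of_real ((4 * pi) powr n) * G ((t, 0) + 1 *\<^sub>R p)"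
      using inner[of "fst p" "snd p"] by simp
  qed
  also have "\<dots> = complex_of_real ((4 * pi) powr n) * (LINT p|lborel. G ((t, 0) + 1 *\<^sub>R p))"
    by (rule integral_mult_right_zero)
  also have "(LINT p|lborel. G ((t, 0) + 1 *\<^sub>R p)) = (LINT p|lborel. G p)"
    using lborel_affine_subst(2)[of 1 G "(t, 0)"] by simp
  also have "complex_of_real (Cf * Cu) * ((2 * pi) ^ DIM('b) * (complex_of_real ((4 * pi) powr n) * (LINT p|lborel. G p))) =
      complex_of_real Cu * (complex_of_real (t powr (1 + s)) * (LINT p|lborel. G p))"
    unfolding const [symmetric] by simp
  also have "complex_of_real (t powr (1 + s)) * (LINT p|lborel. G p) =
      (LINT p|lborel. complex_of_real (t powr (1 + s)) * G p)"
    by (rule integral_mult_right_zero [symmetric])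
  also have "\<dots> = (LINT p|lborel. exp (- (\<i> * complex_of_real (\<sigma> \<bullet> snd p))) *
      complex_of_real (mehler n ((norm z)\<^sup>2 / 4) (norm (snd p)) (fst p) *
        ((t * hs (norm (snd p)) t) powr (1 + s) * mehler (1 - s) c (norm (snd p)) (fst p - t))))"
    by (intro Bochner_Integration.integral_cong refl) (simp add: G_def powr_mult)
  finally show ?thesis by (simp add: Cu_def n_def c_def lborel_prod)
qed

text \<open>P u - u becomes one integral over total time and frequency whose integrand is the
  horizontal factor \<open>w\<close> times a one-dimensional difference. Once the t integral is
  moved inside, \<open>increment_integral\<close> evaluates it pointwise, and its exponent 1 + s
  joins the n of \<open>w\<close> to the exponent of \<open>e_kernel (- s)\<close>.\<close>

lemma conf_frac_Laplacian_e_kernel: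
  fixes s y :: real and z :: 'a and \<sigma> :: 'b
  assumes s: "0 < s" "s < 1" and y: "0 < y"
  shows "conf_frac_Laplacian br s (\<lambda>h. e_kernel s h y) (z, \<sigma>) =
    complex_of_real ((2 * pi * y) powr (2 * s)) * e_kernel (- s) (z, \<sigma>) y"
proof -
  define n where "n = real DIM('a) / 2"
  define c where "c = y\<^sup>2 / 4"
  have n: "1 \<le> n" using heisenberg_type_DIM[OF ht] by (simp add: n_def)
  have c: "0 < c" using y by (simp add: c_def)
  have DIMb: "1 \<le> real DIM('b)" using DIM_positive[where 'a = 'b] by linarith
  define Cs where "Cs = kernel_const s DIM('a) DIM('b)"
  define Cm where "Cm = kernel_const (- s) DIM('a) DIM('b)"
  define e where "e p = exp (- (\<i> * complex_of_real (\<sigma> \<bullet> snd p)))" for p :: "real \<times> 'b"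
  have e_norm: "cmod (e p * complex_of_real r) = \<bar>r\<bar>" for p r by (simp add: e_def norm_mult)
  define w where "w p = mehler n ((norm z)\<^sup>2 / 4) (norm (snd p)) (fst p)" for p :: "real \<times> 'b"
  define u where "u p = mehler (1 - s) c (norm (snd p)) (fst p)" for p :: "real \<times> 'b"
  define ut where "ut t p = (t * hs (norm (snd p)) t) powr (1 + s) * mehler (1 - s) c (norm (snd p)) (fst p - t)"
    for t and p :: "real \<times> 'b"
  obtain M where M: "0 < M"
    "\<And>\<rho> T. 0 \<le> \<rho> \<Longrightarrow> 0 < T \<Longrightarrow> mehler (1 - s) c \<rho> T \<le> M * exp (- (c / 2 * hc \<rho> T))"
    "\<And>\<rho> T t. 0 \<le> \<rho> \<Longrightarrow> 0 < T \<Longrightarrow> 0 < t \<Longrightarrow>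
      \<bar>(t * hs \<rho> t) powr (1 + s) * mehler (1 - s) c \<rho> (T - t) - mehler (1 - s) c \<rho> T\<bar> \<le>
        M * min 1 t * exp (- (c / 2 * hc \<rho> T))"
    using mehler_increment_bound[OF s c] by blast
  \<comment> \<open>The common majorant: \<open>w\<close> times the half exponential kept in
    \<open>mehler_increment_bound\<close>, with the horizontal Gaussian estimated by 1. It is
    integrable because n + k > 1 and c / 2 > 0.\<close>
  define d where "d p = mehler n (c / 2) (norm (snd p)) (fst p)" for p :: "real \<times> 'b"
  have d_int: "integrable (lborel \<Otimes>\<^sub>M lborel) d"
    unfolding d_def by (intro mehler_integrable; use n DIMb c in linarith)
  have w_exp: "w p * exp (- (c / 2 * hc (norm (snd p)) (fst p))) \<le> d p" for p
  proof (cases "0 < fst p")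
    case True
    have "0 \<le> (norm z)\<^sup>2 / 4 * hc (norm (snd p)) (fst p)"
      using hc_pos[of "norm (snd p)" "fst p"] True by simp
    then have "hs (norm (snd p)) (fst p) powr n * exp (- ((norm z)\<^sup>2 / 4 * hc (norm (snd p)) (fst p))) \<le>
        hs (norm (snd p)) (fst p) powr n * 1"
      by (intro mult_left_mono) auto
    then show ?thesis using True by (simp add: w_def d_def mehler_def mult_right_mono)
  qed (simp add: w_def d_def mehler_def)
  have w_nonneg: "0 \<le> w p" and d_nonneg: "0 \<le> d p" for p
    by (simp_all add: w_def d_def mehler_nonneg)
  have w_zero: "w p = 0" if "\<not> 0 < fst p" for p
    using that by (simp add: w_def mehler_def)
  have diff_le: "w p * \<bar>ut t p - u p\<bar> \<le> M * min 1 t * d p" if "0 < t" for t p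
  proof (cases "0 < fst p")
    case True
    have "w p * \<bar>ut t p - u p\<bar> \<le> w p * (M * min 1 t * exp (- (c / 2 * hc (norm (snd p)) (fst p))))"
      unfolding ut_def u_def by (intro mult_left_mono M w_nonneg norm_ge_zero True that)
    also have "\<dots> = M * min 1 t * (w p * exp (- (c / 2 * hc (norm (snd p)) (fst p))))" by simp
    also have "\<dots> \<le> M * min 1 t * d p" using M(1) that by (intro mult_left_mono w_exp) auto
    finally show ?thesis .
  qed (use M(1) that d_nonneg in \<open>simp add: w_zero\<close>)
  have u_le: "w p * u p \<le> M * d p" for p
  proof (cases "0 < fst p")
    case True
    have "w p * u p \<le> w p * (M * exp (- (c / 2 * hc (norm (snd p)) (fst p))))"
      unfolding u_def by (intro mult_left_mono M w_nonneg norm_ge_zero True)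
    also have "\<dots> = M * (w p * exp (- (c / 2 * hc (norm (snd p)) (fst p))))" by simp
    also have "\<dots> \<le> M * d p" using M(1) by (intro mult_left_mono w_exp) auto
    finally show ?thesis .
  qed (use M(1) d_nonneg in \<open>simp add: w_zero\<close>)
  have [measurable]: "w \<in> borel_measurable borel" "u \<in> borel_measurable borel" "e \<in> borel_measurable borel"
      "d \<in> borel_measurable borel" "ut t \<in> borel_measurable borel" for t
    unfolding w_def [abs_def] u_def [abs_def] e_def [abs_def] ut_def [abs_def] d_def [abs_def] by measurable
  have u_int: "integrable lborel (\<lambda>p. e p * complex_of_real (w p * u p))"
  proof (rule Bochner_Integration.integrable_bound[OF integrable_mult_right[of M, OF d_int[unfolded lborel_prod]]])
    show "AE p in lborel. norm (e p * complex_of_real (w p * u p)) \<le> norm (M * d p)"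
      unfolding e_norm using order.trans[OF u_le abs_ge_self] w_nonneg
      by (auto simp: u_def mehler_nonneg)
  qed measurable
  have diff_int: "integrable lborel (\<lambda>p. e p * complex_of_real (w p * (ut t p - u p)))" if t: "0 < t" for t
  proof (rule Bochner_Integration.integrable_bound[OF integrable_mult_right[of "M * min 1 t", OF d_int[unfolded lborel_prod]]])
    show "AE p in lborel. norm (e p * complex_of_real (w p * (ut t p - u p))) \<le> norm (M * min 1 t * d p)"
      unfolding e_norm abs_mult[of "w _"] abs_of_nonneg[OF w_nonneg] real_norm_def
      by (rule AE_I2) (rule order.trans[OF diff_le[OF t] abs_ge_self])
  qed measurable
  have E: "e_kernel s (z, \<sigma>) y = complex_of_real Cs * (LINT p|lborel. e p * complex_of_real (w p * u p))"
  proof -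
    have "mehler (n + 1 - s) (((norm z)\<^sup>2 + y\<^sup>2) / 4) (norm (snd p)) (fst p) = w p * u p" for p :: "real \<times> 'b"
    proof -
      have "hs (norm (snd p)) (fst p) powr (n + 1 - s) = hs (norm (snd p)) (fst p) powr n * hs (norm (snd p)) (fst p) powr (1 - s)"
        by (simp add: powr_add [symmetric] add_diff_eq)
      moreover have "exp (- (((norm z)\<^sup>2 + y\<^sup>2) / 4 * hc (norm (snd p)) (fst p))) =
          exp (- ((norm z)\<^sup>2 / 4 * hc (norm (snd p)) (fst p))) * exp (- (c * hc (norm (snd p)) (fst p)))"
        by (simp add: exp_add [symmetric] c_def algebra_simps add_divide_distrib)
      ultimately show ?thesis by (simp add: mehler_def mehler_def w_def u_def)
    qed
    then show ?thesis
      using e_kernel_fourier(1)[OF s(2) y, of z \<sigma>] by (simp add: Cs_def e_def n_def lborel_prod)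
  qed
  have P: "P_op br s t (\<lambda>h. e_kernel s h y) (z, \<sigma>) - e_kernel s (z, \<sigma>) y =
      complex_of_real Cs * (LINT p|lborel. e p * complex_of_real (w p * (ut t p - u p)))" if t: "0 < t" for t
  proof -
    have "P_op br s t (\<lambda>h. e_kernel s h y) (z, \<sigma>) = complex_of_real Cs * (LINT p|lborel. e p * complex_of_real (w p * ut t p))"
      using P_op_e_kernel[OF s y t, of z \<sigma>] by (simp add: Cs_def e_def n_def c_def w_def ut_def lborel_prod)
    also have "(LINT p|lborel. e p * complex_of_real (w p * ut t p)) =
        (LINT p|lborel. e p * complex_of_real (w p * (ut t p - u p)) + e p * complex_of_real (w p * u p))"
      by (intro Bochner_Integration.integral_cong refl) (simp add: algebra_simps)
    also have "\<dots> = (LINT p|lborel. e p * complex_of_real (w p * (ut t p - u p))) + (LINT p|lborel. e p * complex_of_real (w p * u p))"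
      by (rule Bochner_Integration.integral_add[OF diff_int[OF t] u_int])
    finally show ?thesis unfolding E by (simp add: algebra_simps)
  qed
  define W where "W = (\<lambda>(t, p). complex_of_real (indicator {0<..} t * (1 / t powr (1 + s))) * (e p * complex_of_real (w p * (ut t p - u p))))"
  \<comment> \<open>Since \<open>min 1 t\<close> was obtained uniformly in \<rho> and T, the
    majorant is a function of t times a function of p, and each is integrable.\<close>
  have W_int: "integrable (lborel \<Otimes>\<^sub>M lborel) W"
  proof (rule Bochner_Integration.integrable_bound)
    have "integrable lborel (\<lambda>t::real. indicator {0<..} t * (1 / t powr (1 + s) * min 1 t))"
      using integrable_min_powr[OF s] by (simp add: set_integrable_def)
    from integrable_mult_pair[OF this integrable_mult_right[of M, OF d_int[unfolded lborel_prod]]]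
    show "integrable (lborel \<Otimes>\<^sub>M lborel)
        (\<lambda>q. (indicator {0<..} (fst q) * (1 / fst q powr (1 + s) * min 1 (fst q))) * (M * d (snd q)))" .
    show "W \<in> borel_measurable (lborel \<Otimes>\<^sub>M lborel)"
      unfolding W_def ut_def case_prod_unfold by measurable
    show "AE q in lborel \<Otimes>\<^sub>M lborel. norm (W q) \<le>
        norm ((indicator {0<..} (fst q) * (1 / fst q powr (1 + s) * min 1 (fst q))) * (M * d (snd q)))"
    proof (rule AE_I2)
      fix q :: "real \<times> (real \<times> 'b)"
      obtain t p where q: "q = (t, p)" by (cases q)
      show "norm (W q) \<le>
        norm ((indicator {0<..} (fst q) * (1 / fst q powr (1 + s) * min 1 (fst q))) * (M * d (snd q)))"
      proof (cases "0 < t")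
        case True
        have "norm (W q) = 1 / t powr (1 + s) * (w p * \<bar>ut t p - u p\<bar>)"
          using True unfolding q W_def prod.case norm_mult[of "complex_of_real _"] e_norm abs_mult[of "w _"] abs_of_nonneg[OF w_nonneg]
          by (simp add: norm_divide)
        also have "\<dots> \<le> 1 / t powr (1 + s) * (M * min 1 t * d p)"
          by (intro mult_left_mono diff_le True) simp
        also have "\<dots> = (indicator {0<..} t * (1 / t powr (1 + s) * min 1 t)) * (M * d p)"
          using True by simp
        finally show ?thesis unfolding q fst_conv snd_conv real_norm_def by (rule order.trans[OF _ abs_ge_self])
      qed (simp add: q W_def)
    qed
  qed
  have inner: "(LINT t|lborel. W (t, p)) = complex_of_real (- (Gamma (1 - s) / s * c powr s)) *
      (e p * complex_of_real (mehler (n + 1 - - s) (((norm z)\<^sup>2 + y\<^sup>2) / 4) (norm (snd p)) (fst p)))" for p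
  proof (cases "0 < fst p")
    case False
    then show ?thesis by (simp add: W_def w_zero mehler_def)
  next
    case True
    let ?\<rho> = "norm (snd p)"
    have "(LINT t|lborel. W (t, p)) =
        (LINT t|lborel. e p * complex_of_real (w p) * complex_of_real (indicator {0<..} t *\<^sub>R increment s c ?\<rho> (fst p) t))"
      by (intro Bochner_Integration.integral_cong refl)
         (simp add: W_def increment_def[OF s c norm_ge_zero True] ut_def u_def)
    also have "\<dots> = e p * complex_of_real (w p) * complex_of_real (LINT t:{0<..}|lborel. increment s c ?\<rho> (fst p) t)"
      unfolding set_lebesgue_integral_def integral_mult_right_zero integral_complex_of_real ..
    also have "\<dots> = e p * complex_of_real (w p) * complex_of_real
        (- (Gamma (1 - s) / s * c powr s * (hs ?\<rho> (fst p) powr (1 + s) * exp (- (c * hc ?\<rho> (fst p))))))"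
      unfolding increment_integral[OF s c norm_ge_zero True] ..
    also have "\<dots> = complex_of_real (- (Gamma (1 - s) / s * c powr s)) *
        (e p * complex_of_real (w p * (hs ?\<rho> (fst p) powr (1 + s) * exp (- (c * hc ?\<rho> (fst p))))))"
      by simp
    also have "w p * (hs ?\<rho> (fst p) powr (1 + s) * exp (- (c * hc ?\<rho> (fst p)))) =
        mehler (n + 1 - - s) (((norm z)\<^sup>2 + y\<^sup>2) / 4) ?\<rho> (fst p)"
    proof -
      have "hs ?\<rho> (fst p) powr (n + 1 - - s) = hs ?\<rho> (fst p) powr n * hs ?\<rho> (fst p) powr (1 + s)"
        by (simp add: powr_add [symmetric] add.assoc)
      moreover have "exp (- (((norm z)\<^sup>2 + y\<^sup>2) / 4 * hc ?\<rho> (fst p))) =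
          exp (- ((norm z)\<^sup>2 / 4 * hc ?\<rho> (fst p))) * exp (- (c * hc ?\<rho> (fst p)))"
        by (simp add: exp_add [symmetric] c_def algebra_simps add_divide_distrib)
      ultimately show ?thesis using True by (simp only: mehler_def w_def if_True mult_ac)
    qed
    finally show ?thesis .
  qed
  define I where "I = (LINT p|lborel. e p * complex_of_real (mehler (n + 1 - - s) (((norm z)\<^sup>2 + y\<^sup>2) / 4) (norm (snd p)) (fst p)))"
  have Em: "e_kernel (- s) (z, \<sigma>) y = complex_of_real Cm * I"
    using e_kernel_fourier(1)[of "- s" y z \<sigma>] s y by (simp add: I_def Cm_def e_def n_def lborel_prod)
  have "(LINT t:{0<..}|lborel. complex_of_real (1 / t powr (1 + s)) *
        (P_op br s t (\<lambda>h. e_kernel s h y) (z, \<sigma>) - e_kernel s (z, \<sigma>) y)) =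
      (LINT t|lborel. complex_of_real Cs * (LINT p|lborel. W (t, p)))"
    unfolding set_lebesgue_integral_def
  proof (intro Bochner_Integration.integral_cong refl)
    fix t :: real
    show "indicator {0<..} t *\<^sub>R (complex_of_real (1 / t powr (1 + s)) *
        (P_op br s t (\<lambda>h. e_kernel s h y) (z, \<sigma>) - e_kernel s (z, \<sigma>) y)) = complex_of_real Cs * (LINT p|lborel. W (t, p))"
    proof (cases "0 < t")
      case True
      have "(LINT p|lborel. W (t, p)) = complex_of_real (1 / t powr (1 + s)) * (LINT p|lborel. e p * complex_of_real (w p * (ut t p - u p)))"
        unfolding W_def prod.case integral_mult_right_zero using True by simp
      then show ?thesis unfolding P[OF True] using True by simp
    qed (simp add: W_def)
  qed
  also have "\<dots> = complex_of_real Cs * (LINT p|lborel. (LINT t|lborel. W (t, p)))"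
    using lborel_pair.Fubini_integral[of "\<lambda>t p. W (t, p)"] W_int by simp
  also have "(LINT p|lborel. (LINT t|lborel. W (t, p))) = complex_of_real (- (Gamma (1 - s) / s * c powr s)) * I"
    unfolding inner I_def by (rule integral_mult_right_zero)
  finally have "conf_frac_Laplacian br s (\<lambda>h. e_kernel s h y) (z, \<sigma>) =
      complex_of_real (s / Gamma (1 - s) * Cs * (Gamma (1 - s) / s * c powr s)) * I"
    unfolding conf_frac_Laplacian_def by simp
  \<comment> \<open>The normalisation s / Gamma(1 - s) of the operator is the reciprocal of the
    factor produced by the time integral; what remains is c^s and the change of
    \<open>kernel_const\<close> from s to - s.\<close>
  also have "s / Gamma (1 - s) * Cs * (Gamma (1 - s) / s * c powr s) = (2 * pi * y) powr (2 * s) * Cm"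
  proof -
    have "Gamma (1 - s) \<noteq> 0" using Gamma_real_pos[of "1 - s"] s by linarith
    then have "s / Gamma (1 - s) * Cs * (Gamma (1 - s) / s * c powr s) = Cs * c powr s"
      using s by simp
    moreover have "c powr s = (y / 2) powr (2 * s)"
    proof -
      have "c = (y / 2) powr 2" using y by (simp add: c_def power_divide)
      then show ?thesis by (simp only: powr_powr)
    qed
    moreover have "Cs * (y / 2) powr (2 * s) = (2 * pi * y) powr (2 * s) * Cm"
    proof -
      have "2 * pi * y = (4 * pi) * (y / 2)" by simp
      then have 1: "(2 * pi * y) powr (2 * s) = (4 * pi) powr (2 * s) * (y / 2) powr (2 * s)"
        by (simp only: powr_mult)
      have 2: "(4 * pi) powr (2 * s) * (4 * pi) powr (- (n + 1 - - s)) = (4 * pi) powr (- (n + 1 - s))"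
        by (simp only: powr_add [symmetric]) (simp add: algebra_simps)
      show ?thesis
        unfolding 1 Cs_def Cm_def kernel_const_def n_def [symmetric] 2 [symmetric] by simp
    qed
    ultimately show ?thesis by simp
  qed
  finally show ?thesis unfolding Em by simp
qed

end

theorem theorem1p1:
  fixes br :: "'a::euclidean_space \<times> 'b::euclidean_space \<Rightarrow> 'a \<times> 'b \<Rightarrow> 'a \<times> 'b"
    and s y :: real
    and g :: "'a \<times> 'b"
  assumes "heisenberg_type br"
    and "0 < s" and "s < 1"
    and "0 < y"
  shows "conf_frac_Laplacian br s (\<lambda>h. e_kernel s h y) g =
         complex_of_real ((2 * pi * y) powr (2 * s)) * e_kernel (- s) g y"
  using conf_frac_Laplacian_e_kernel[OF assms, of "fst g" "snd g"] by simp

end
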